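(* Let $1\le p\le\infty$ and let $\Omega$ be an open subset of $\mathbb{R}^N$. For a function $u\in C(\Omega)$ the following assertions are equivalent: (i) $u$ is a viscosity solution of $\Delta_p^n u=0$ in $\Omega$; (ii) $u(x)=\mu_p(\varepsilon,u)(x)+o(\varepsilon^2)$ as $\varepsilon\to 0$, in the viscosity sense, for every $x\in\Omega$.
   Context: $B_\varepsilon(x)$ is the open Euclidean ball of radius $\varepsilon$ centered at $x$ in $\mathbb{R}^N$. $p$-mean: for $1\le p\le\infty$ and a function $u$ continuous on $\overline{B_\varepsilon(x)}$, $\mu_p(\varepsilon,u)(x)$ is the unique real number $\mu$ such that $\|u-\mu\|_{L^p(B_\varepsilon(x))}=\min_{\lambda\in\mathbb{R}}\|u-\lambda\|_{L^p(B_\varepsilon(x))}$ (Lebesgue measure). Normalized $p$-Laplacian: for $\phi$ of class $C^2$ near $x$ with $\nabla\phi(x)\neq0$, $$\Delta_p^n\phi=\frac{\nabla\cdot(|\nabla\phi|^{p-2}\nabla\phi)}{|\nabla\phi|^{p-2}}=\Delta\phi+(p-2)\frac{\langle\nabla^2\phi\,\nabla\phi,\nabla\phi\rangle}{|\nabla\phi|^2}\quad(1\le p<\infty),\qquad \Delta_\infty^n\phi=\frac{\langle\nabla^2\phi\,\nabla\phi,\nabla\phi\rangle}{|\nabla\phi|^2}.$$ Viscosity solution: $u\in C(\Omega)$ is a viscosity solution of $\Delta_p^nu=0$ in $\Omega$ if at every $x\in\Omega$ both of the following hold: for any $\phi$ of class $C^2$ near $x$ such that $u-\phi$ has a strict (local)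 minimum at $x$ with $u(x)=\phi(x)$ and $\nabla\phi(x)\ne0$, one has $\Delta_p^n\phi(x)\le0$; and for any $\phi$ of class $C^2$ near $x$ such that $u-\phi$ has a strict (local) maximum at $x$ with $u(x)=\phi(x)$ and $\nabla\phi(x)\neq0$, one has $\Delta_p^n\phi(x)\ge0$. Asymptotic mean value property in the viscosity sense: $u\in C(\Omega)$ satisfies $u(x)=\mu_p(\varepsilon,u)(x)+o(\varepsilon^2)$ as $\varepsilon\to0$ in the viscosity sense at $x\in\Omega$ if both of the following hold: for any $\phi$ of class $C^2$ near $x$ such that $u-\phi$ has a strict (local) minimum at $x$ with $u(x)=\phi(x)$ and $\nabla\phi(x)\ne0$, one has $\phi(x)\ge\mu_p(\varepsilon,\phi)(x)+o(\varepsilon^2)$ as $\varepsilon\to0$; and for any $\phi$ of class $C^2$ near $x$ such that $u-\phi$ has a strict (local) maximum at $x$ with $u(x)=\phi(x)$ and $\nabla\phi(x)\ne0$, one has $\phi(x)\le\mu_p(\varepsilon,\phi)(x)+o(\varepsilon^2)$ as $\varepsilon\to0$. An inequality of the form $a(\varepsilon)\ge b(\varepsilon)+o(\varepsilon^2)$ means that $a(\varepsilon)\ge b(\varepsilon)+r(\varepsilon)$ for all small $\varepsilon>0$, for some function $r$ with $r(\varepsilon)/\varepsilon^2\to0$ as $\varepsilon\to 0$. *)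

theory Defs
  imports "HOL-Probability.Essential_Supremum" "HOL-Library.Landau_Symbols"
begin

definition gradient :: "(real^'n \<Rightarrow> real) \<Rightarrow> real^'n \<Rightarrow> real^'n" where
  "gradient \<phi> x = (\<chi> i. frechet_derivative \<phi> (at x) (axis i 1))"

lemma GDERIV_gradient:
  assumes "\<phi> differentiable (at x)"
  shows "GDERIV \<phi> x :> gradient \<phi> x"
proof -
  have lin: "linear (frechet_derivative \<phi> (at x))"
    using assms by (rule linear_frechet_derivative)
  have "frechet_derivative \<phi> (at x) h = h \<bullet> gradient \<phi> x" for h
  proof -
    have "frechet_derivative \<phi> (at x) h = frechet_derivative \<phi> (at x) (\<Sum>i\<in>UNIV. h$i *\<^sub>R axis i 1)"
      using basis_expansion[of h] by (simp add: scalar_mult_eq_scaleR)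
    also have "\<dots> = h \<bullet> gradient \<phi> x"
      by (simp add: linear_sum[OF lin] linear_scale[OF lin] gradient_def inner_vec_def)
    finally show ?thesis .
  qed
  then show ?thesis
    using assms unfolding gderiv_def frechet_derivative_works by presburger
qed

definition hessian :: "(real^'n \<Rightarrow> real) \<Rightarrow> real^'n \<Rightarrow> real^'n^'n" where
  "hessian \<phi> x = jacobian (gradient \<phi>) (at x)"

definition divergence :: "(real^'n \<Rightarrow> real^'n) \<Rightarrow> real^'n \<Rightarrow> real" where
  "divergence F x = trace (jacobian F (at x))"

definition C2_near :: "(real^'n \<Rightarrow> real) \<Rightarrow> real^'n \<Rightarrow> bool" where
  "C2_near \<phi> x \<longleftrightarrow> (\<exists>U. open U \<and> x \<in> U \<and> \<phi> differentiable_on U \<and>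
     gradient \<phi> differentiable_on U \<and> continuous_on U (hessian \<phi>))"

definition normalized_p_laplacian :: "ereal \<Rightarrow> (real^'n \<Rightarrow> real) \<Rightarrow> real^'n \<Rightarrow> real" where
  "normalized_p_laplacian p \<phi> x =
     (if p = \<infinity>
      then ((hessian \<phi> x *v gradient \<phi> x) \<bullet> gradient \<phi> x) / (norm (gradient \<phi> x))\<^sup>2
      else divergence (\<lambda>y. (norm (gradient \<phi> y) powr (real_of_ereal p - 2)) *\<^sub>R gradient \<phi> y) x
             / norm (gradient \<phi> x) powr (real_of_ereal p - 2))"

text \<open>The Laplacian of \<open>\<phi>\<close> is the trace of its Hessian, so the divergence form agrees with
  the expanded form of the normalized \<open>p\<close>-Laplacian.\<close>

lemma normalized_p_laplacian_finite:
  assumes C2: "C2_near \<phi> x" and nz: "gradient \<phi> x \<noteq> 0" and p: "p \<noteq> \<infinity>"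
  shows "normalized_p_laplacian p \<phi> x = trace (hessian \<phi> x) + (real_of_ereal p - 2) *
     (((hessian \<phi> x *v gradient \<phi> x) \<bullet> gradient \<phi> x) / (norm (gradient \<phi> x))\<^sup>2)"
proof -
  define q where "q = real_of_ereal p - 2"
  define g where "g = gradient \<phi> x"
  define H where "H = hessian \<phi> x"
  define a where "a = norm g"
  have a: "a > 0" using nz by (simp add: a_def g_def)
  obtain U where U: "open U" "x \<in> U" "gradient \<phi> differentiable_on U"
    using C2 unfolding C2_near_def by blast
  then have "gradient \<phi> differentiable (at x)"
    by (metis at_within_open differentiable_on_def)
  then have dG: "(gradient \<phi> has_derivative (\<lambda>h. H *v h)) (at x)"
    unfolding H_def hessian_def using jacobian_works by blast
  have dN: "((\<lambda>y. norm (gradient \<phi> y)) has_derivative (\<lambda>h. (H *v h) \<bullet> sgn g)) (at x)"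
    using has_derivative_compose[OF dG has_derivative_norm] nz by (simp add: g_def inner_commute)
  have dP: "((\<lambda>t. t powr q) has_derivative (\<lambda>t. t * (q * a powr (q - 1)))) (at a)"
    using has_real_derivative_powr[OF a, of q] unfolding has_field_derivative_def
    by (simp add: mult.commute[of _ "q * _"])
  have "((\<lambda>y. norm (gradient \<phi> y) powr q) has_derivative
          (\<lambda>h. ((H *v h) \<bullet> sgn g) * (q * a powr (q - 1)))) (at x)"
    using has_derivative_compose[OF dN, of "\<lambda>t. t powr q"] dP by (simp add: a_def g_def)
  from has_derivative_scaleR[OF this dG]
  have dF: "((\<lambda>y. (norm (gradient \<phi> y) powr q) *\<^sub>R gradient \<phi> y) has_derivative
       (\<lambda>h. (a powr q) *\<^sub>R (H *v h) + (((H *v h) \<bullet> sgn g) * (q * a powr (q - 1))) *\<^sub>R g)) (at x)"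
    by (simp add: a_def g_def)
  have div: "divergence (\<lambda>y. (norm (gradient \<phi> y) powr q) *\<^sub>R gradient \<phi> y) x
     = (\<Sum>i\<in>UNIV. (a powr q) * H$i$i + (((H *v axis i 1) \<bullet> sgn g) * (q * a powr (q - 1))) * g$i)"
    unfolding divergence_def jacobian_def frechet_derivative_at[OF dF, symmetric]
    by (simp add: trace_def matrix_def matrix_vector_mul_component inner_axis)
  have Hg: "(\<Sum>i\<in>UNIV. ((H *v axis i 1) \<bullet> sgn g) * g$i) = (H *v g) \<bullet> sgn g"
  proof -
    have "g = (\<Sum>i\<in>UNIV. g$i *\<^sub>R axis i 1)"
      using basis_expansion[of g] by (simp add: scalar_mult_eq_scaleR)
    then have "H *v g = (\<Sum>i\<in>UNIV. g$i *\<^sub>R (H *v axis i 1))"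
      by (metis (no_types, lifting) linear_sum matrix_vector_mul_linear linear_scale sum.cong)
    then show ?thesis by (simp add: inner_sum_left mult.commute)
  qed
  have "divergence (\<lambda>y. (norm (gradient \<phi> y) powr q) *\<^sub>R gradient \<phi> y) x
     = (a powr q) * trace H + (q * a powr (q - 1)) * (\<Sum>i\<in>UNIV. ((H *v axis i 1) \<bullet> sgn g) * g$i)"
    unfolding div trace_def by (simp add: sum.distrib sum_distrib_left mult_ac)
  also have "\<dots> = (a powr q) * (trace H + q * (((H *v g) \<bullet> g) / a\<^sup>2))"
    unfolding Hg using a
    by (simp add: sgn_div_norm a_def[symmetric] powr_diff field_simps power2_eq_square)
  finally show ?thesis
    using a p unfolding normalized_p_laplacian_def q_def g_def H_def a_def by simp
qed

definition strict_local_min :: "(real^'n \<Rightarrow> real) \<Rightarrow> real^'n \<Rightarrow> bool" where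
  "strict_local_min f x \<longleftrightarrow> (\<forall>\<^sub>F y in at x. f x < f y)"

definition strict_local_max :: "(real^'n \<Rightarrow> real) \<Rightarrow> real^'n \<Rightarrow> bool" where
  "strict_local_max f x \<longleftrightarrow> (\<forall>\<^sub>F y in at x. f y < f x)"

definition Lp_norm :: "ereal \<Rightarrow> (real^'n) set \<Rightarrow> (real^'n \<Rightarrow> real) \<Rightarrow> real" where
  "Lp_norm p S f =
     (if p = \<infinity> then real_of_ereal (esssup (lebesgue_on S) (\<lambda>y. ereal \<bar>f y\<bar>))
      else (LINT y|lebesgue_on S. \<bar>f y\<bar> powr real_of_ereal p) powr (1 / real_of_ereal p))"

definition p_mean :: "ereal \<Rightarrow> real \<Rightarrow> (real^'n \<Rightarrow> real) \<Rightarrow> real^'n \<Rightarrow> real" where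
  "p_mean p \<epsilon> u x = (THE \<mu>. \<forall>c. Lp_norm p (ball x \<epsilon>) (\<lambda>y. u y - \<mu>)
                                \<le> Lp_norm p (ball x \<epsilon>) (\<lambda>y. u y - c))"

text \<open>Functions on an open set \<open>\<Omega>\<close> are total functions here.  The predicates below depend only on
  the values in \<open>\<Omega>\<close>: extrema are local, and only small radii \<open>\<epsilon>\<close> matter.\<close>

definition viscosity_solution :: "ereal \<Rightarrow> (real^'n) set \<Rightarrow> (real^'n \<Rightarrow> real) \<Rightarrow> bool" where
  "viscosity_solution p \<Omega> u \<longleftrightarrow> (\<forall>x\<in>\<Omega>.
     (\<forall>\<phi>. C2_near \<phi> x \<and> strict_local_min (\<lambda>y. u y - \<phi> y) x \<and> u x = \<phi> x \<and> gradient \<phi> x \<noteq> 0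
        \<longrightarrow> normalized_p_laplacian p \<phi> x \<le> 0) \<and>
     (\<forall>\<phi>. C2_near \<phi> x \<and> strict_local_max (\<lambda>y. u y - \<phi> y) x \<and> u x = \<phi> x \<and> gradient \<phi> x \<noteq> 0
        \<longrightarrow> normalized_p_laplacian p \<phi> x \<ge> 0))"

definition viscosity_mean_value :: "ereal \<Rightarrow> (real^'n \<Rightarrow> real) \<Rightarrow> real^'n \<Rightarrow> bool" where
  "viscosity_mean_value p u x \<longleftrightarrow>
     (\<forall>\<phi>. C2_near \<phi> x \<and> strict_local_min (\<lambda>y. u y - \<phi> y) x \<and> u x = \<phi> x \<and> gradient \<phi> x \<noteq> 0
        \<longrightarrow> (\<exists>r\<in>o[at_right 0](\<lambda>\<epsilon>. \<epsilon>\<^sup>2). \<forall>\<^sub>F \<epsilon> in at_right 0. \<phi> x \<ge> p_mean p \<epsilon> \<phi> x + r \<epsilon>)) \<and>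
     (\<forall>\<phi>. C2_near \<phi> x \<and> strict_local_max (\<lambda>y. u y - \<phi> y) x \<and> u x = \<phi> x \<and> gradient \<phi> x \<noteq> 0
        \<longrightarrow> (\<exists>r\<in>o[at_right 0](\<lambda>\<epsilon>. \<epsilon>\<^sup>2). \<forall>\<^sub>F \<epsilon> in at_right 0. \<phi> x \<le> p_mean p \<epsilon> \<phi> x + r \<epsilon>))"

end

theory Submission
  imports Defs
begin

text \<open>Every test function \<open>\<phi>\<close> with \<open>\<nabla>\<phi>(x) \<noteq> 0\<close> satisfies
  \<open>\<mu>\<^sub>p(\<epsilon>, \<phi>)(x) = \<phi>(x) + c \<epsilon>\<^sup>2 \<Delta>\<^sub>p\<^sup>n \<phi>(x) + o(\<epsilon>\<^sup>2)\<close> for some \<open>c > 0\<close>, so both assertions constrain the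
  sign of \<open>\<Delta>\<^sub>p\<^sup>n \<phi>(x)\<close> in the same way.  For \<open>p < \<infinity>\<close>, convexity of \<open>\<lambda> \<mapsto> \<integral> \<bar>\<phi> - \<lambda>\<bar>\<^sup>p\<close> reduces the
  expansion to the sign of \<open>\<integral> J(\<phi> - \<lambda>)\<close> with \<open>J s = \<bar>s\<bar>\<^sup>p\<^sup>-\<^sup>2 s\<close>; after rescaling to the unit ball and a second-order
  Taylor expansion this is the sign of \<open>\<integral> J(g \<bullet> y + \<epsilon> w(y)) dy\<close> for an even \<open>w\<close>.  As \<open>J\<close> is odd, only the
  symmetric difference of \<open>J\<close> contributes.  Its first-order term is \<open>(p - 1) \<integral> \<bar>g \<bullet> y\<bar>\<^sup>p\<^sup>-\<^sup>2 w(y) dy\<close> for \<open>p > 1\<close> and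
  a multiple of the integral of \<open>w\<close> over the disc \<open>g \<bullet> y = 0\<close> for \<open>p = 1\<close>; reflections evaluate both on
  quadratic forms.  For \<open>p = \<infinity>\<close> the mean is the midpoint of the supremum and the infimum over the ball.\<close>

section \<open>Invariance of Lebesgue measure\<close>

text \<open>The constant \<open>c\<close> is never evaluated: the sign argument only needs it
  positive and independent of the Hessian, so it appears as a ratio of two moments. It must be fixed
  before the Hessian, because one estimate from above, applied to \<open>-L\<close> after the change
  \<open>y\<close> to \<open>-y\<close>, is reused as the estimate from below. The coefficient
  \<open>p - 2\<close> of the normalized Laplacian comes from second moments of the weight
  \<open>\<bar>g \<bullet> y\<bar> powr (p - 2)\<close>: by invariance under reflections the moment
  in direction \<open>g\<close> is \<open>p - 1\<close> times that in an orthogonal direction of the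
  same length. For \<open>1 < p < 2\<close> this weight blows up on the hyperplane orthogonal to
  \<open>g\<close> and is integrable only because \<open>p - 2 > -1\<close>; hence the slicing of
  the ball along \<open>g\<close> and the difference bounds valid across the hyperplane. At
  \<open>p = 1\<close> this integrability is lost and \<open>J = sgn\<close> jumps; the perturbation
  is first compared with its value at the projection of \<open>y\<close> onto the hyperplane, after
  which integrals along lines are explicit. Uniqueness of the mean is also delicate there: strict
  convexity fails, and connectedness of the ball replaces it.\<close>

lemma nn_integral_lborel_translate:
  fixes f :: "'a::euclidean_space \<Rightarrow> ennreal"
  assumes [measurable]: "f \<in> borel_measurable borel"
  shows "(\<integral>\<^sup>+x. f (x + c) \<partial>lborel) = (\<integral>\<^sup>+x. f x \<partial>lborel)"
proof -
  have "(\<integral>\<^sup>+x. f x \<partial>lborel) = (\<integral>\<^sup>+x. f x \<partial>distr lborel borel ((+) c))"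
    by (simp add: lborel_distr_plus)
  also have "\<dots> = (\<integral>\<^sup>+x. f (x + c) \<partial>lborel)"
    by (subst nn_integral_distr) (auto simp: add.commute)
  finally show ?thesis by simp
qed

text \<open>Lebesgue measure is determined by translation invariance and the measure of the unit ball:
  integrate \<open>1\<^sub>B(x) 1\<^sub>A(R y + x)\<close> over \<open>x\<close> and \<open>y\<close> in both orders.\<close>

lemma lborel_distr_orthogonal:
  fixes R :: "'a::euclidean_space \<Rightarrow> 'a"
  assumes R: "orthogonal_transformation R"
  shows "distr lborel borel R = lborel"
proof (rule measure_eqI)
  show "sets (distr lborel borel R) = sets lborel" by simp
  fix A assume "A \<in> sets (distr lborel borel R)"
  then have [measurable]: "A \<in> sets borel" by simp
  have lin: "linear R" using R by (rule orthogonal_transformation_linear)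
  have [measurable]: "R \<in> borel_measurable borel"
    using lin by (intro borel_measurable_continuous_onI linear_continuous_on linear_conv_bounded_linear[THEN iffD1])
  have surj: "\<exists>y. R y = x" for x
    using orthogonal_transformation_surj[OF R] by (metis surjD)
  define B where "B = ball (0::'a) 1"
  have [measurable]: "B \<in> sets borel" by (simp add: B_def)
  define i where "i A x = (indicator A x :: ennreal)" for A and x :: 'a
  have [measurable]: "i A \<in> borel_measurable borel" "i B \<in> borel_measurable borel" unfolding i_def by measurable
  have Ball: "(\<integral>\<^sup>+y. i B (x - R y) \<partial>lborel) = emeasure lborel B" for x
  proof -
    obtain x' where x': "R x' = x" using surj by blast
    have "i B (x - R y) = i B (y + - x')" for y
      unfolding i_def B_def x'[symmetric] linear_diff[OF lin, symmetric]
      by (simp add: orthogonal_transformation_norm[OF R] indicator_def norm_minus_commute)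
    then have "(\<integral>\<^sup>+y. i B (x - R y) \<partial>lborel) = (\<integral>\<^sup>+y. i B y \<partial>lborel)"
      by (simp only: nn_integral_lborel_translate \<open>i B \<in> borel_measurable borel\<close>)
    then show ?thesis by (simp add: i_def)
  qed
  have "emeasure lborel (R -` A) * emeasure lborel B = (\<integral>\<^sup>+x. i B x * emeasure lborel (R -` A) \<partial>lborel)"
    by (subst nn_integral_multc) (auto simp: i_def[abs_def] mult.commute)
  also have "\<dots> = (\<integral>\<^sup>+x. \<integral>\<^sup>+y. i B x * i A (R y + x) \<partial>lborel \<partial>lborel)"
  proof (rule nn_integral_cong)
    fix x
    obtain x' where x': "R x' = x" using surj by blast
    have "(\<integral>\<^sup>+y. i A (R y + x) \<partial>lborel) = (\<integral>\<^sup>+y. i A (R (y + x')) \<partial>lborel)"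
      by (simp add: x'[symmetric] linear_add[OF lin])
    also have "\<dots> = (\<integral>\<^sup>+y. i A (R y) \<partial>lborel)"
      by (rule nn_integral_lborel_translate[where f="\<lambda>y. i A (R y)"]) measurable
    also have "\<dots> = (\<integral>\<^sup>+y. indicator (R -` A) y \<partial>lborel)"
      by (simp add: i_def indicator_def)
    also have "\<dots> = emeasure lborel (R -` A)"
      using measurable_sets[OF \<open>R \<in> borel_measurable borel\<close> \<open>A \<in> sets borel\<close>]
      by (subst nn_integral_indicator) auto
    finally show "i B x * emeasure lborel (R -` A) = (\<integral>\<^sup>+y. i B x * i A (R y + x) \<partial>lborel)"
      by (subst nn_integral_cmult) auto
  qed
  also have "\<dots> = (\<integral>\<^sup>+y. \<integral>\<^sup>+x. i B x * i A (R y + x) \<partial>lborel \<partial>lborel)"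
    by (rule lborel_pair.Fubini'[symmetric]) measurable
  also have "\<dots> = (\<integral>\<^sup>+y. \<integral>\<^sup>+x. i B (x - R y) * i A x \<partial>lborel \<partial>lborel)"
  proof (rule nn_integral_cong)
    fix y
    have "(\<integral>\<^sup>+x. i B (x - R y) * i A x \<partial>lborel) = (\<integral>\<^sup>+x. i B (x + R y - R y) * i A (x + R y) \<partial>lborel)"
      by (rule nn_integral_lborel_translate[symmetric, where f="\<lambda>x. i B (x - R y) * i A x"]) measurable
    then show "(\<integral>\<^sup>+x. i B x * i A (R y + x) \<partial>lborel) = (\<integral>\<^sup>+x. i B (x - R y) * i A x \<partial>lborel)"
      by (simp add: add.commute)
  qed
  also have "\<dots> = (\<integral>\<^sup>+x. \<integral>\<^sup>+y. i B (x - R y) * i A x \<partial>lborel \<partial>lborel)"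
    by (rule lborel_pair.Fubini') measurable
  also have "\<dots> = (\<integral>\<^sup>+x. emeasure lborel B * i A x \<partial>lborel)"
    by (intro nn_integral_cong) (simp add: nn_integral_multc Ball)
  also have "\<dots> = emeasure lborel A * emeasure lborel B"
    by (subst nn_integral_cmult) (auto simp: i_def[abs_def] mult.commute)
  finally have "emeasure lborel (R -` A) * emeasure lborel B = emeasure lborel A * emeasure lborel B" .
  moreover have "emeasure lborel B \<noteq> 0"
    unfolding B_def by (simp add: emeasure_ball less_imp_neq[OF unit_ball_vol_pos, symmetric])
  moreover have "emeasure lborel B \<noteq> \<infinity>"
    unfolding B_def using emeasure_lborel_ball_finite[of "0::'a" 1] by (simp add: less_top)
  ultimately have "emeasure lborel (R -` A) = emeasure lborel A"
    by (metis ennreal_mult_cancel_left infinity_ennreal_def mult.commute)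
  then show "emeasure (distr lborel borel R) A = emeasure lborel A"
    by (subst emeasure_distr) auto
qed

lemma integral_lborel_orthogonal:
  fixes f :: "'a::euclidean_space \<Rightarrow> real" and R :: "'a \<Rightarrow> 'a"
  assumes R: "orthogonal_transformation R" and f: "f \<in> borel_measurable borel"
  shows "(LINT y|lborel. f (R y)) = (LINT y|lborel. f y)"
proof -
  have [measurable]: "R \<in> borel_measurable borel"
    using orthogonal_transformation_linear[OF R]
    by (intro borel_measurable_continuous_onI linear_continuous_on linear_conv_bounded_linear[THEN iffD1])
  have "(LINT y|lborel. f y) = (LINT y|distr lborel borel R. f y)"
    by (simp add: lborel_distr_orthogonal[OF R])
  also have "\<dots> = (LINT y|lborel. f (R y))"
    using f by (intro integral_distr) auto
  finally show ?thesis by simp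
qed

lemma integral_lborel_scale_translate:
  fixes f :: "'a::euclidean_space \<Rightarrow> real"
  assumes r: "r > 0" and f [measurable]: "f \<in> borel_measurable borel"
  shows "(LINT y|lborel. f y) = r ^ DIM('a) * (LINT y|lborel. f (x + r *\<^sub>R y))"
proof -
  have "(LINT y|lborel. f y) = (LINT y|density (distr lborel borel (\<lambda>y. x + r *\<^sub>R y)) (\<lambda>_. \<bar>r\<bar> ^ DIM('a)). f y)"
    using lborel_affine[of r x] r by simp
  also have "\<dots> = r ^ DIM('a) * (LINT y|lborel. f (x + r *\<^sub>R y))"
    using r by (subst integral_real_density) (auto simp: integral_distr)
  finally show ?thesis .
qed

section \<open>Signed powers\<close>

text \<open>With \<open>q = p - 1\<close> this is, up to the factor \<open>p\<close>, the derivative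
  of \<open>\<bar>s\<bar> powr p\<close>. The factor \<open>sgn s\<close> makes \<open>q = 0\<close>
  give \<open>sgn\<close>, the odd choice of subgradient when \<open>p = 1\<close>.\<close>

definition signed_powr :: "real \<Rightarrow> real \<Rightarrow> real" where
  "signed_powr q s = sgn s * \<bar>s\<bar> powr q"

lemma signed_powr_zero [simp]: "signed_powr q 0 = 0"
  by (simp add: signed_powr_def)

lemma signed_powr_minus [simp]: "signed_powr q (- s) = - signed_powr q s"
  by (simp add: signed_powr_def sgn_minus)

lemma signed_powr_exponent_zero: "signed_powr 0 s = sgn s"
  by (simp add: signed_powr_def sgn_if)

text \<open>The case \<open>s = 0\<close> relies on \<open>0 powr q = 0\<close> for every
  \<open>q\<close>, also for \<open>q = 0\<close>.\<close>

lemma abs_signed_powr [simp]: "\<bar>signed_powr q s\<bar> = \<bar>s\<bar> powr q"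
  by (simp add: signed_powr_def abs_mult abs_sgn_eq)

lemma signed_powr_pos: "s > 0 \<Longrightarrow> signed_powr q s = s powr q"
  by (simp add: signed_powr_def)

lemma signed_powr_mono:
  assumes "q \<ge> 0" "s \<le> t" shows "signed_powr q s \<le> signed_powr q t"
proof -
  consider "0 \<le> s" | "s < 0" "0 \<le> t" | "t < 0" using \<open>s \<le> t\<close> by linarith
  then show ?thesis
  proof cases
    case 1 then show ?thesis using assms by (auto simp: signed_powr_def sgn_if powr_mono2)
  next
    case 2
    then have "signed_powr q s \<le> 0" "signed_powr q t \<ge> 0" by (auto simp: signed_powr_def sgn_if)
    then show ?thesis by linarith
  next
    case 3
    then show ?thesis using assms by (auto simp: signed_powr_def sgn_if powr_mono2)
  qed
qed

lemma signed_powr_scale: "r > 0 \<Longrightarrow> signed_powr q (r * s) = r powr q * signed_powr q s"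
  by (simp add: signed_powr_def sgn_mult abs_mult powr_mult)

lemma borel_measurable_signed_powr [measurable (raw)]:
  assumes [measurable]: "f \<in> borel_measurable M"
  shows "(\<lambda>x. signed_powr q (f x)) \<in> borel_measurable M"
  unfolding signed_powr_def by measurable

text \<open>Young's inequality for the product of \<open>t\<close> and
  \<open>a powr (p - 1)\<close>, with exponents \<open>p\<close> and \<open>p / (p - 1)\<close>,
  rearranges to the tangent bound and includes \<open>t = 0\<close>. At \<open>p = 1\<close> there
  is no finite conjugate exponent, but both sides are linear.\<close>

lemma powr_above_tangent:
  assumes p: "p \<ge> 1" and a: "a > 0" and t: "t \<ge> 0"
  shows "a powr p + p * a powr (p - 1) * (t - a) \<le> t powr (p::real)"
proof (cases "p = 1")
  case True then show ?thesis using a t by (cases "t = 0") auto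
next
  case False
  then have p1: "p > 1" using p by simp
  have "t * a powr (p - 1) \<le> t powr p / p + (a powr (p - 1)) powr (p / (p - 1)) / (p / (p - 1))"
    using p1 a t by (intro Youngs_inequality) (auto simp: field_simps)
  also have "(a powr (p - 1)) powr (p / (p - 1)) = a powr p"
    using p1 by (simp add: powr_powr)
  also have "t powr p / p + a powr p / (p / (p - 1)) = (t powr p + (p - 1) * a powr p) / p"
    using p1 by (simp add: field_simps)
  finally have "p * (t * a powr (p - 1)) \<le> t powr p + (p - 1) * a powr p"
    using p1 by (simp add: field_simps)
  moreover have "a powr (p - 1) * a = a powr p"
    using a by (simp add: powr_diff)
  ultimately show ?thesis by (simp add: algebra_simps)
qed

text \<open>Since \<open>\<bar>s - h\<bar> - \<bar>s\<bar> \<ge> - (sgn s * h)\<close>, the tangent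
  bound at \<open>\<bar>s\<bar>\<close> suffices. At \<open>s = 0\<close> the chosen slope is 0, a
  valid subgradient even for \<open>p = 1\<close>.\<close>

lemma abs_powr_subgradient:
  assumes p: "p \<ge> 1"
  shows "\<bar>s\<bar> powr p - p * signed_powr (p - 1) s * h \<le> \<bar>s - h\<bar> powr p"
proof (cases "s = 0")
  case False
  have "- (p * \<bar>s\<bar> powr (p - 1)) * (sgn s * h) \<le> p * \<bar>s\<bar> powr (p - 1) * (\<bar>s - h\<bar> - \<bar>s\<bar>)"
  proof -
    have "- (sgn s * h) \<le> \<bar>s - h\<bar> - \<bar>s\<bar>" using False by (auto simp: sgn_if)
    from mult_left_mono[OF this, of "p * \<bar>s\<bar> powr (p - 1)"] show ?thesis using p by simp
  qed
  moreover have "\<bar>s\<bar> powr p + p * \<bar>s\<bar> powr (p - 1) * (\<bar>s - h\<bar> - \<bar>s\<bar>) \<le> \<bar>s - h\<bar> powr p"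
    using False p by (intro powr_above_tangent) auto
  ultimately show ?thesis by (simp add: signed_powr_def mult_ac)
qed auto

text \<open>Average the tangent bounds taken at the midpoint: the linear terms cancel.\<close>

lemma powr_midpoint_le:
  fixes a b p :: real
  assumes p: "p \<ge> 1" and "a \<ge> 0" "b \<ge> 0"
  shows "((a + b) / 2) powr p \<le> (a powr p + b powr p) / 2"
proof (cases "a + b = 0")
  case False
  define m where "m = (a + b) / 2"
  have m: "m > 0" using assms False by (auto simp: m_def)
  have "m powr p + p * m powr (p - 1) * (a - m) \<le> a powr p"
    "m powr p + p * m powr (p - 1) * (b - m) \<le> b powr p"
    using powr_above_tangent[OF p m] assms by auto
  moreover have "p * m powr (p - 1) * (a - m) + p * m powr (p - 1) * (b - m) = 0"
    unfolding distrib_left[symmetric] m_def by simp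
  ultimately show ?thesis unfolding m_def by simp
qed (use assms in auto)

lemma abs_powr_midpoint_le:
  fixes a b p s :: real
  assumes p: "p \<ge> 1"
  shows "\<bar>s - (a + b) / 2\<bar> powr p \<le> (\<bar>s - a\<bar> powr p + \<bar>s - b\<bar> powr p) / 2"
proof -
  have "\<bar>s - (a + b) / 2\<bar> \<le> (\<bar>s - a\<bar> + \<bar>s - b\<bar>) / 2" by (auto simp: abs_if field_simps)
  then have "\<bar>s - (a + b) / 2\<bar> powr p \<le> ((\<bar>s - a\<bar> + \<bar>s - b\<bar>) / 2) powr p"
    using p by (intro powr_mono2) auto
  also have "\<dots> \<le> (\<bar>s - a\<bar> powr p + \<bar>s - b\<bar> powr p) / 2"
    by (rule powr_midpoint_le[OF p]) auto
  finally show ?thesis .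
qed

text \<open>Strictness comes from the triangle inequality with \<open>s\<close> strictly between
  \<open>a\<close> and \<open>b\<close>, not from strict convexity of the power, so
  \<open>p = 1\<close> is included.\<close>

lemma abs_powr_midpoint_less:
  fixes a b p s :: real
  assumes p: "p \<ge> 1" and s: "a < s" "s < b"
  shows "\<bar>s - (a + b) / 2\<bar> powr p < (\<bar>s - a\<bar> powr p + \<bar>s - b\<bar> powr p) / 2"
proof -
  have "\<bar>s - (a + b) / 2\<bar> < (\<bar>s - a\<bar> + \<bar>s - b\<bar>) / 2" using s by (auto simp: abs_if field_simps)
  then have "\<bar>s - (a + b) / 2\<bar> powr p < ((\<bar>s - a\<bar> + \<bar>s - b\<bar>) / 2) powr p"
    using p by (intro powr_less_mono2) auto
  also have "\<dots> \<le> (\<bar>s - a\<bar> powr p + \<bar>s - b\<bar> powr p) / 2"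
    by (rule powr_midpoint_le[OF p]) auto
  finally show ?thesis .
qed

lemma has_real_derivative_signed_powr:
  assumes a: "a \<noteq> 0"
  shows "(signed_powr q has_real_derivative q * \<bar>a\<bar> powr (q - 1)) (at a)"
proof -
  have pos: "(signed_powr q has_real_derivative q * \<bar>a\<bar> powr (q - 1)) (at a)" if a: "a > 0" for a
  proof (rule DERIV_cong_ev[THEN iffD2, OF refl _ refl])
    show "\<forall>\<^sub>F x in nhds a. signed_powr q x = x powr q"
      using eventually_nhds_in_open[of "{0<..}" a] a by (auto elim!: eventually_mono simp: signed_powr_pos)
    show "((\<lambda>x. x powr q) has_real_derivative q * \<bar>a\<bar> powr (q - 1)) (at a)"
      using has_real_derivative_powr[OF a, of q] a by simp
  qed
  show ?thesis
  proof (cases "a > 0")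
    case False
    then have "((\<lambda>x. - signed_powr q (- x)) has_real_derivative - (q * \<bar>- a\<bar> powr (q - 1) * - 1)) (at a)"
      using a by (intro DERIV_minus DERIV_chain2[OF pos, of "uminus"]) (auto intro!: derivative_eq_intros)
    then show ?thesis by simp
  qed (rule pos)
qed

lemma continuous_signed_powr:
  assumes "q > 0" shows "isCont (signed_powr q) a"
proof (cases "a = 0")
  case False
  then show ?thesis using has_real_derivative_signed_powr DERIV_isCont by blast
next
  case True
  have "((\<lambda>x. \<bar>x\<bar> powr q) \<longlongrightarrow> \<bar>0\<bar> powr q) (at (0::real))"
    using assms by (intro tendsto_intros tendsto_powr') auto
  then have "((\<lambda>x. \<bar>signed_powr q x\<bar>) \<longlongrightarrow> 0) (at 0)" by simp
  then have "(signed_powr q \<longlongrightarrow> 0) (at 0)" by (simp only: tendsto_rabs_zero_iff)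
  then show ?thesis using True by (simp add: isCont_def)
qed

text \<open>The bound also holds for \<open>\<bar>h\<bar> > \<bar>a\<bar>\<close>; this gives an integrable majorant across the hyperplane \<open>a = 0\<close>.\<close>

lemma signed_powr_symmetric_difference_bound_le1:
  assumes q: "0 < q" "q \<le> 1" and a: "a \<noteq> 0"
  shows "\<bar>signed_powr q (a + h) - signed_powr q (a - h)\<bar> \<le> 4 * \<bar>h\<bar> * \<bar>a\<bar> powr (q - 1)"
proof -
  have main: "\<bar>signed_powr q (a + h) - signed_powr q (a - h)\<bar> \<le> 4 * h * a powr (q - 1)" if a: "a > 0" and h: "h \<ge> 0" for a h
  proof (cases "h < a")
    case True
    \<comment> \<open>Homogeneity scales \<open>a\<close> out. With an exponent in
      \<open>(0, 1]\<close>, numbers above 1 shrink and numbers below 1 grow, so the increment from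
      \<open>1 - t\<close> to \<open>1 + t\<close> is at most \<open>2 * t\<close>.\<close>
    define t where "t = h / a"
    have t: "0 \<le> t" "t < 1" "h = a * t" using a h True by (auto simp: t_def)
    have 1: "signed_powr q (a + h) = a powr q * (1 + t) powr q"
      using a t by (simp add: signed_powr_pos powr_mult[symmetric] algebra_simps add_pos_nonneg)
    have 2: "signed_powr q (a - h) = a powr q * (1 - t) powr q"
      using a t True by (simp add: signed_powr_pos powr_mult[symmetric] algebra_simps)
    have "(1 + t) powr q \<le> (1 + t) powr 1" "(1 - t) powr 1 \<le> (1 - t) powr q"
      using q t powr_mono[of q 1 "1 + t"] powr_mono'[of q 1 "1 - t"] by auto
    then have "(1 + t) powr q - (1 - t) powr q \<le> 2 * t" using t by simp
    then have "a powr q * ((1 + t) powr q - (1 - t) powr q) \<le> a powr q * (2 * t)"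
      by (intro mult_left_mono) auto
    also have "\<dots> = 2 * h * a powr (q - 1)" using a t by (simp add: powr_diff)
    also have "\<dots> \<le> 4 * h * a powr (q - 1)" using h by (intro mult_right_mono) auto
    finally have "signed_powr q (a + h) - signed_powr q (a - h) \<le> 4 * h * a powr (q - 1)" using 1 2 by (simp add: algebra_simps)
    moreover have "signed_powr q (a - h) \<le> signed_powr q (a + h)" using h q by (intro signed_powr_mono) auto
    ultimately show ?thesis by linarith
  next
    case False
    then have h: "h \<ge> a" "h > 0" using a by auto
    \<comment> \<open>For \<open>h \<ge> a\<close> no cancellation is available: each value is of
      order \<open>h powr q\<close>, and \<open>h powr (q - 1) \<le> a powr (q - 1)\<close> because
      the exponent is not positive.\<close>
    have *: "\<bar>signed_powr q s\<bar> \<le> 2 * h powr q" if "\<bar>s\<bar> \<le> 2 * h" for s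
    proof -
      have "\<bar>s\<bar> powr q \<le> (2 * h) powr q" using that q by (intro powr_mono2) auto
      also have "\<dots> = 2 powr q * h powr q" using h by (simp add: powr_mult)
      also have "\<dots> \<le> 2 powr 1 * h powr q" using q by (intro mult_right_mono powr_mono) auto
      finally show ?thesis by simp
    qed
    have "\<bar>signed_powr q (a + h) - signed_powr q (a - h)\<bar> \<le> \<bar>signed_powr q (a + h)\<bar> + \<bar>signed_powr q (a - h)\<bar>" by linarith
    also have "\<dots> \<le> 2 * h powr q + 2 * h powr q" using h a by (intro add_mono *) auto
    also have "\<dots> = 4 * h * h powr (q - 1)" using h by (simp add: powr_diff)
    also have "\<dots> \<le> 4 * h * a powr (q - 1)"
      using h a q by (intro mult_left_mono powr_mono2') auto
    finally show ?thesis .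
  qed
  \<comment> \<open>Changing the sign of \<open>a\<close> or of \<open>h\<close> leaves the absolute
    difference unchanged, so nonnegative arguments suffice.\<close>
  define D where "D a h = \<bar>signed_powr q (a + h) - signed_powr q (a - h)\<bar>" for a h
  have "D a (- h) = D a h" "D (- a) h = D a h" for a h
    using signed_powr_minus[of q "a - h"] signed_powr_minus[of q "a + h"] by (simp_all add: D_def add.commute)
  then have red: "D a h = D \<bar>a\<bar> \<bar>h\<bar>" by (simp add: abs_if)
  show ?thesis using red main[of "\<bar>a\<bar>" "\<bar>h\<bar>"] a by (simp add: D_def)
qed

text \<open>A mean value bound on \<open>[-R, R]\<close> with
  \<open>R = \<bar>a\<bar> + \<bar>h\<bar>\<close>: the tangent inequality at the larger endpoint
  controls positive intervals, oddness the negative ones, and an interval straddling 0 is split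
  there.\<close>

lemma signed_powr_symmetric_difference_bound_ge1:
  assumes q: "1 \<le> q"
  shows "\<bar>signed_powr q (a + h) - signed_powr q (a - h)\<bar> \<le> 2 * q * \<bar>h\<bar> * (\<bar>a\<bar> + \<bar>h\<bar>) powr (q - 1)"
proof -
  have step: "\<bar>signed_powr q s - signed_powr q t\<bar> \<le> q * \<bar>s - t\<bar> * R powr (q - 1)"
    if "\<bar>s\<bar> \<le> R" "\<bar>t\<bar> \<le> R" for s t R
  proof -
    have main: "signed_powr q t - signed_powr q s \<le> q * (t - s) * R powr (q - 1)" if "0 \<le> s" "s \<le> t" "t \<le> R" for s t
    proof (cases "t = 0")
      case False
      then have t: "t > 0" using that by simp
      have "t powr q + q * t powr (q - 1) * (s - t) \<le> s powr q"
        using that t q by (intro powr_above_tangent) auto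
      moreover have "signed_powr q s = s powr q" using that by (cases "s = 0") (auto simp: signed_powr_def)
      ultimately have "signed_powr q t - signed_powr q s \<le> q * (t - s) * t powr (q - 1)"
        using t by (simp add: signed_powr_pos algebra_simps)
      also have "\<dots> \<le> q * (t - s) * R powr (q - 1)"
        using that t q by (intro mult_left_mono powr_mono2) auto
      finally show ?thesis .
    qed (use that in auto)
    have full: "signed_powr q t - signed_powr q s \<le> q * (t - s) * R powr (q - 1)" if "s \<le> t" "\<bar>s\<bar> \<le> R" "\<bar>t\<bar> \<le> R" for s t
    proof -
      consider "0 \<le> s" | "s < 0" "0 \<le> t" | "t < 0" by linarith
      then show ?thesis
      proof cases
        case 1 then show ?thesis using that main by auto
      next
        case 2
        have "signed_powr q t - signed_powr q 0 \<le> q * (t - 0) * R powr (q - 1)" using 2 that by (intro main) auto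
        moreover have "signed_powr q (-s) - signed_powr q 0 \<le> q * (-s - 0) * R powr (q - 1)" using 2 that by (intro main) auto
        ultimately show ?thesis by (simp add: algebra_simps)
      next
        case 3
        have "signed_powr q (-s) - signed_powr q (-t) \<le> q * (-s - -t) * R powr (q - 1)" using 3 that by (intro main) auto
        then show ?thesis by (simp add: algebra_simps)
      qed
    qed
    show ?thesis
      using full[of s t] full[of t s] that signed_powr_mono[of q s t] signed_powr_mono[of q t s] q
      by (cases "s \<le> t") auto
  qed
  have "\<bar>signed_powr q (a + h) - signed_powr q (a - h)\<bar> \<le> q * \<bar>(a + h) - (a - h)\<bar> * (\<bar>a\<bar> + \<bar>h\<bar>) powr (q - 1)"
    by (rule step) linarith+
  then show ?thesis by (simp add: abs_mult)
qed

lemma tendsto_signed_powr_symmetric_difference: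
  assumes a: "a \<noteq> 0"
  shows "((\<lambda>\<epsilon>. (signed_powr q (a + \<epsilon> * w) - signed_powr q (a - \<epsilon> * w)) / (2 * \<epsilon>)) \<longlongrightarrow> q * \<bar>a\<bar> powr (q - 1) * w) (at 0)"
proof -
  have "((\<lambda>\<epsilon>. signed_powr q (a + \<epsilon> * w) - signed_powr q (a - \<epsilon> * w)) has_real_derivative
        q * \<bar>a + 0 * w\<bar> powr (q - 1) * w - q * \<bar>a - 0 * w\<bar> powr (q - 1) * (- w)) (at 0)"
    using a by (intro DERIV_diff DERIV_chain2[OF has_real_derivative_signed_powr]) (auto intro!: derivative_eq_intros)
  then have "((\<lambda>\<epsilon>. (signed_powr q (a + \<epsilon> * w) - signed_powr q (a - \<epsilon> * w)) / \<epsilon>) \<longlongrightarrow> 2 * (q * \<bar>a\<bar> powr (q - 1) * w)) (at 0)"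
    by (simp add: has_field_derivative_iff mult_ac)
  then have "((\<lambda>\<epsilon>. (signed_powr q (a + \<epsilon> * w) - signed_powr q (a - \<epsilon> * w)) / \<epsilon> / 2) \<longlongrightarrow> 2 * (q * \<bar>a\<bar> powr (q - 1) * w) / 2) (at 0)"
    by (intro tendsto_intros) auto
  then show ?thesis by (simp add: mult.commute)
qed

section \<open>Existence, uniqueness and location of the \<open>p\<close>-mean\<close>

lemma integrable_lebesgue_on_ball:
  fixes h :: "real^'n \<Rightarrow> real"
  assumes "h \<in> borel_measurable (lebesgue_on (ball x r))" and "\<And>y. y \<in> ball x r \<Longrightarrow> \<bar>h y\<bar> \<le> C"
  shows "integrable (lebesgue_on (ball x r)) h"
proof -
  interpret finite_measure "lebesgue_on (ball x r)"
    by (intro finite_measure_lebesgue_on) auto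
  show ?thesis
    by (rule integrable_const_bound[of _ C]) (use assms in auto)
qed

text \<open>The set where a continuous function exceeds \<open>C\<close> is open, and a nonempty
  open set is not negligible.\<close>

lemma AE_lebesgue_on_continuous_le:
  fixes h :: "real^'n \<Rightarrow> real"
  assumes B: "open B" and h: "continuous_on B h" and AE: "AE y in lebesgue_on B. h y \<le> C" and y: "y \<in> B"
  shows "h y \<le> C"
proof (rule ccontr)
  assume "\<not> h y \<le> C"
  define W where "W = {y\<in>B. C < h y}"
  have "open (h -` {C<..} \<inter> B)" using continuous_on_open_vimage[OF B, THEN iffD1, OF h] by simp
  also have "h -` {C<..} \<inter> B = W" by (auto simp: W_def)
  finally have "open W" .
  moreover have "negligible W"
  proof -
    have "AE y in lebesgue. y \<in> B \<longrightarrow> h y \<le> C"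
      using AE B by (subst (asm) AE_restrict_space_iff) auto
    then have "AE y in lebesgue. y \<notin> W" by (auto simp: W_def elim!: eventually_mono)
    then have "W \<in> null_sets lebesgue" using \<open>open W\<close> by (subst AE_iff_null_sets) auto
    then show ?thesis by (simp add: negligible_iff_null_sets)
  qed
  ultimately have "W = {}" using open_not_negligible by blast
  then show False using y \<open>\<not> h y \<le> C\<close> by (auto simp: W_def)
qed

lemma continuous_integral_zero_imp_nonpos:
  fixes h :: "real^'n \<Rightarrow> real"
  assumes "integrable (lebesgue_on (ball x r)) h" "continuous_on (ball x r) h"
    and "\<And>y. y \<in> ball x r \<Longrightarrow> 0 \<le> h y" and "(LINT y|lebesgue_on (ball x r). h y) \<le> 0" and "y \<in> ball x r"
  shows "h y \<le> 0"
proof -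
  have "(LINT y|lebesgue_on (ball x r). h y) = 0"
    using assms by (intro antisym integral_nonneg_AE AE_I2) auto
  then have "AE y in lebesgue_on (ball x r). h y = 0"
    using assms by (subst (asm) integral_nonneg_eq_0_iff_AE) (auto intro!: AE_I2)
  then have "AE y in lebesgue_on (ball x r). h y \<le> 0" by (auto elim!: eventually_mono)
  then show ?thesis using assms by (intro AE_lebesgue_on_continuous_le[of "ball x r"]) auto
qed

section \<open>Minimizers of the energy of a bounded continuous function on a ball\<close>

context
  fixes u :: "real^'n \<Rightarrow> real" and x :: "real^'n" and r p K :: real
  assumes cont: "continuous_on (ball x r) u" and bdd: "\<And>y. y \<in> ball x r \<Longrightarrow> \<bar>u y\<bar> \<le> K"
    and r: "r > 0" and p: "p \<ge> 1"
begin

lemma u_measurable: "u \<in> borel_measurable (lebesgue_on (ball x r))"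
  using cont by (intro continuous_imp_measurable_on_sets_lebesgue) auto

lemma integrable_p_energy: "integrable (lebesgue_on (ball x r)) (\<lambda>y. \<bar>u y - c\<bar> powr p)"
proof (rule integrable_lebesgue_on_ball)
  note u_measurable[measurable]
  show "(\<lambda>y. \<bar>u y - c\<bar> powr p) \<in> borel_measurable (lebesgue_on (ball x r))" by measurable
  show "\<bar>\<bar>u y - c\<bar> powr p\<bar> \<le> (K + \<bar>c\<bar>) powr p" if "y \<in> ball x r" for y
    using bdd[OF that] p by (auto intro!: powr_mono2)
qed

lemma integrable_signed_powr: "integrable (lebesgue_on (ball x r)) (\<lambda>y. signed_powr (p - 1) (u y - c))"
proof (rule integrable_lebesgue_on_ball)
  note u_measurable[measurable]
  show "(\<lambda>y. signed_powr (p - 1) (u y - c)) \<in> borel_measurable (lebesgue_on (ball x r))" by measurable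
  show "\<bar>signed_powr (p - 1) (u y - c)\<bar> \<le> (K + \<bar>c\<bar>) powr (p - 1)" if "y \<in> ball x r" for y
    using bdd[OF that] p by (auto intro!: powr_mono2)
qed

definition "p_energy c = (LINT y|lebesgue_on (ball x r). \<bar>u y - c\<bar> powr p)"

lemma p_energy_nonneg: "0 \<le> p_energy c"
  unfolding p_energy_def by (intro integral_nonneg_AE AE_I2) auto

text \<open>The slope at \<open>c\<close> is \<open>-p\<close> times the integral of the signed
  power, so the sign of that integral tells on which side of \<open>c\<close> the minimizer lies.
  This is the source of the two sign criteria for the mean below.\<close>

lemma p_energy_subgradient:
  "p_energy c - p * (LINT y|lebesgue_on (ball x r). signed_powr (p - 1) (u y - c)) * (d - c) \<le> p_energy d"
proof -
  have "p_energy c - p * (LINT y|lebesgue_on (ball x r). signed_powr (p - 1) (u y - c)) * (d - c)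
    = (LINT y|lebesgue_on (ball x r). \<bar>u y - c\<bar> powr p - p * signed_powr (p - 1) (u y - c) * (d - c))"
    unfolding p_energy_def using integrable_p_energy integrable_signed_powr by simp
  also have "\<dots> \<le> p_energy d"
    unfolding p_energy_def
  proof (rule integral_mono)
    show "\<bar>u y - c\<bar> powr p - p * signed_powr (p - 1) (u y - c) * (d - c) \<le> \<bar>u y - d\<bar> powr p" for y
      using abs_powr_subgradient[OF p, of "u y - c" "d - c"] by simp
  qed (use integrable_p_energy integrable_signed_powr in simp_all)
  finally show ?thesis .
qed

lemma continuous_p_energy: "continuous_on UNIV p_energy"
proof (rule continuous_at_imp_continuous_on, intro ballI continuous_at_sequentiallyI)
  fix c and X :: "nat \<Rightarrow> real" assume X: "X \<longlonglongrightarrow> c"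
  then obtain L where L: "\<And>n. \<bar>X n\<bar> \<le> L"
    using convergent_imp_bounded by (metis bounded_iff rangeI real_norm_def)
  note u_measurable[measurable]
  show "(\<lambda>n. p_energy (X n)) \<longlonglongrightarrow> p_energy c"
    unfolding p_energy_def
  proof (rule integral_dominated_convergence[where w="\<lambda>_. (K + L) powr p"])
    show "integrable (lebesgue_on (ball x r)) (\<lambda>_. (K + L) powr p)"
      by (rule integrable_lebesgue_on_ball) auto
    show "AE y in lebesgue_on (ball x r). (\<lambda>n. \<bar>u y - X n\<bar> powr p) \<longlonglongrightarrow> \<bar>u y - c\<bar> powr p"
      using X p by (intro AE_I2 tendsto_powr' tendsto_intros) auto
    show "AE y in lebesgue_on (ball x r). norm (\<bar>u y - X n\<bar> powr p) \<le> (K + L) powr p" for n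
    proof (rule AE_I2)
      fix y assume "y \<in> space (lebesgue_on (ball x r))"
      then show "norm (\<bar>u y - X n\<bar> powr p) \<le> (K + L) powr p"
        using bdd[of y] L[of n] p by (auto intro!: powr_mono2)
    qed
  qed measurable
qed

lemma p_energy_minimizer_exists: "\<exists>\<mu>. \<forall>c. p_energy \<mu> \<le> p_energy c"
proof -
  have K: "0 \<le> K" using bdd[of x] r by auto
  have "\<exists>\<mu>\<in>{-K..K}. \<forall>c\<in>{-K..K}. p_energy \<mu> \<le> p_energy c"
    using K continuous_on_subset[OF continuous_p_energy] by (intro continuous_attains_inf) auto
  then obtain \<mu> where \<mu>: "\<And>c. c \<in> {-K..K} \<Longrightarrow> p_energy \<mu> \<le> p_energy c" by blast
  have "p_energy \<mu> \<le> p_energy c" for c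
  proof -
    \<comment> \<open>Clamping \<open>c\<close> to \<open>[-K, K]\<close> brings it no farther from
      any value of \<open>u\<close>, so the minimum over the compact interval is global.\<close>
    define c' where "c' = max (-K) (min K c)"
    have "p_energy \<mu> \<le> p_energy c'" using K by (intro \<mu>) (auto simp: c'_def)
    also have "\<dots> \<le> p_energy c" unfolding p_energy_def
    proof (rule integral_mono_AE[OF integrable_p_energy integrable_p_energy], rule AE_I2)
      fix y assume "y \<in> space (lebesgue_on (ball x r))"
      then have "\<bar>u y\<bar> \<le> K" using bdd by simp
      then have "\<bar>u y - c'\<bar> \<le> \<bar>u y - c\<bar>" by (auto simp: c'_def)
      then show "\<bar>u y - c'\<bar> powr p \<le> \<bar>u y - c\<bar> powr p" using p by (intro powr_mono2) auto
    qed
    finally show ?thesis .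
  qed
  then show ?thesis by blast
qed

text \<open>Two minimizers make the midpoint convexity inequality an equality, so \<open>u\<close>
  takes no value strictly between them. By connectedness \<open>u\<close> then lies on one side of
  the gap, and the nearer minimizer has strictly smaller energy. The argument is uniform in
  \<open>p \<ge> 1\<close>.\<close>

lemma p_energy_minimizer_less_contradiction:
  assumes a: "\<And>c. p_energy a \<le> p_energy c" and b: "\<And>c. p_energy b \<le> p_energy c" and ab: "a < b"
  shows False
proof -
  have eq: "p_energy a = p_energy b" using a b by (meson order_antisym)
  have cont_pow: "continuous_on (ball x r) (\<lambda>y. \<bar>u y - c\<bar> powr p)" for c
    using cont p by (intro continuous_intros continuous_on_powr') auto
  have x: "x \<in> ball x r" using r by simp
  have "u y \<le> a \<or> b \<le> u y" if y: "y \<in> ball x r" for y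
  proof (rule ccontr)
    assume *: "\<not> (u y \<le> a \<or> b \<le> u y)"
    \<comment> \<open>The midpoint defect is pointwise nonnegative, while its integral is not
      positive because both \<open>a\<close> and \<open>b\<close> are minimizers; continuity makes
      it vanish everywhere.\<close>
    let ?d = "\<lambda>y. (\<bar>u y - a\<bar> powr p + \<bar>u y - b\<bar> powr p) / 2 - \<bar>u y - (a + b) / 2\<bar> powr p"
    have "(LINT y|lebesgue_on (ball x r). ?d y) = (p_energy a + p_energy b) / 2 - p_energy ((a + b) / 2)"
      unfolding p_energy_def using integrable_p_energy by simp
    also have "\<dots> \<le> 0" using a[of "(a + b) / 2"] eq by simp
    finally have int: "(LINT y|lebesgue_on (ball x r). ?d y) \<le> 0" .
    have "?d y \<le> 0"
    proof (rule continuous_integral_zero_imp_nonpos[OF _ _ _ int y])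
      show "integrable (lebesgue_on (ball x r)) ?d" using integrable_p_energy by simp
      show "continuous_on (ball x r) ?d"
        by (intro continuous_on_diff continuous_on_divide continuous_on_add cont_pow continuous_on_const) simp
      show "0 \<le> ?d y" for y using abs_powr_midpoint_le[OF p, of "u y" a b] by linarith
    qed
    then show False using abs_powr_midpoint_less[OF p, of a "u y" b] * by simp
  qed
  \<comment> \<open>Values on both sides would force the value \<open>(a + b) / 2\<close>, which
    lies in the excluded gap.\<close>
  moreover have "connected (u ` ball x r)" using cont by (intro connected_continuous_image) auto
  then have "\<not> (u y \<le> a \<and> b \<le> u z)" if "y \<in> ball x r" "z \<in> ball x r" for y z
    using connectedD_interval[of "u ` ball x r" "u y" "u z" "(a + b) / 2"] that calculation ab
    by (fastforce simp: field_simps)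
  ultimately consider "\<And>y. y \<in> ball x r \<Longrightarrow> u y \<le> a" | "\<And>y. y \<in> ball x r \<Longrightarrow> b \<le> u y"
    by blast
  then show False
  proof cases
    case 1
    let ?d = "\<lambda>y. \<bar>u y - b\<bar> powr p - \<bar>u y - a\<bar> powr p"
    have pos: "0 < ?d y" if "y \<in> ball x r" for y
      using 1[OF that] ab p by (auto intro!: powr_less_mono2)
    have "?d x \<le> 0"
    proof (rule continuous_integral_zero_imp_nonpos[where h="?d"])
      show "(LINT y|lebesgue_on (ball x r). ?d y) \<le> 0"
        using eq integrable_p_energy unfolding p_energy_def by simp
      show "0 \<le> ?d y" if "y \<in> ball x r" for y using pos[OF that] by linarith
    qed (use integrable_p_energy cont_pow x in \<open>auto intro!: continuous_on_diff\<close>)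
    then show False using pos[OF x] by linarith
  next
    case 2
    let ?d = "\<lambda>y. \<bar>u y - a\<bar> powr p - \<bar>u y - b\<bar> powr p"
    have pos: "0 < ?d y" if "y \<in> ball x r" for y
      using 2[OF that] ab p by (auto intro!: powr_less_mono2)
    have "?d x \<le> 0"
    proof (rule continuous_integral_zero_imp_nonpos[where h="?d"])
      show "(LINT y|lebesgue_on (ball x r). ?d y) \<le> 0"
        using eq integrable_p_energy unfolding p_energy_def by simp
      show "0 \<le> ?d y" if "y \<in> ball x r" for y using pos[OF that] by linarith
    qed (use integrable_p_energy cont_pow x in \<open>auto intro!: continuous_on_diff\<close>)
    then show False using pos[OF x] by linarith
  qed
qed

lemma p_energy_p_mean: "p_energy (p_mean (ereal p) r u x) \<le> p_energy c"
proof -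
  have Lp: "Lp_norm (ereal p) (ball x r) (\<lambda>y. u y - c) = p_energy c powr (1 / p)" for c
    by (simp add: Lp_norm_def p_energy_def)
  \<comment> \<open>The map \<open>t powr (1 / p)\<close> is strictly increasing on nonnegative
    reals, so the norm and its \<open>p\<close>-th power have the same minimizers.\<close>
  have le: "p_energy c powr (1 / p) \<le> p_energy d powr (1 / p) \<longleftrightarrow> p_energy c \<le> p_energy d" for c d
    using p p_energy_nonneg powr_mono2[of "1 / p" "p_energy c" "p_energy d"]
      powr_less_mono2[of "1 / p" "p_energy d" "p_energy c"] by fastforce
  have "\<exists>!\<mu>. \<forall>c. p_energy \<mu> \<le> p_energy c"
    using p_energy_minimizer_exists p_energy_minimizer_less_contradiction by (metis linorder_less_linear)
  then have "\<forall>c. p_energy (THE \<mu>. \<forall>c. p_energy \<mu> \<le> p_energy c) \<le> p_energy c" by (rule theI')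
  then show ?thesis unfolding p_mean_def Lp le by blast
qed

lemma p_mean_le_if_integral_neg:
  assumes "(LINT y|lebesgue_on (ball x r). signed_powr (p - 1) (u y - c)) < 0"
  shows "p_mean (ereal p) r u x \<le> c"
proof (rule ccontr)
  let ?\<mu> = "p_mean (ereal p) r u x" and ?G = "LINT y|lebesgue_on (ball x r). signed_powr (p - 1) (u y - c)"
  assume "\<not> ?\<mu> \<le> c"
  then have "0 < (p * - ?G) * (?\<mu> - c)" using assms p by (intro mult_pos_pos) auto
  then show False using p_energy_subgradient[of c ?\<mu>] p_energy_p_mean[of c] by (simp add: algebra_simps)
qed

lemma p_mean_ge_if_integral_pos:
  assumes "(LINT y|lebesgue_on (ball x r). signed_powr (p - 1) (u y - c)) > 0"
  shows "c \<le> p_mean (ereal p) r u x"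
proof (rule ccontr)
  let ?\<mu> = "p_mean (ereal p) r u x" and ?G = "LINT y|lebesgue_on (ball x r). signed_powr (p - 1) (u y - c)"
  assume "\<not> c \<le> ?\<mu>"
  then have "0 < (p * ?G) * (c - ?\<mu>)" using assms p by (intro mult_pos_pos) auto
  then show False using p_energy_subgradient[of c ?\<mu>] p_energy_p_mean[of c] by (simp add: algebra_simps)
qed

text \<open>For a continuous function on an open ball the essential supremum is the supremum, and
  the largest deviation from \<open>c\<close> is governed by the two extreme values of
  \<open>u\<close>.\<close>

lemma Lp_norm_infinity:
  "Lp_norm \<infinity> (ball x r) (\<lambda>y. u y - c) = max ((SUP y\<in>ball x r. u y) - c) (c - (INF y\<in>ball x r. u y))"
proof -
  let ?B = "ball x r" and ?S = "SUP y\<in>ball x r. u y" and ?I = "INF y\<in>ball x r. u y"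
  let ?e = "esssup (lebesgue_on ?B) (\<lambda>y. ereal \<bar>u y - c\<bar>)"
  have above: "bdd_above (u ` ?B)"
    using bdd abs_le_D1 by (intro bdd_aboveI2[of _ _ K]) blast
  have below: "bdd_below (u ` ?B)"
  proof (rule bdd_belowI2)
    show "- K \<le> u y" if "y \<in> ?B" for y using bdd[OF that] by linarith
  qed
  have ne: "?B \<noteq> {}" using r by simp
  note u_measurable[measurable]
  define m where "m = max (?S - c) (c - ?I)"
  have bound: "\<bar>u y - c\<bar> \<le> m" if "y \<in> ?B" for y
    using cSUP_upper[OF that above] cINF_lower[OF below that] unfolding m_def by linarith
  have le: "?e \<le> ereal (m)"
    using bound by (intro esssup_I AE_I2) auto
  \<comment> \<open>Together with the upper bound this makes the essential supremum a finite real. A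
    negative value is ruled out because continuity would turn it into a pointwise negative bound for
    an absolute value.\<close>
  moreover have "0 \<le> ?e"
  proof (rule ccontr)
    assume "\<not> 0 \<le> ?e"
    then have "AE y in lebesgue_on ?B. \<bar>u y - c\<bar> \<le> -1"
      using esssup_AE[of "\<lambda>y. ereal \<bar>u y - c\<bar>" "lebesgue_on ?B"]
      by (auto elim!: eventually_mono simp: not_le) (metis abs_ge_zero ereal_less_eq(5) order.strict_trans2 order_less_irrefl)
    then have "\<bar>u x - c\<bar> \<le> -1"
      using cont r by (intro AE_lebesgue_on_continuous_le[of ?B "\<lambda>y. \<bar>u y - c\<bar>"]) (auto intro!: continuous_intros)
    then show False by simp
  qed
  ultimately obtain s where s: "?e = ereal s"
    by (metis PInfty_neq_ereal(1) ereal_infty_less_eq(1) ereal_less_eq(2) MInfty_neq_ereal(1) ereal_cases not_MInfty_nonneg)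
  have "AE y in lebesgue_on ?B. \<bar>u y - c\<bar> \<le> s"
    using esssup_AE[of "\<lambda>y. ereal \<bar>u y - c\<bar>" "lebesgue_on ?B"] by (simp add: s)
  then have *: "\<bar>u y - c\<bar> \<le> s" if "y \<in> ?B" for y
    using cont that by (intro AE_lebesgue_on_continuous_le[of ?B "\<lambda>y. \<bar>u y - c\<bar>"]) (auto intro!: continuous_intros)
  have "?S \<le> c + s" using * ne by (intro cSUP_least) (auto simp: abs_le_iff algebra_simps)
  moreover have "c - s \<le> ?I" using * ne by (intro cINF_greatest) (auto simp: abs_le_iff algebra_simps)
  ultimately have "m \<le> s" unfolding m_def by simp
  then have "s = m" using le s by simp
  then show ?thesis by (simp only: m_def[symmetric] Lp_norm_def s refl if_True real_of_ereal.simps)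
qed

text \<open>As a function of \<open>c\<close> the norm is V-shaped with its lowest point at the
  midpoint; testing any minimizer against the midpoint forces equality.\<close>

lemma p_mean_infinity:
  "p_mean \<infinity> r u x = ((SUP y\<in>ball x r. u y) + (INF y\<in>ball x r. u y)) / 2"
  unfolding p_mean_def Lp_norm_infinity
proof (rule the_equality)
  let ?S = "SUP y\<in>ball x r. u y" and ?I = "INF y\<in>ball x r. u y"
  show "\<forall>c. max (?S - (?S + ?I) / 2) ((?S + ?I) / 2 - ?I) \<le> max (?S - c) (c - ?I)"
    by (auto simp: max_def field_simps)
  fix \<mu> assume "\<forall>c. max (?S - \<mu>) (\<mu> - ?I) \<le> max (?S - c) (c - ?I)"
  from this[rule_format, of "(?S + ?I) / 2"] show "\<mu> = (?S + ?I) / 2"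
    by (auto simp: max_def field_simps split: if_splits)
qed

end

section \<open>Slicing the ball\<close>

text \<open>Substituting \<open>inverse t\<close> turns the one-sided limit at 0 into dominated
  convergence at infinity.\<close>

lemma integral_dominated_convergence_at_right:
  fixes s :: "real \<Rightarrow> 'a \<Rightarrow> real"
  assumes "f \<in> borel_measurable M" "\<And>t. s t \<in> borel_measurable M" "integrable M w"
    and lim: "AE x in M. ((\<lambda>t. s t x) \<longlongrightarrow> f x) (at_right 0)"
    and bound: "\<forall>\<^sub>F t in at_right 0. AE x in M. norm (s t x) \<le> w x"
  shows "((\<lambda>t. integral\<^sup>L M (s t)) \<longlongrightarrow> integral\<^sup>L M f) (at_right 0)"
  unfolding filterlim_at_right_to_top
proof (rule integral_dominated_convergence_at_top[where w=w])
  show "AE x in M. ((\<lambda>t. s (inverse t) x) \<longlongrightarrow> f x) at_top"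
    using lim by (simp add: filterlim_at_right_to_top)
  show "\<forall>\<^sub>F t in at_top. AE x in M. norm (s (inverse t) x) \<le> w x"
    using bound by (simp add: eventually_at_right_to_top)
qed (use assms in auto)

lemma ball_borel [measurable]: "ball c r \<in> sets borel"
  by simp

text \<open>For \<open>v = 0\<close> the quotient is 0 by the convention for division by zero, so
  the map is the identity and still orthogonal.\<close>

definition reflect :: "'a::euclidean_space \<Rightarrow> 'a \<Rightarrow> 'a" where
  "reflect v y = y - (2 * (v \<bullet> y) / (v \<bullet> v)) *\<^sub>R v"

lemma inner_reflect: "w \<bullet> reflect v y = w \<bullet> y - 2 * (v \<bullet> y) / (v \<bullet> v) * (w \<bullet> v)"
  by (simp add: reflect_def inner_diff_right)

lemma inner_reflect_self [simp]: "v \<bullet> reflect v y = - (v \<bullet> y)"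
  by (cases "v = 0") (auto simp: inner_reflect)

lemma inner_reflect_orthogonal [simp]: "w \<bullet> v = 0 \<Longrightarrow> w \<bullet> reflect v y = w \<bullet> y"
  by (simp add: inner_reflect)

lemma orthogonal_transformation_reflect: "orthogonal_transformation (reflect v)"
  unfolding orthogonal_transformation_def
proof (intro conjI allI)
  show "linear (reflect v)"
    by (rule linearI) (simp_all add: reflect_def inner_add_right algebra_simps add_divide_distrib scaleR_left_distrib)
  fix y z show "reflect v y \<bullet> reflect v z = y \<bullet> z"
  proof (cases "v = 0")
    case False
    then show ?thesis unfolding inner_reflect[of "reflect v y"]
      by (simp add: inner_reflect inner_commute[of "reflect v y"] inner_commute[of z] field_simps)
  qed (simp add: reflect_def)
qed

lemma norm_reflect [simp]: "norm (reflect v y) = norm y"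
  by (rule orthogonal_transformation_norm[OF orthogonal_transformation_reflect])

lemma integral_lborel_reflect:
  fixes f :: "'a::euclidean_space \<Rightarrow> real"
  assumes "f \<in> borel_measurable borel"
  shows "(LINT y|lborel. f (reflect v y)) = (LINT y|lborel. f y)"
  by (rule integral_lborel_orthogonal[OF orthogonal_transformation_reflect assms])

lemma integral_lborel_uminus:
  fixes f :: "'a::euclidean_space \<Rightarrow> real"
  assumes "f \<in> borel_measurable borel"
  shows "(LINT y|lborel. f (- y)) = (LINT y|lborel. f y)"
  by (rule integral_lborel_orthogonal[OF _ assms])
     (auto simp: orthogonal_transformation_def intro!: linearI)

lemma AE_lborel_inner_nonzero:
  fixes g :: "'a::euclidean_space"
  assumes "g \<noteq> 0" shows "AE y in lborel. g \<bullet> y \<noteq> 0"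
proof -
  have "{y. g \<bullet> y = 0} \<in> null_sets lebesgue"
    using negligible_hyperplane[of g 0] assms by (simp add: negligible_iff_null_sets)
  then have "{y. g \<bullet> y = 0} \<in> null_sets lborel"
    by (subst (asm) null_sets_completion_iff) auto
  then show ?thesis by (rule AE_I'[of _ lborel]) auto
qed

text \<open>The projection onto the hyperplane orthogonal to \<open>e\<close>, provided
  \<open>e\<close> is a unit vector, as the next context assumes.\<close>

definition perp :: "'a::euclidean_space \<Rightarrow> 'a \<Rightarrow> 'a" where
  "perp e z = z - (z \<bullet> e) *\<^sub>R e"

section \<open>Fubini's theorem along lines in a given direction\<close>

context
  fixes e :: "'a::euclidean_space"
  assumes e: "norm e = 1"
begin

lemma inner_self_1: "e \<bullet> e = 1" using e by (simp add: norm_eq_1)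

lemma perp_inner [simp]: "perp e z \<bullet> e = 0" "e \<bullet> perp e z = 0"
  using inner_self_1 by (simp_all add: perp_def inner_diff_left inner_diff_right inner_commute)

lemma perp_idem [simp]: "perp e (perp e z + t *\<^sub>R e) = perp e z" "perp e (perp e z) = perp e z"
  using inner_self_1 by (simp_all add: perp_def inner_diff_left inner_add_left)

lemma norm_perp_add: "(norm (perp e z + t *\<^sub>R e))\<^sup>2 = (norm (perp e z))\<^sup>2 + t\<^sup>2"
  unfolding power2_norm_eq_inner using inner_self_1
  by (simp add: inner_add_left inner_add_right power2_eq_square)

lemma norm_perp_decomp: "(norm z)\<^sup>2 = (norm (perp e z))\<^sup>2 + (z \<bullet> e)\<^sup>2"
proof -
  have "norm z = norm (perp e z + (z \<bullet> e) *\<^sub>R e)" by (simp add: perp_def)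
  then show ?thesis by (simp only: norm_perp_add)
qed

lemma norm_perp_le: "norm (perp e z) \<le> norm z"
proof (rule power2_le_imp_le)
  show "(norm (perp e z))\<^sup>2 \<le> (norm z)\<^sup>2"
    unfolding norm_perp_decomp[of z] by (simp only: le_add_same_cancel1 zero_le_power2)
qed (rule norm_ge_zero)

lemma borel_measurable_perp [measurable]: "perp e \<in> borel_measurable borel"
  unfolding perp_def by measurable

text \<open>A Fubini theorem in a direction \<open>e\<close>, avoiding a choice of coordinates: average the integral over
  the lines parallel to \<open>e\<close> with the weight \<open>1\<close> on the slab \<open>\<bar>z \<bullet> e\<bar> < 1/2\<close> of unit width.\<close>

lemma nn_integral_slice:
  assumes [measurable]: "f \<in> borel_measurable borel"
  shows "(\<integral>\<^sup>+z. f z \<partial>lborel) =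
    (\<integral>\<^sup>+z. indicator {z. \<bar>z \<bullet> e\<bar> < 1/2} z * (\<integral>\<^sup>+t. f (perp e z + t *\<^sub>R e) \<partial>lborel) \<partial>lborel)"
proof -
  define \<kappa> :: "real \<Rightarrow> ennreal" where "\<kappa> = indicator {t. \<bar>t\<bar> < 1/2}"
  have [measurable]: "\<kappa> \<in> borel_measurable borel" unfolding \<kappa>_def by measurable
  have ind: "indicator {z. \<bar>z \<bullet> e\<bar> < 1/2} z = \<kappa> (z \<bullet> e)" for z by (simp add: \<kappa>_def indicator_def)
  \<comment> \<open>The slab has unit width, so every line parallel to \<open>e\<close> spends
    length 1 in it.\<close>
  have one: "(\<integral>\<^sup>+t. \<kappa> (z \<bullet> e - t) \<partial>lborel) = 1" for z
  proof -
    have "\<kappa> (z \<bullet> e - t) = indicator {z \<bullet> e - 1/2 <..< z \<bullet> e + 1/2} t" for t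
      by (auto simp: \<kappa>_def indicator_def abs_if split: if_splits)
    then show ?thesis by simp
  qed
  have "(\<integral>\<^sup>+z. indicator {z. \<bar>z \<bullet> e\<bar> < 1/2} z * (\<integral>\<^sup>+t. f (perp e z + t *\<^sub>R e) \<partial>lborel) \<partial>lborel)
    = (\<integral>\<^sup>+z. \<integral>\<^sup>+t. \<kappa> (z \<bullet> e) * f (z + t *\<^sub>R e) \<partial>lborel \<partial>lborel)"
  proof (rule nn_integral_cong)
    fix z
    have "(\<integral>\<^sup>+t. f (perp e z + t *\<^sub>R e) \<partial>lborel) = (\<integral>\<^sup>+t. f (perp e z + (t + z \<bullet> e) *\<^sub>R e) \<partial>lborel)"
      by (rule nn_integral_lborel_translate[symmetric, where f="\<lambda>t. f (perp e z + t *\<^sub>R e)"]) measurable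
    also have "\<dots> = (\<integral>\<^sup>+t. f (z + t *\<^sub>R e) \<partial>lborel)"
      by (simp add: perp_def scaleR_left_distrib)
    finally show "indicator {z. \<bar>z \<bullet> e\<bar> < 1/2} z * (\<integral>\<^sup>+t. f (perp e z + t *\<^sub>R e) \<partial>lborel)
      = (\<integral>\<^sup>+t. \<kappa> (z \<bullet> e) * f (z + t *\<^sub>R e) \<partial>lborel)"
      by (simp only: ind) (simp add: nn_integral_cmult)
  qed
  also have "\<dots> = (\<integral>\<^sup>+t. \<integral>\<^sup>+z. \<kappa> (z \<bullet> e) * f (z + t *\<^sub>R e) \<partial>lborel \<partial>lborel)"
    by (rule lborel_pair.Fubini'[symmetric]) measurable
  \<comment> \<open>Translating \<open>z\<close> by \<open>t *\<^sub>R e\<close> frees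
    \<open>f\<close> from \<open>t\<close> and moves the slab weight instead.\<close>
  also have "\<dots> = (\<integral>\<^sup>+t. \<integral>\<^sup>+z. \<kappa> (z \<bullet> e - t) * f z \<partial>lborel \<partial>lborel)"
  proof (rule nn_integral_cong)
    fix t :: real
    have "(\<integral>\<^sup>+z. \<kappa> (z \<bullet> e - t) * f z \<partial>lborel) = (\<integral>\<^sup>+z. \<kappa> ((z + t *\<^sub>R e) \<bullet> e - t) * f (z + t *\<^sub>R e) \<partial>lborel)"
      by (rule nn_integral_lborel_translate[symmetric, where f="\<lambda>z. \<kappa> (z \<bullet> e - t) * f z"]) measurable
    then show "(\<integral>\<^sup>+z. \<kappa> (z \<bullet> e) * f (z + t *\<^sub>R e) \<partial>lborel) = (\<integral>\<^sup>+z. \<kappa> (z \<bullet> e - t) * f z \<partial>lborel)"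
      using inner_self_1 by (simp add: inner_add_left)
  qed
  also have "\<dots> = (\<integral>\<^sup>+z. \<integral>\<^sup>+t. \<kappa> (z \<bullet> e - t) * f z \<partial>lborel \<partial>lborel)"
    by (rule lborel_pair.Fubini') measurable
  also have "\<dots> = (\<integral>\<^sup>+z. f z \<partial>lborel)"
    by (simp add: nn_integral_multc one)
  finally show ?thesis by simp
qed

text \<open>The nonnegative version, applied to indicators, exhibits \<open>lborel\<close> as the
  image under \<open>T\<close> of the product measure with density \<open>\<kappa>\<close>. Signed
  integrals then transfer through this image and the product Fubini theorem.\<close>

lemma integral_slice:
  fixes f :: "'a \<Rightarrow> real"
  assumes f: "integrable lborel f"
  shows "(LINT z|lborel. f z) =
    (LINT z|lborel. indicator {z. \<bar>z \<bullet> e\<bar> < 1/2} z * (LINT t|lborel. f (perp e z + t *\<^sub>R e)))"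
proof -
  have [measurable]: "f \<in> borel_measurable borel" using f by simp
  let ?P = "lborel \<Otimes>\<^sub>M lborel :: ('a \<times> real) measure"
  define \<kappa> where "\<kappa> = (\<lambda>(z, t::real). indicator {z::'a. \<bar>z \<bullet> e\<bar> < 1/2} z :: real)"
  define T where "T = (\<lambda>(z, t::real). perp e z + t *\<^sub>R e)"
  have [measurable]: "\<kappa> \<in> borel_measurable ?P" "T \<in> borel_measurable ?P"
    unfolding \<kappa>_def T_def by measurable
  have eq: "distr (density ?P \<kappa>) borel T = lborel"
  proof (rule measure_eqI)
    fix A assume "A \<in> sets (distr (density ?P \<kappa>) borel T)"
    then have A [measurable]: "A \<in> sets borel" by simp
    have "emeasure (distr (density ?P \<kappa>) borel T) A = (\<integral>\<^sup>+y. indicator A y \<partial>distr (density ?P \<kappa>) borel T)"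
      by simp
    also have "\<dots> = (\<integral>\<^sup>+x. ennreal (\<kappa> x) * indicator A (T x) \<partial>?P)"
      by (subst nn_integral_distr) (auto simp: nn_integral_density)
    also have "\<dots> = (\<integral>\<^sup>+z. \<integral>\<^sup>+t. ennreal (\<kappa> (z, t)) * indicator A (T (z, t)) \<partial>lborel \<partial>lborel)"
      by (subst lborel.nn_integral_fst[symmetric]) auto
    also have "\<dots> = (\<integral>\<^sup>+z. indicator {z. \<bar>z \<bullet> e\<bar> < 1/2} z * (\<integral>\<^sup>+t. indicator A (perp e z + t *\<^sub>R e) \<partial>lborel) \<partial>lborel)"
      by (intro nn_integral_cong) (simp add: \<kappa>_def T_def nn_integral_cmult ennreal_indicator)
    also have "\<dots> = emeasure lborel A"
      by (subst nn_integral_slice[symmetric]) auto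
    finally show "emeasure (distr (density ?P \<kappa>) borel T) A = emeasure lborel A" .
  qed simp
  have nonneg: "AE x in ?P. 0 \<le> \<kappa> x" by (intro AE_I2) (auto simp: \<kappa>_def)
  have "integrable (distr (density ?P \<kappa>) borel T) f" using f by (simp add: eq)
  then have int: "integrable ?P (\<lambda>x. \<kappa> x * f (T x))"
    using nonneg by (simp add: integrable_distr_eq integrable_density)
  have "(LINT z|lborel. f z) = (LINT z|distr (density ?P \<kappa>) borel T. f z)" by (simp add: eq)
  also have "\<dots> = (LINT x|?P. \<kappa> x * f (T x))"
    using nonneg by (simp add: integral_distr integral_density)
  also have "\<dots> = (LINT z|lborel. LINT t|lborel. \<kappa> (z, t) * f (T (z, t)))"
    by (rule lborel_pair.integral_fst'[OF int, symmetric])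
  finally show ?thesis by (simp add: \<kappa>_def T_def)
qed

end

text \<open>The condition \<open>s > -1\<close> is integrability of \<open>t powr s\<close> at 0;
  the mirror image of \<open>f\<close> supplies the negative half.\<close>

lemma integrable_abs_powr_interval:
  fixes s :: real
  assumes "s > -1"
  shows "integrable lborel (\<lambda>t. indicator {-1..1} t * \<bar>t\<bar> powr s)"
proof -
  define f where "f = (\<lambda>t::real. indicator {0..1} t * t powr s)"
  have "(\<lambda>t. t powr s) absolutely_integrable_on {0..1::real}"
    using integrable_on_powr_from_0[of s 1] assms by (subst absolutely_integrable_on_iff_nonneg) auto
  then have f: "integrable lborel f"
    unfolding set_integrable_def f_def by (subst (asm) integrable_completion) auto
  have "integrable lborel (\<lambda>t. f t + f (0 + (-1) * t))"
    using f by (intro Bochner_Integration.integrable_add lborel_integrable_real_affine) auto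
  then show ?thesis
    by (rule Bochner_Integration.integrable_bound) (auto simp: f_def indicator_def)
qed

text \<open>On each line parallel to \<open>g\<close> the weight is, up to a constant factor,
  \<open>\<bar>t\<bar> powr s\<close> on a subset of \<open>[-1, 1]\<close>. This bound is uniform
  over the lines, and the lines meeting the unit ball cross the slab inside
  \<open>ball 0 2\<close>.\<close>

lemma integrable_ball_inner_powr:
  fixes g :: "'a::euclidean_space" and s :: real
  assumes g: "g \<noteq> 0" and s: "s > -1"
  shows "integrable lborel (\<lambda>y. indicator (ball 0 1) y * \<bar>g \<bullet> y\<bar> powr s)"
proof -
  define e where "e = g /\<^sub>R norm g"
  have e: "norm e = 1" using g by (simp add: e_def)
  define f where "f y = indicator (ball 0 1) y * \<bar>e \<bullet> y\<bar> powr s" for y :: 'a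
  have [measurable]: "f \<in> borel_measurable borel" unfolding f_def by measurable
  have "(\<integral>\<^sup>+y. ennreal (f y) \<partial>lborel) = (\<integral>\<^sup>+z. indicator {z. \<bar>z \<bullet> e\<bar> < 1/2} z *
      (\<integral>\<^sup>+t. ennreal (f (perp e z + t *\<^sub>R e)) \<partial>lborel) \<partial>lborel)"
    by (rule nn_integral_slice[OF e]) measurable
  also have "\<dots> \<le> (\<integral>\<^sup>+z. indicator (ball (0::'a) 2) z *
      (\<integral>\<^sup>+t. ennreal (indicator {-1..1} t * \<bar>t\<bar> powr s) \<partial>lborel) \<partial>lborel)"
  proof (rule nn_integral_mono)
    fix z
    have f: "f (perp e z + t *\<^sub>R e) \<le> indicator {-1..1} t * \<bar>t\<bar> powr s"
      "norm (perp e z) \<ge> 1 \<Longrightarrow> f (perp e z + t *\<^sub>R e) = 0" for t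
    proof -
      have eq: "e \<bullet> (perp e z + t *\<^sub>R e) = t"
        using e by (simp add: inner_add_right norm_eq_1)
      have *: "(norm (perp e z))\<^sup>2 + t\<^sup>2 < 1" if "norm (perp e z + t *\<^sub>R e) < 1"
        using that norm_perp_add[OF e, of z t] by (metis norm_ge_zero one_power2 power_strict_mono zero_less_numeral)
      have "norm (perp e z) < 1 \<and> \<bar>t\<bar> < 1" if "norm (perp e z + t *\<^sub>R e) < 1"
        using *[OF that] abs_square_less_1[of t] abs_square_less_1[of "norm (perp e z)"]
          zero_le_power2[of t] zero_le_power2[of "norm (perp e z)"] by auto
      then show "f (perp e z + t *\<^sub>R e) \<le> indicator {-1..1} t * \<bar>t\<bar> powr s"
        "norm (perp e z) \<ge> 1 \<Longrightarrow> f (perp e z + t *\<^sub>R e) = 0"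
        unfolding f_def eq by (auto simp: indicator_def)
    qed
    have b: "z \<in> ball 0 2" if "\<bar>z \<bullet> e\<bar> < 1/2" "norm (perp e z) < 1"
    proof -
      have "norm z = norm (perp e z + (z \<bullet> e) *\<^sub>R e)" by (simp add: perp_def)
      also have "\<dots> \<le> norm (perp e z) + \<bar>z \<bullet> e\<bar>" using norm_triangle_ineq[of "perp e z"] e by (metis mult.right_neutral norm_scaleR real_norm_def)
      finally show ?thesis using that by simp
    qed
    show "indicator {z. \<bar>z \<bullet> e\<bar> < 1/2} z * (\<integral>\<^sup>+t. ennreal (f (perp e z + t *\<^sub>R e)) \<partial>lborel)
      \<le> indicator (ball 0 2) z * (\<integral>\<^sup>+t. ennreal (indicator {-1..1} t * \<bar>t\<bar> powr s) \<partial>lborel)"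
    proof (cases "\<bar>z \<bullet> e\<bar> < 1/2 \<and> norm (perp e z) < 1")
      case True
      then show ?thesis using b f(1) by (auto intro!: mult_mono nn_integral_mono ennreal_leI)
    next
      case False
      then have "indicator {z. \<bar>z \<bullet> e\<bar> < 1/2} z * (\<integral>\<^sup>+t. ennreal (f (perp e z + t *\<^sub>R e)) \<partial>lborel) = 0"
        using f(2) by (auto simp: indicator_def)
      then show ?thesis by (simp only: zero_le)
    qed
  qed
  also have "\<dots> = emeasure lborel (ball (0::'a) 2) * (\<integral>\<^sup>+t. ennreal (indicator {-1..1} t * \<bar>t\<bar> powr s) \<partial>lborel)"
    by (subst nn_integral_multc) auto
  also have "\<dots> < \<infinity>"
    using emeasure_lborel_ball_finite[of "0::'a" 2] integrable_abs_powr_interval[OF s]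
    by (auto simp: integrable_iff_bounded ennreal_mult_less_top)
  finally have "integrable lborel f"
    by (intro integrableI_nonneg) (auto simp: f_def)
  then have "integrable lborel (\<lambda>y. norm g powr s * f y)" by simp
  moreover have "norm g powr s * f y = indicator (ball 0 1) y * \<bar>g \<bullet> y\<bar> powr s" for y
  proof -
    have "\<bar>g \<bullet> y\<bar> = norm g * \<bar>e \<bullet> y\<bar>" using g by (simp add: e_def abs_mult)
    then show ?thesis by (simp add: f_def powr_mult)
  qed
  ultimately show ?thesis by simp
qed

text \<open>Polarization turns the formula for squares into one for products, and expansion in the
  basis produces the trace. The weight \<open>\<omega>\<close> and the map \<open>\<pi>\<close> are
  left general because \<open>p > 1\<close> uses the ball with \<open>\<pi>\<close> the identity and
  \<open>p = 1\<close> uses a cylinder with \<open>\<pi>\<close> a projection.\<close>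

lemma integral_quadratic_form:
  fixes L :: "'a::euclidean_space \<Rightarrow> 'a" and \<omega> :: "'b \<Rightarrow> real" and \<pi> :: "'b \<Rightarrow> 'a"
  assumes int: "\<And>a b. integrable M (\<lambda>y. \<omega> y * ((a \<bullet> \<pi> y) * (b \<bullet> \<pi> y)))"
    and sq: "\<And>a. (LINT y|M. \<omega> y * (a \<bullet> \<pi> y)\<^sup>2) = K * (a \<bullet> a + r * (a \<bullet> g)\<^sup>2)"
    and L: "linear L"
  shows "integrable M (\<lambda>y. \<omega> y * (\<pi> y \<bullet> L (\<pi> y)))"
    and "(LINT y|M. \<omega> y * (\<pi> y \<bullet> L (\<pi> y))) = K * ((\<Sum>b\<in>Basis. b \<bullet> L b) + r * (g \<bullet> L g))"
proof -
  have bil: "(LINT y|M. \<omega> y * ((a \<bullet> \<pi> y) * (b \<bullet> \<pi> y))) = K * (a \<bullet> b + r * ((a \<bullet> g) * (b \<bullet> g)))" for a b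
  proof -
    have "(LINT y|M. \<omega> y * ((a + b) \<bullet> \<pi> y)\<^sup>2) = (LINT y|M. \<omega> y * (a \<bullet> \<pi> y)\<^sup>2)
      + (LINT y|M. \<omega> y * (b \<bullet> \<pi> y)\<^sup>2) + 2 * (LINT y|M. \<omega> y * ((a \<bullet> \<pi> y) * (b \<bullet> \<pi> y)))"
    proof -
      have "(LINT y|M. \<omega> y * ((a + b) \<bullet> \<pi> y)\<^sup>2) = (LINT y|M. \<omega> y * ((a \<bullet> \<pi> y) * (a \<bullet> \<pi> y))
        + \<omega> y * ((b \<bullet> \<pi> y) * (b \<bullet> \<pi> y)) + 2 * (\<omega> y * ((a \<bullet> \<pi> y) * (b \<bullet> \<pi> y))))"
        by (intro Bochner_Integration.integral_cong) (auto simp: inner_add_left power2_eq_square algebra_simps)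
      then show ?thesis using int by (simp add: power2_eq_square)
    qed
    then have "2 * (LINT y|M. \<omega> y * ((a \<bullet> \<pi> y) * (b \<bullet> \<pi> y))) = 2 * (K * (a \<bullet> b + r * ((a \<bullet> g) * (b \<bullet> g))))"
      unfolding sq by (simp add: inner_add_left inner_add_right inner_commute[of b a] power2_eq_square algebra_simps)
    then show ?thesis by simp
  qed
  have expand: "y \<bullet> L z = (\<Sum>i\<in>Basis. \<Sum>j\<in>Basis. (i \<bullet> L j) * ((i \<bullet> y) * (j \<bullet> z)))" for y z
  proof -
    have "L z = L (\<Sum>j\<in>Basis. (z \<bullet> j) *\<^sub>R j)" by (simp add: euclidean_representation)
    also have "\<dots> = (\<Sum>j\<in>Basis. (z \<bullet> j) *\<^sub>R L j)"
      using L by (simp add: linear_sum linear_scale)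
    finally have Lz: "L z = \<dots>" .
    have "y \<bullet> L z = (\<Sum>i\<in>Basis. (y \<bullet> i) * (L z \<bullet> i))" by (rule euclidean_inner)
    also have "\<dots> = (\<Sum>i\<in>Basis. \<Sum>j\<in>Basis. (i \<bullet> L j) * ((i \<bullet> y) * (j \<bullet> z)))"
      unfolding Lz by (intro sum.cong refl)
        (simp add: inner_sum_right inner_sum_left sum_distrib_left inner_commute mult_ac)
    finally show ?thesis .
  qed
  have pt: "\<omega> y * (\<pi> y \<bullet> L (\<pi> y)) = (\<Sum>i\<in>Basis. \<Sum>j\<in>Basis. (i \<bullet> L j) * (\<omega> y * ((i \<bullet> \<pi> y) * (j \<bullet> \<pi> y))))" for y
    unfolding expand[of "\<pi> y"] by (simp add: sum_distrib_left mult_ac)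
  show "integrable M (\<lambda>y. \<omega> y * (\<pi> y \<bullet> L (\<pi> y)))"
    unfolding pt using int by (intro Bochner_Integration.integrable_sum integrable_mult_right) auto
  have "(LINT y|M. \<omega> y * (\<pi> y \<bullet> L (\<pi> y))) = (\<Sum>i\<in>Basis. \<Sum>j\<in>Basis. (i \<bullet> L j) * (K * (i \<bullet> j + r * ((i \<bullet> g) * (j \<bullet> g)))))"
    unfolding pt using int by (simp add: Bochner_Integration.integral_sum bil)
  also have "\<dots> = K * ((\<Sum>i\<in>Basis. \<Sum>j\<in>Basis. (i \<bullet> L j) * (i \<bullet> j)) + r * (g \<bullet> L g))"
    unfolding expand[of g] by (simp add: sum_distrib_left sum.distrib algebra_simps)
  also have "(\<Sum>i\<in>Basis. \<Sum>j\<in>Basis. (i \<bullet> L j) * (i \<bullet> j)) = (\<Sum>i\<in>Basis. i \<bullet> L i)"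
  proof (intro sum.cong refl)
    fix i :: 'a assume "i \<in> Basis"
    then have "(\<Sum>j\<in>Basis. (i \<bullet> L j) * (i \<bullet> j)) = (\<Sum>j\<in>Basis. if i = j then i \<bullet> L j else 0)"
      by (intro sum.cong) (auto simp: inner_Basis)
    then show "(\<Sum>j\<in>Basis. (i \<bullet> L j) * (i \<bullet> j)) = i \<bullet> L i" using \<open>i \<in> Basis\<close> by simp
  qed
  finally show "(LINT y|M. \<omega> y * (\<pi> y \<bullet> L (\<pi> y))) = K * ((\<Sum>b\<in>Basis. b \<bullet> L b) + r * (g \<bullet> L g))" .
qed

section \<open>Perturbed odd moments for \<open>p > 1\<close>\<close>

lemma integrable_lborel_ball:
  fixes f :: "'a::euclidean_space \<Rightarrow> real"
  assumes [measurable]: "f \<in> borel_measurable borel" and b: "\<And>y. y \<in> ball 0 r \<Longrightarrow> \<bar>f y\<bar> \<le> C"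
  shows "integrable lborel (\<lambda>y. indicator (ball 0 r) y * f y)"
proof (rule Bochner_Integration.integrable_bound)
  have "integrable lborel (indicator (ball (0::'a) r) :: 'a \<Rightarrow> real)"
    using emeasure_lborel_ball_finite[of "0::'a" r] by (simp add: integrable_indicator_iff)
  then show "integrable lborel (\<lambda>y. C * indicator (ball (0::'a) r) y)" by simp
  show "AE y in lborel. norm (indicator (ball 0 r) y * f y) \<le> norm (C * indicator (ball (0::'a) r) y)"
  proof (rule AE_I2)
    fix y
    have "\<bar>f y\<bar> \<le> \<bar>C\<bar>" if "y \<in> ball 0 r" using b[OF that] by linarith
    then show "norm (indicator (ball 0 r) y * f y) \<le> norm (C * indicator (ball (0::'a) r) y)"
      by (cases "y \<in> ball 0 r") auto
  qed
qed measurable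

context
  fixes g :: "'a::euclidean_space" and q :: real
  assumes g: "g \<noteq> 0"
begin

abbreviation "unit_ball \<equiv> ball (0::'a) 1"

lemma integrable_ball_weight:
  assumes q: "q > 0" and [measurable]: "k \<in> borel_measurable borel" and k: "\<And>y. y \<in> unit_ball \<Longrightarrow> \<bar>k y\<bar> \<le> C"
  shows "integrable lborel (\<lambda>y. indicator unit_ball y * (\<bar>g \<bullet> y\<bar> powr (q - 1) * k y))"
proof (rule Bochner_Integration.integrable_bound)
  show "integrable lborel (\<lambda>y. C * (indicator unit_ball y * \<bar>g \<bullet> y\<bar> powr (q - 1)))"
    using integrable_ball_inner_powr[OF g, of "q - 1"] q by simp
  show "AE y in lborel. norm (indicator unit_ball y * (\<bar>g \<bullet> y\<bar> powr (q - 1) * k y))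
      \<le> norm (C * (indicator unit_ball y * \<bar>g \<bullet> y\<bar> powr (q - 1)))"
  proof (rule AE_I2)
    fix y
    have "\<bar>k y\<bar> * \<bar>g \<bullet> y\<bar> powr (q - 1) \<le> \<bar>C\<bar> * \<bar>g \<bullet> y\<bar> powr (q - 1)" if "y \<in> unit_ball"
      using k[OF that] by (intro mult_right_mono) auto
    then show "norm (indicator unit_ball y * (\<bar>g \<bullet> y\<bar> powr (q - 1) * k y))
      \<le> norm (C * (indicator unit_ball y * \<bar>g \<bullet> y\<bar> powr (q - 1)))"
      by (cases "y \<in> unit_ball") (auto simp: abs_mult mult_ac)
  qed
qed measurable

text \<open>Dominated convergence, with the pointwise limit available off the null hyperplane
  \<open>g \<bullet> y = 0\<close>. The factor \<open>k\<close> is 1 for the mean itself and a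
  linear form for the moment identity below.\<close>

lemma tendsto_ball_symmetric_difference:
  assumes q: "q > 0" and [measurable]: "w \<in> borel_measurable borel" "k \<in> borel_measurable borel"
    and w: "\<And>y. y \<in> unit_ball \<Longrightarrow> \<bar>w y\<bar> \<le> C" and k: "\<And>y. y \<in> unit_ball \<Longrightarrow> \<bar>k y\<bar> \<le> C"
  shows "((\<lambda>\<epsilon>. LINT y|lborel. indicator unit_ball y *
        ((signed_powr q (g \<bullet> y + \<epsilon> * w y) - signed_powr q (g \<bullet> y - \<epsilon> * w y)) / (2 * \<epsilon>) * k y))
      \<longlongrightarrow> q * (LINT y|lborel. indicator unit_ball y * (\<bar>g \<bullet> y\<bar> powr (q - 1) * (w y * k y)))) (at_right 0)"
proof -
  define G where "G = (norm g + C) powr (q - 1)"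
  have C: "0 \<le> C" using w[of 0] by auto
  \<comment> \<open>For \<open>q \<le> 1\<close> the difference quotient is controlled by the
    singular weight, for \<open>q > 1\<close> by a constant; the sum of the two serves as one
    majorant.\<close>
  have quot: "\<bar>(signed_powr q (a + \<epsilon> * v) - signed_powr q (a - \<epsilon> * v)) / (2 * \<epsilon>)\<bar> \<le> C * (2 * \<bar>a\<bar> powr (q - 1) + q * G)"
    if a: "a \<noteq> 0" "\<bar>a\<bar> \<le> norm g" and v: "\<bar>v\<bar> \<le> C" and \<epsilon>: "0 < \<epsilon>" "\<epsilon> < 1" for a v \<epsilon>
  proof (cases "q \<le> 1")
    case True
    have "\<bar>signed_powr q (a + \<epsilon> * v) - signed_powr q (a - \<epsilon> * v)\<bar> \<le> 4 * \<bar>\<epsilon> * v\<bar> * \<bar>a\<bar> powr (q - 1)"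
      by (rule signed_powr_symmetric_difference_bound_le1) (use True q a in auto)
    also have "\<dots> \<le> 4 * (\<epsilon> * C) * \<bar>a\<bar> powr (q - 1)"
      using v \<epsilon> by (intro mult_right_mono mult_left_mono) (auto simp: abs_mult)
    finally have "\<bar>(signed_powr q (a + \<epsilon> * v) - signed_powr q (a - \<epsilon> * v)) / (2 * \<epsilon>)\<bar> \<le> C * (2 * \<bar>a\<bar> powr (q - 1))"
      using \<epsilon> by (simp add: abs_divide abs_mult field_simps)
    also have "\<dots> \<le> C * (2 * \<bar>a\<bar> powr (q - 1) + q * G)"
      using C q by (intro mult_left_mono) (auto simp: G_def)
    finally show ?thesis .
  next
    case False
    have "\<bar>signed_powr q (a + \<epsilon> * v) - signed_powr q (a - \<epsilon> * v)\<bar> \<le> 2 * q * \<bar>\<epsilon> * v\<bar> * (\<bar>a\<bar> + \<bar>\<epsilon> * v\<bar>) powr (q - 1)"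
      by (rule signed_powr_symmetric_difference_bound_ge1) (use False in auto)
    also have "\<dots> \<le> 2 * q * (\<epsilon> * C) * G"
    proof (intro mult_mono mult_left_mono)
      show "\<bar>\<epsilon> * v\<bar> \<le> \<epsilon> * C" using v \<epsilon> by (simp add: abs_mult)
      have "\<bar>\<epsilon> * v\<bar> \<le> 1 * C" unfolding abs_mult using v \<epsilon> by (intro mult_mono) auto
      then show "(\<bar>a\<bar> + \<bar>\<epsilon> * v\<bar>) powr (q - 1) \<le> G"
        unfolding G_def using False a by (intro powr_mono2) auto
    qed (use q C \<epsilon> in auto)
    finally have "\<bar>(signed_powr q (a + \<epsilon> * v) - signed_powr q (a - \<epsilon> * v)) / (2 * \<epsilon>)\<bar> \<le> C * (q * G)"
      using \<epsilon> by (simp add: abs_divide abs_mult field_simps)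
    also have "\<dots> \<le> C * (2 * \<bar>a\<bar> powr (q - 1) + q * G)"
      using C by (intro mult_left_mono) auto
    finally show ?thesis .
  qed
  have "((\<lambda>\<epsilon>. LINT y|lborel. indicator unit_ball y *
        ((signed_powr q (g \<bullet> y + \<epsilon> * w y) - signed_powr q (g \<bullet> y - \<epsilon> * w y)) / (2 * \<epsilon>) * k y))
      \<longlongrightarrow> (LINT y|lborel. indicator unit_ball y * (q * \<bar>g \<bullet> y\<bar> powr (q - 1) * w y * k y))) (at_right 0)"
  proof (rule integral_dominated_convergence_at_right
      [where w="\<lambda>y. C * C * (2 * (indicator unit_ball y * \<bar>g \<bullet> y\<bar> powr (q - 1)) + q * G * indicator unit_ball y)"])
    have "integrable lborel (indicator unit_ball :: 'a \<Rightarrow> real)"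
      using emeasure_lborel_ball_finite[of "0::'a" 1] by (simp add: integrable_indicator_iff)
    then show "integrable lborel (\<lambda>y. C * C * (2 * (indicator unit_ball y * \<bar>g \<bullet> y\<bar> powr (q - 1)) + q * G * indicator unit_ball y))"
      using integrable_ball_inner_powr[OF g, of "q - 1"] q by simp
    show "AE y in lborel. ((\<lambda>\<epsilon>. indicator unit_ball y *
        ((signed_powr q (g \<bullet> y + \<epsilon> * w y) - signed_powr q (g \<bullet> y - \<epsilon> * w y)) / (2 * \<epsilon>) * k y))
        \<longlongrightarrow> indicator unit_ball y * (q * \<bar>g \<bullet> y\<bar> powr (q - 1) * w y * k y)) (at_right 0)"
      using AE_lborel_inner_nonzero[OF g]
    proof (rule AE_mp, intro AE_I2 impI)
      fix y assume "g \<bullet> y \<noteq> 0"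
      from tendsto_signed_powr_symmetric_difference[OF this, of q "w y"]
      have "((\<lambda>\<epsilon>. (signed_powr q (g \<bullet> y + \<epsilon> * w y) - signed_powr q (g \<bullet> y - \<epsilon> * w y)) / (2 * \<epsilon>))
        \<longlongrightarrow> q * \<bar>g \<bullet> y\<bar> powr (q - 1) * w y) (at_right 0)"
        by (rule filterlim_mono) (auto simp: at_le)
      then show "((\<lambda>\<epsilon>. indicator unit_ball y *
        ((signed_powr q (g \<bullet> y + \<epsilon> * w y) - signed_powr q (g \<bullet> y - \<epsilon> * w y)) / (2 * \<epsilon>) * k y))
        \<longlongrightarrow> indicator unit_ball y * (q * \<bar>g \<bullet> y\<bar> powr (q - 1) * w y * k y)) (at_right 0)"
        by (intro tendsto_intros)
    qed
    have "\<forall>\<^sub>F \<epsilon> in at_right 0. 0 < \<epsilon> \<and> \<epsilon> < (1::real)"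
      by (auto simp: eventually_at_right_field intro!: exI[of _ 1])
    then show "\<forall>\<^sub>F \<epsilon> in at_right 0. AE y in lborel. norm (indicator unit_ball y *
        ((signed_powr q (g \<bullet> y + \<epsilon> * w y) - signed_powr q (g \<bullet> y - \<epsilon> * w y)) / (2 * \<epsilon>) * k y))
        \<le> C * C * (2 * (indicator unit_ball y * \<bar>g \<bullet> y\<bar> powr (q - 1)) + q * G * indicator unit_ball y)"
    proof eventually_elim
      case (elim \<epsilon>)
      show ?case using AE_lborel_inner_nonzero[OF g]
      proof (rule AE_mp, intro AE_I2 impI)
        fix y assume nz: "g \<bullet> y \<noteq> 0"
        show "norm (indicator unit_ball y *
          ((signed_powr q (g \<bullet> y + \<epsilon> * w y) - signed_powr q (g \<bullet> y - \<epsilon> * w y)) / (2 * \<epsilon>) * k y))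
          \<le> C * C * (2 * (indicator unit_ball y * \<bar>g \<bullet> y\<bar> powr (q - 1)) + q * G * indicator unit_ball y)"
        proof (cases "y \<in> unit_ball")
          case True
          have "\<bar>g \<bullet> y\<bar> \<le> norm g * norm y" by (rule Cauchy_Schwarz_ineq2)
          also have "\<dots> \<le> norm g * 1" using True by (intro mult_left_mono) auto
          finally have "\<bar>g \<bullet> y\<bar> \<le> norm g" by simp
          from mult_mono[OF quot[OF nz this w[OF True], of \<epsilon>] k[OF True]] elim True C q
          show ?thesis by (simp add: abs_mult mult_ac G_def)
        qed simp
      qed
    qed
  qed measurable
  also have "(LINT y|lborel. indicator unit_ball y * (q * \<bar>g \<bullet> y\<bar> powr (q - 1) * w y * k y))
      = q * (LINT y|lborel. indicator unit_ball y * (\<bar>g \<bullet> y\<bar> powr (q - 1) * (w y * k y)))"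
    by (subst integral_mult_right_zero[symmetric]) (simp only: mult_ac)
  finally show ?thesis .
qed

lemma integrable_ball_signed_powr:
  assumes q: "q \<ge> 0" and [measurable]: "w \<in> borel_measurable borel" "k \<in> borel_measurable borel"
    and w: "\<And>y. y \<in> unit_ball \<Longrightarrow> \<bar>w y\<bar> \<le> C" and k: "\<And>y. y \<in> unit_ball \<Longrightarrow> \<bar>k y\<bar> \<le> C"
  shows "integrable lborel (\<lambda>y. indicator unit_ball y * (signed_powr q (g \<bullet> y + \<epsilon> * w y) * k y))"
proof (rule integrable_lborel_ball)
  fix y assume y: "y \<in> unit_ball"
  have "\<bar>g \<bullet> y\<bar> \<le> norm g * norm y" by (rule Cauchy_Schwarz_ineq2)
  also have "\<dots> \<le> norm g * 1" using y by (intro mult_left_mono) auto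
  finally have "\<bar>g \<bullet> y\<bar> \<le> norm g" by simp
  moreover have "\<bar>\<epsilon> * w y\<bar> \<le> \<bar>\<epsilon>\<bar> * C" unfolding abs_mult using w[OF y] by (intro mult_left_mono) auto
  ultimately have "\<bar>g \<bullet> y + \<epsilon> * w y\<bar> \<le> norm g + \<bar>\<epsilon>\<bar> * C" by linarith
  then have "\<bar>signed_powr q (g \<bullet> y + \<epsilon> * w y)\<bar> \<le> (norm g + \<bar>\<epsilon>\<bar> * C) powr q"
    using q by (simp add: powr_mono2)
  then show "\<bar>signed_powr q (g \<bullet> y + \<epsilon> * w y) * k y\<bar> \<le> (norm g + \<bar>\<epsilon>\<bar> * C) powr q * C"
    unfolding abs_mult using k[OF y] by (intro mult_mono) auto
qed measurable

text \<open>The isometry \<open>R\<close> turns the integral at \<open>\<epsilon>\<close> into minus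
  the integral at \<open>- \<epsilon>\<close>, and averaging the two expressions gives the symmetric
  difference. Its instances are the antipodal map and reflections, according to the symmetry of
  \<open>w\<close> and \<open>k\<close>.\<close>

lemma ball_signed_powr_symmetrize:
  assumes q: "q \<ge> 0" and [measurable]: "w \<in> borel_measurable borel" "k \<in> borel_measurable borel"
    and w: "\<And>y. y \<in> unit_ball \<Longrightarrow> \<bar>w y\<bar> \<le> C" and k: "\<And>y. y \<in> unit_ball \<Longrightarrow> \<bar>k y\<bar> \<le> C"
    and R: "orthogonal_transformation R"
    and inv: "\<And>y. signed_powr q (g \<bullet> R y + \<epsilon> * w (R y)) * k (R y) = - signed_powr q (g \<bullet> y - \<epsilon> * w y) * k y"
  shows "(LINT y|lborel. indicator unit_ball y * (signed_powr q (g \<bullet> y + \<epsilon> * w y) * k y)) =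
    (LINT y|lborel. indicator unit_ball y * ((signed_powr q (g \<bullet> y + \<epsilon> * w y) - signed_powr q (g \<bullet> y - \<epsilon> * w y)) / 2 * k y))"
proof -
  let ?f = "\<lambda>\<epsilon> y. indicator unit_ball y * (signed_powr q (g \<bullet> y + \<epsilon> * w y) * k y)"
  have "(LINT y|lborel. ?f \<epsilon> y) = (LINT y|lborel. ?f \<epsilon> (R y))"
    by (rule integral_lborel_orthogonal[OF R, symmetric]) measurable
  also have "\<dots> = (LINT y|lborel. - ?f (-\<epsilon>) y)"
    unfolding inv using orthogonal_transformation_norm[OF R] by (simp add: indicator_def)
  finally have "(LINT y|lborel. ?f \<epsilon> y) = - (LINT y|lborel. ?f (-\<epsilon>) y)" by simp
  moreover have int: "integrable lborel (?f \<epsilon>)" for \<epsilon>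
    by (rule integrable_ball_signed_powr[OF q _ _ w k]) auto
  ultimately have "(LINT y|lborel. ?f \<epsilon> y) = (LINT y|lborel. (?f \<epsilon> y - ?f (-\<epsilon>) y) / 2)"
    using Bochner_Integration.integral_diff[OF int[of \<epsilon>] int[of "-\<epsilon>"]] by simp
  also have "\<dots> = (LINT y|lborel. indicator unit_ball y *
      ((signed_powr q (g \<bullet> y + \<epsilon> * w y) - signed_powr q (g \<bullet> y - \<epsilon> * w y)) / 2 * k y))"
    by (intro Bochner_Integration.integral_cong) (auto simp: algebra_simps diff_divide_distrib)
  finally show ?thesis .
qed

lemma tendsto_ball_signed_powr:
  assumes q: "q > 0" and [measurable]: "w \<in> borel_measurable borel"
    and w: "\<And>y. y \<in> unit_ball \<Longrightarrow> \<bar>w y\<bar> \<le> C" and even: "\<And>y. w (- y) = w y"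
  shows "((\<lambda>\<epsilon>. (LINT y|lborel. indicator unit_ball y * signed_powr q (g \<bullet> y + \<epsilon> * w y)) / \<epsilon>)
      \<longlongrightarrow> q * (LINT y|lborel. indicator unit_ball y * (\<bar>g \<bullet> y\<bar> powr (q - 1) * w y))) (at_right 0)"
proof -
  have eq: "(LINT y|lborel. indicator unit_ball y * signed_powr q (g \<bullet> y + \<epsilon> * w y)) / \<epsilon> = (LINT y|lborel. indicator unit_ball y *
        ((signed_powr q (g \<bullet> y + \<epsilon> * w y) - signed_powr q (g \<bullet> y - \<epsilon> * w y)) / (2 * \<epsilon>) * 1))" for \<epsilon>
  proof -
    have "(LINT y|lborel. indicator unit_ball y * (signed_powr q (g \<bullet> y + \<epsilon> * w y) * 1)) =
      (LINT y|lborel. indicator unit_ball y * ((signed_powr q (g \<bullet> y + \<epsilon> * w y) - signed_powr q (g \<bullet> y - \<epsilon> * w y)) / 2 * 1))"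
    \<comment> \<open>\<open>max C 1\<close> bounds both \<open>w\<close> and the constant factor
      \<open>k = 1\<close>.\<close>
    proof (rule ball_signed_powr_symmetrize[where R=uminus and C="max C 1"])
      show "orthogonal_transformation (uminus :: 'a \<Rightarrow> 'a)"
        by (auto simp: orthogonal_transformation_def intro!: linearI)
      show "signed_powr q (g \<bullet> - y + \<epsilon> * w (- y)) * 1 = - signed_powr q (g \<bullet> y - \<epsilon> * w y) * 1" for y
        using signed_powr_minus[of q "g \<bullet> y - \<epsilon> * w y"] by (simp add: even add.commute)
      show "\<bar>w y\<bar> \<le> max C 1" if "y \<in> unit_ball" for y using w[OF that] by simp
    qed (use q in auto)
    then have "(LINT y|lborel. indicator unit_ball y * signed_powr q (g \<bullet> y + \<epsilon> * w y)) / \<epsilon> =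
      (LINT y|lborel. indicator unit_ball y * ((signed_powr q (g \<bullet> y + \<epsilon> * w y) - signed_powr q (g \<bullet> y - \<epsilon> * w y)) / 2 * 1)) / \<epsilon>"
      by (simp only: mult_1_right)
    also have "\<dots> = (LINT y|lborel. indicator unit_ball y *
        ((signed_powr q (g \<bullet> y + \<epsilon> * w y) - signed_powr q (g \<bullet> y - \<epsilon> * w y)) / (2 * \<epsilon>) * 1))"
      by (subst integral_divide_zero[symmetric]) (simp add: mult_ac)
    finally show ?thesis .
  qed
  have "((\<lambda>\<epsilon>. LINT y|lborel. indicator unit_ball y *
        ((signed_powr q (g \<bullet> y + \<epsilon> * w y) - signed_powr q (g \<bullet> y - \<epsilon> * w y)) / (2 * \<epsilon>) * 1))
      \<longlongrightarrow> q * (LINT y|lborel. indicator unit_ball y * (\<bar>g \<bullet> y\<bar> powr (q - 1) * (w y * 1)))) (at_right 0)"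
    by (rule tendsto_ball_symmetric_difference[where C="max C 1"]) (use w q in \<open>auto simp: le_max_iff_disj\<close>)
  then show ?thesis unfolding eq by simp
qed

section \<open>Second moments of the unit ball for the singular weight\<close>

lemma inner_le_norm_ball: "y \<in> unit_ball \<Longrightarrow> \<bar>a \<bullet> y\<bar> \<le> norm a"
proof -
  assume y: "y \<in> unit_ball"
  have "\<bar>a \<bullet> y\<bar> \<le> norm a * norm y" by (rule Cauchy_Schwarz_ineq2)
  also have "\<dots> \<le> norm a * 1" using y by (intro mult_left_mono) auto
  finally show ?thesis by simp
qed

lemma inner_inner_le_norm_ball: "y \<in> unit_ball \<Longrightarrow> \<bar>(a \<bullet> y) * (b \<bullet> y)\<bar> \<le> norm a * norm b"
  unfolding abs_mult by (intro mult_mono inner_le_norm_ball) auto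

lemma integrable_ball_weight_inner:
  assumes "q > 0"
  shows "integrable lborel (\<lambda>y. indicator unit_ball y * \<bar>g \<bullet> y\<bar> powr (q - 1) * ((a \<bullet> y) * (b \<bullet> y)))"
  using integrable_ball_weight[OF assms, of "\<lambda>y. (a \<bullet> y) * (b \<bullet> y)" "norm a * norm b"] inner_inner_le_norm_ball
  by (simp add: mult.assoc)

definition "second_moment a = (LINT y|lborel. indicator unit_ball y * \<bar>g \<bullet> y\<bar> powr (q - 1) * (a \<bullet> y)\<^sup>2)"

lemma second_moment_scale: "second_moment (c *\<^sub>R a) = c\<^sup>2 * second_moment a"
proof -
  have "second_moment (c *\<^sub>R a) = (LINT y|lborel. c\<^sup>2 * (indicator unit_ball y * \<bar>g \<bullet> y\<bar> powr (q - 1) * (a \<bullet> y)\<^sup>2))"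
    unfolding second_moment_def
    by (intro Bochner_Integration.integral_cong) (auto simp: power_mult_distrib mult_ac)
  then show ?thesis by (simp add: second_moment_def)
qed

text \<open>Differentiate at \<open>\<theta> = 0\<close> the identity
  \<open>\<integral> signed_powr q ((g + \<theta> f) \<bullet> y) ((f - \<theta> g) \<bullet> y) dy = 0\<close>, which holds because the reflection in the
  direction \<open>f - \<theta> g\<close> fixes the first factor and negates the second.\<close>

lemma second_moment_orthogonal:
  assumes q: "q > 0" and orth: "f \<bullet> g = 0" and norm: "norm f = norm g"
  shows "q * second_moment f = second_moment g"
proof -
  have ff: "f \<bullet> f = g \<bullet> g" using norm by (simp add: norm_eq)
  let ?I = "\<lambda>\<theta> k. LINT y|lborel. indicator unit_ball y * (signed_powr q (g \<bullet> y + \<theta> * (f \<bullet> y)) * (k \<bullet> y))"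
  have int: "integrable lborel (\<lambda>y. indicator unit_ball y * (signed_powr q (g \<bullet> y + \<theta> * (f \<bullet> y)) * (k \<bullet> y)))" for \<theta> k
  proof (rule integrable_ball_signed_powr[where C="max (norm f) (norm k)"])
    fix y assume "y \<in> unit_ball"
    from inner_le_norm_ball[OF this] show "\<bar>f \<bullet> y\<bar> \<le> max (norm f) (norm k)" "\<bar>k \<bullet> y\<bar> \<le> max (norm f) (norm k)"
      by (auto simp: le_max_iff_disj)
  qed (use q in auto)
  \<comment> \<open>Expanding the vanishing integral at \<open>v = f - \<theta> *\<^sub>R g\<close>
    replaces the difference quotient by an integral without division by \<open>\<theta>\<close>,
    whose limit is \<open>second_moment g\<close>.\<close>
  have rot: "?I \<theta> f / \<theta> = ?I \<theta> g" if "\<theta> > 0" for \<theta>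
  proof -
    define v where "v = f - \<theta> *\<^sub>R g"
    have "(g + \<theta> *\<^sub>R f) \<bullet> v = 0"
      using orth ff by (simp add: v_def inner_diff_right inner_add_left inner_commute[of g f])
    then have inv: "(g + \<theta> *\<^sub>R f) \<bullet> reflect v y = (g + \<theta> *\<^sub>R f) \<bullet> y" for y by simp
    let ?h = "\<lambda>y. indicator unit_ball y * (signed_powr q ((g + \<theta> *\<^sub>R f) \<bullet> y) * (v \<bullet> y))"
    have "(LINT y|lborel. ?h y) = (LINT y|lborel. ?h (reflect v y))"
      by (rule integral_lborel_reflect[symmetric]) measurable
    also have "\<dots> = (LINT y|lborel. - ?h y)"
      by (simp only: inv inner_reflect_self) (simp add: indicator_def)
    finally have "(LINT y|lborel. ?h y) = 0" by simp
    moreover have "?h y = indicator unit_ball y * (signed_powr q (g \<bullet> y + \<theta> * (f \<bullet> y)) * (f \<bullet> y))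
       - \<theta> * (indicator unit_ball y * (signed_powr q (g \<bullet> y + \<theta> * (f \<bullet> y)) * (g \<bullet> y)))" for y
      by (simp add: v_def inner_add_left inner_diff_left algebra_simps)
    ultimately have "?I \<theta> f - \<theta> * ?I \<theta> g = 0" using int by simp
    then show ?thesis using that by (simp add: field_simps)
  qed
  \<comment> \<open>Here reflection in \<open>f\<close> fixes \<open>g \<bullet> y\<close> and
    negates \<open>f \<bullet> y\<close>. The same quotient, now a symmetric difference, tends to
    \<open>q * second_moment f\<close>.\<close>
  have sym: "?I \<theta> f / \<theta> = (LINT y|lborel. indicator unit_ball y *
        ((signed_powr q (g \<bullet> y + \<theta> * (f \<bullet> y)) - signed_powr q (g \<bullet> y - \<theta> * (f \<bullet> y))) / (2 * \<theta>) * (f \<bullet> y)))" for \<theta>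
  proof -
    have "?I \<theta> f = (LINT y|lborel. indicator unit_ball y *
        ((signed_powr q (g \<bullet> y + \<theta> * (f \<bullet> y)) - signed_powr q (g \<bullet> y - \<theta> * (f \<bullet> y))) / 2 * (f \<bullet> y)))"
      by (rule ball_signed_powr_symmetrize[where R="reflect f" and C="norm f"])
        (use q orth inner_le_norm_ball orthogonal_transformation_reflect in \<open>auto simp: inner_commute\<close>)
    then have "?I \<theta> f / \<theta> = (LINT y|lborel. indicator unit_ball y *
        ((signed_powr q (g \<bullet> y + \<theta> * (f \<bullet> y)) - signed_powr q (g \<bullet> y - \<theta> * (f \<bullet> y))) / 2 * (f \<bullet> y))) / \<theta>" by (simp only:)
    also have "\<dots> = (LINT y|lborel. indicator unit_ball y *
        ((signed_powr q (g \<bullet> y + \<theta> * (f \<bullet> y)) - signed_powr q (g \<bullet> y - \<theta> * (f \<bullet> y))) / (2 * \<theta>) * (f \<bullet> y)))"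
      by (subst integral_divide_zero[symmetric]) (simp add: mult_ac)
    finally show ?thesis .
  qed
  have "((\<lambda>\<theta>. ?I \<theta> f / \<theta>) \<longlongrightarrow> q * (LINT y|lborel. indicator unit_ball y * (\<bar>g \<bullet> y\<bar> powr (q - 1) * ((f \<bullet> y) * (f \<bullet> y))))) (at_right 0)"
    unfolding sym by (rule tendsto_ball_symmetric_difference[where C="norm f"]) (use q inner_le_norm_ball in auto)
  then have lim1: "((\<lambda>\<theta>. ?I \<theta> f / \<theta>) \<longlongrightarrow> q * second_moment f) (at_right 0)"
    by (simp add: second_moment_def power2_eq_square mult.assoc)
  have "((\<lambda>\<theta>. ?I \<theta> g) \<longlongrightarrow> (LINT y|lborel. indicator unit_ball y * (signed_powr q (g \<bullet> y) * (g \<bullet> y)))) (at_right 0)"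
  proof (rule integral_dominated_convergence_at_right[where w="\<lambda>y. (norm g + norm f) powr q * norm g * indicator unit_ball y"])
    have "integrable lborel (indicator unit_ball :: 'a \<Rightarrow> real)"
      using emeasure_lborel_ball_finite[of "0::'a" 1] by (simp add: integrable_indicator_iff)
    then show "integrable lborel (\<lambda>y. (norm g + norm f) powr q * norm g * indicator unit_ball y)" by simp
    show "AE y in lborel. ((\<lambda>\<theta>. indicator unit_ball y * (signed_powr q (g \<bullet> y + \<theta> * (f \<bullet> y)) * (g \<bullet> y)))
       \<longlongrightarrow> indicator unit_ball y * (signed_powr q (g \<bullet> y) * (g \<bullet> y))) (at_right 0)"
    proof (intro AE_I2 tendsto_intros)
      fix y
      have "((\<lambda>\<theta>. g \<bullet> y + \<theta> * (f \<bullet> y)) \<longlongrightarrow> g \<bullet> y + 0 * (f \<bullet> y)) (at_right 0)" by (intro tendsto_intros)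
      then show "((\<lambda>\<theta>. signed_powr q (g \<bullet> y + \<theta> * (f \<bullet> y))) \<longlongrightarrow> signed_powr q (g \<bullet> y)) (at_right 0)"
        using isCont_tendsto_compose[OF continuous_signed_powr[OF q]] by fastforce
    qed
    have "\<forall>\<^sub>F \<theta> in at_right 0. 0 < \<theta> \<and> \<theta> < (1::real)"
      by (auto simp: eventually_at_right_field intro!: exI[of _ 1])
    then show "\<forall>\<^sub>F \<theta> in at_right 0. AE y in lborel.
        norm (indicator unit_ball y * (signed_powr q (g \<bullet> y + \<theta> * (f \<bullet> y)) * (g \<bullet> y))) \<le> (norm g + norm f) powr q * norm g * indicator unit_ball y"
    proof eventually_elim
      case (elim \<theta>)
      show ?case
      proof (rule AE_I2)
        fix y
        show "norm (indicator unit_ball y * (signed_powr q (g \<bullet> y + \<theta> * (f \<bullet> y)) * (g \<bullet> y))) \<le> (norm g + norm f) powr q * norm g * indicator unit_ball y"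
        proof (cases "y \<in> unit_ball")
          case True
          have "\<bar>\<theta> * (f \<bullet> y)\<bar> \<le> 1 * norm f"
            unfolding abs_mult using elim inner_le_norm_ball[OF True] by (intro mult_mono) auto
          then have "\<bar>g \<bullet> y + \<theta> * (f \<bullet> y)\<bar> \<le> norm g + norm f" using inner_le_norm_ball[OF True, of g] by linarith
          then have "\<bar>g \<bullet> y + \<theta> * (f \<bullet> y)\<bar> powr q \<le> (norm g + norm f) powr q" using q by (intro powr_mono2) auto
          then show ?thesis using True inner_le_norm_ball[OF True, of g] by (auto simp: abs_mult intro!: mult_mono)
        qed simp
      qed
    qed
  qed measurable
  also have "(LINT y|lborel. indicator unit_ball y * (signed_powr q (g \<bullet> y) * (g \<bullet> y))) = second_moment g"
    unfolding second_moment_def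
  proof (intro Bochner_Integration.integral_cong refl)
    fix y
    have "signed_powr q (g \<bullet> y) * (g \<bullet> y) = \<bar>g \<bullet> y\<bar> powr (q - 1) * (g \<bullet> y)\<^sup>2"
      by (cases "g \<bullet> y = 0") (auto simp: signed_powr_def powr_diff sgn_if power2_eq_square)
    then show "indicator unit_ball y * (signed_powr q (g \<bullet> y) * (g \<bullet> y)) = indicator unit_ball y * \<bar>g \<bullet> y\<bar> powr (q - 1) * (g \<bullet> y)\<^sup>2"
      by simp
  qed
  finally have "((\<lambda>\<theta>. ?I \<theta> f / \<theta>) \<longlongrightarrow> second_moment g) (at_right 0)"
    by (rule Lim_transform_eventually) (auto simp: eventually_at_right_field rot intro!: exI[of _ 1])
  with lim1 show ?thesis by (intro tendsto_unique) auto
qed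

text \<open>Split \<open>a\<close> into a multiple of \<open>g\<close> and an orthogonal part
  \<open>f\<close>: reflection in \<open>g\<close> kills the mixed term, and \<open>f\<close>,
  rescaled to the length of \<open>g\<close>, has \<open>1 / q\<close> times the moment of
  \<open>g\<close>. For \<open>q = p - 1\<close> the factor
  \<open>(q - 1) / (norm g)\<^sup>2\<close> is the one in the normalized Laplacian.\<close>

lemma second_moment_eq:
  assumes q: "q > 0"
  shows "second_moment a = second_moment g / (q * (norm g)\<^sup>2) * (a \<bullet> a + (q - 1) / (norm g)\<^sup>2 * (a \<bullet> g)\<^sup>2)"
proof -
  have gg: "g \<bullet> g \<noteq> 0" using g by simp
  define \<alpha> where "\<alpha> = (a \<bullet> g) / (g \<bullet> g)"
  define f where "f = a - \<alpha> *\<^sub>R g"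
  have fg: "f \<bullet> g = 0" using gg by (simp add: f_def \<alpha>_def inner_diff_left)
  have a: "a = \<alpha> *\<^sub>R g + f" by (simp add: f_def)
  have f2: "q * second_moment f * (g \<bullet> g) = second_moment g * (f \<bullet> f)"
  proof (cases "f = 0")
    case True then show ?thesis by (simp add: second_moment_def)
  next
    case False
    have "q * second_moment ((norm g / norm f) *\<^sub>R f) = second_moment g"
      using False fg by (intro second_moment_orthogonal[OF q]) auto
    then have "q * (((norm g)\<^sup>2 / (norm f)\<^sup>2) * second_moment f) = second_moment g"
      by (simp only: second_moment_scale power_divide)
    then show ?thesis using False by (simp add: power2_norm_eq_inner field_simps)
  qed
  have mixed: "(LINT y|lborel. indicator unit_ball y * \<bar>g \<bullet> y\<bar> powr (q - 1) * ((g \<bullet> y) * (f \<bullet> y))) = 0"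
  proof -
    let ?h = "\<lambda>y. indicator unit_ball y * \<bar>g \<bullet> y\<bar> powr (q - 1) * ((g \<bullet> y) * (f \<bullet> y))"
    have "(LINT y|lborel. ?h y) = (LINT y|lborel. ?h (reflect g y))"
      by (rule integral_lborel_reflect[symmetric]) measurable
    also have "\<dots> = (LINT y|lborel. - ?h y)"
      by (simp only: inner_reflect_self inner_reflect_orthogonal[OF fg]) (simp add: indicator_def)
    finally show ?thesis by simp
  qed
  have "second_moment a = (LINT y|lborel. \<alpha>\<^sup>2 * (indicator unit_ball y * \<bar>g \<bullet> y\<bar> powr (q - 1) * ((g \<bullet> y) * (g \<bullet> y)))
    + (indicator unit_ball y * \<bar>g \<bullet> y\<bar> powr (q - 1) * ((f \<bullet> y) * (f \<bullet> y)))
    + 2 * \<alpha> * (indicator unit_ball y * \<bar>g \<bullet> y\<bar> powr (q - 1) * ((g \<bullet> y) * (f \<bullet> y))))"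
    unfolding second_moment_def
    by (intro Bochner_Integration.integral_cong) (auto simp: a inner_add_left power2_eq_square algebra_simps)
  also have "\<dots> = \<alpha>\<^sup>2 * second_moment g + second_moment f"
    using integrable_ball_weight_inner[OF q] mixed by (simp add: second_moment_def power2_eq_square)
  finally have sm: "second_moment a = \<alpha>\<^sup>2 * second_moment g + second_moment f" .
  have aa: "a \<bullet> a = \<alpha>\<^sup>2 * (g \<bullet> g) + f \<bullet> f" and ag: "a \<bullet> g = \<alpha> * (g \<bullet> g)"
    using fg by (simp_all add: a inner_add_left inner_add_right inner_commute power2_eq_square)
  have "second_moment f = second_moment g * (f \<bullet> f) / (q * (g \<bullet> g))"
    using f2 q gg by (simp add: field_simps)
  then show ?thesis unfolding sm aa ag power2_norm_eq_inner using gg q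
    by (simp add: field_simps power2_eq_square)
qed

lemma second_moment_pos:
  assumes q: "q > 0" shows "second_moment g > 0"
proof -
  let ?h = "\<lambda>y. indicator unit_ball y * \<bar>g \<bullet> y\<bar> powr (q - 1) * (g \<bullet> y)\<^sup>2"
  have int: "integrable lborel ?h"
    using integrable_ball_weight_inner[OF q, of g g] by (simp add: power2_eq_square)
  have "second_moment g \<noteq> 0"
  proof
    assume "second_moment g = 0"
    then have "AE y in lborel. ?h y = 0"
      using int by (simp add: second_moment_def integral_nonneg_eq_0_iff_AE)
    then have "AE y in lborel. y \<notin> unit_ball"
      using AE_lborel_inner_nonzero[OF g] by eventually_elim (auto simp: indicator_def)
    then have "unit_ball \<in> null_sets lborel" by (subst AE_iff_null_sets) auto
    then have "measure lborel unit_ball = 0" by (auto simp: measure_def null_sets_def)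
    then show False using content_ball_pos[of 1 "0::'a"] by simp
  qed
  moreover have "second_moment g \<ge> 0" unfolding second_moment_def by (intro integral_nonneg_AE AE_I2) auto
  ultimately show ?thesis by simp
qed

text \<open>On the unit ball the factor \<open>(g \<bullet> y)\<^sup>2\<close> is at most
  \<open>(norm g)\<^sup>2\<close>, so positivity passes from the second moment to the total
  weight.\<close>

lemma weight_pos:
  assumes q: "q > 0" shows "(LINT y|lborel. indicator unit_ball y * \<bar>g \<bullet> y\<bar> powr (q - 1)) > 0"
proof -
  have "second_moment g \<le> (LINT y|lborel. (norm g)\<^sup>2 * (indicator unit_ball y * \<bar>g \<bullet> y\<bar> powr (q - 1)))"
    unfolding second_moment_def
  proof (rule integral_mono)
    show "integrable lborel (\<lambda>y. indicator unit_ball y * \<bar>g \<bullet> y\<bar> powr (q - 1) * (g \<bullet> y)\<^sup>2)"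
      using integrable_ball_weight_inner[OF q, of g g] by (simp add: power2_eq_square)
    show "integrable lborel (\<lambda>y. (norm g)\<^sup>2 * (indicator unit_ball y * \<bar>g \<bullet> y\<bar> powr (q - 1)))"
      using integrable_ball_inner_powr[OF g, of "q - 1"] q by simp
    show "indicator unit_ball y * \<bar>g \<bullet> y\<bar> powr (q - 1) * (g \<bullet> y)\<^sup>2 \<le> (norm g)\<^sup>2 * (indicator unit_ball y * \<bar>g \<bullet> y\<bar> powr (q - 1))" for y
    proof (cases "y \<in> unit_ball")
      case True
      have "(g \<bullet> y)\<^sup>2 \<le> (norm g)\<^sup>2" using power_mono[OF inner_le_norm_ball[OF True, of g], of 2] by simp
      then show ?thesis using True by (simp add: mult.commute mult_right_mono)
    qed simp
  qed
  then have "0 < (norm g)\<^sup>2 * (LINT y|lborel. indicator unit_ball y * \<bar>g \<bullet> y\<bar> powr (q - 1))"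
    using second_moment_pos[OF q] by simp
  then show ?thesis by (simp add: zero_less_mult_iff)
qed

lemma quadratic_bounded_ball:
  assumes "linear (L :: 'a \<Rightarrow> 'a)" obtains C where "C \<ge> 0" "\<And>y. y \<in> unit_ball \<Longrightarrow> \<bar>y \<bullet> L y\<bar> \<le> C"
proof -
  obtain C where C: "C > 0" "\<And>y. norm (L y) \<le> C * norm y"
    using linear_bounded_pos[OF assms] by blast
  have "\<bar>y \<bullet> L y\<bar> \<le> C" if "y \<in> unit_ball" for y
  proof -
    have "\<bar>y \<bullet> L y\<bar> \<le> norm y * norm (L y)" by (rule Cauchy_Schwarz_ineq2)
    also have "\<dots> \<le> 1 * (C * 1)" using that C
      by (intro mult_mono order_trans[OF C(2)] mult_left_mono) auto
    finally show ?thesis by simp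
  qed
  with C that show thesis by (meson less_imp_le)
qed

text \<open>The witness \<open>K / (2 * W)\<close> makes \<open>m\<close> the weighted average of
  \<open>(y \<bullet> L y) / 2\<close>: \<open>K\<close> is the factor in the second moments and
  \<open>W\<close> the total weight. The first-order coefficient in \<open>\<epsilon>\<close> is
  then \<open>- q * \<eta> * W\<close>, which decides the sign. The witness depends only on
  \<open>g\<close> and \<open>q\<close>.\<close>

lemma eventually_ball_signed_powr_neg:
  assumes q: "q > 0"
  shows "\<exists>c>0. \<forall>L \<eta>. linear L \<and> \<eta> > 0 \<longrightarrow> (\<forall>\<^sub>F \<epsilon> in at_right 0. (LINT y|lborel. indicator unit_ball y *
    signed_powr q (g \<bullet> y + \<epsilon> * ((y \<bullet> L y) / 2 - c * ((\<Sum>b\<in>Basis. b \<bullet> L b) + (q - 1) / (norm g)\<^sup>2 * (g \<bullet> L g)) - \<eta>))) < 0)"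
proof -
  define W where "W = (LINT y|lborel. indicator unit_ball y * \<bar>g \<bullet> y\<bar> powr (q - 1))"
  define K where "K = second_moment g / (q * (norm g)\<^sup>2)"
  have W: "W > 0" unfolding W_def by (rule weight_pos[OF q])
  have K: "K > 0" unfolding K_def using second_moment_pos[OF q] q g by simp
  show ?thesis
  proof (intro exI[of _ "K / (2 * W)"] conjI allI impI)
    show "0 < K / (2 * W)" using W K by simp
    fix L :: "'a \<Rightarrow> 'a" and \<eta> :: real
    assume L\<eta>: "linear L \<and> \<eta> > 0"
    define m where "m = K / (2 * W) * ((\<Sum>b\<in>Basis. b \<bullet> L b) + (q - 1) / (norm g)\<^sup>2 * (g \<bullet> L g))"
    define w where "w y = (y \<bullet> L y) / 2 - m - \<eta>" for y
    have sq: "(LINT y|lborel. indicator unit_ball y * \<bar>g \<bullet> y\<bar> powr (q - 1) * (a \<bullet> y)\<^sup>2) =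
        K * (a \<bullet> a + (q - 1) / (norm g)\<^sup>2 * (a \<bullet> g)\<^sup>2)" for a
      using second_moment_eq[OF q, of a] by (simp only: second_moment_def[of a] K_def)
    have lin: "linear L" using L\<eta> by simp
    note Q = integral_quadratic_form[OF integrable_ball_weight_inner[OF q] sq lin]
    obtain C where C: "C \<ge> 0" "\<And>y. y \<in> unit_ball \<Longrightarrow> \<bar>y \<bullet> L y\<bar> \<le> C" using quadratic_bounded_ball L\<eta> by blast
    have [measurable]: "L \<in> borel_measurable borel"
      using L\<eta> by (intro borel_measurable_continuous_onI linear_continuous_on linear_conv_bounded_linear[THEN iffD1]) auto
    have [measurable]: "w \<in> borel_measurable borel" unfolding w_def by measurable
    have wb: "\<bar>w y\<bar> \<le> C + \<bar>m\<bar> + \<bar>\<eta>\<bar>" if "y \<in> unit_ball" for y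
      using C(1) C(2)[OF that] unfolding w_def by linarith
    have even: "w (- y) = w y" for y
      using L\<eta> by (simp add: w_def linear_neg)
    have "(LINT y|lborel. indicator unit_ball y * (\<bar>g \<bullet> y\<bar> powr (q - 1) * w y)) =
      (LINT y|lborel. (indicator unit_ball y * \<bar>g \<bullet> y\<bar> powr (q - 1) * (y \<bullet> L y)) / 2
        - (m + \<eta>) * (indicator unit_ball y * \<bar>g \<bullet> y\<bar> powr (q - 1)))"
      by (intro Bochner_Integration.integral_cong) (auto simp: w_def algebra_simps)
    also have "\<dots> = K * ((\<Sum>b\<in>Basis. b \<bullet> L b) + (q - 1) / (norm g)\<^sup>2 * (g \<bullet> L g)) / 2 - (m + \<eta>) * W"
      using Q integrable_ball_inner_powr[OF g, of "q - 1"] q by (simp add: W_def)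
    also have "\<dots> = - \<eta> * W" using W by (simp add: m_def field_simps)
    finally have lim: "((\<lambda>\<epsilon>. (LINT y|lborel. indicator unit_ball y * signed_powr q (g \<bullet> y + \<epsilon> * w y)) / \<epsilon>) \<longlongrightarrow> q * (- \<eta> * W)) (at_right 0)"
      using tendsto_ball_signed_powr[OF q \<open>w \<in> borel_measurable borel\<close> wb even] by simp
    have "q * (- \<eta> * W) < 0" using q W L\<eta> by (simp add: mult_neg_pos mult_pos_neg)
    from order_tendstoD(2)[OF lim this]
    have "\<forall>\<^sub>F \<epsilon> in at_right 0. (LINT y|lborel. indicator unit_ball y * signed_powr q (g \<bullet> y + \<epsilon> * w y)) < 0"
      using eventually_at_right_less[of 0] by eventually_elim (simp add: divide_less_0_iff)
    then show "\<forall>\<^sub>F \<epsilon> in at_right 0. (LINT y|lborel. indicator unit_ball y * signed_powr q (g \<bullet> y + \<epsilon> * ((y \<bullet> L y) / 2 -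
        K / (2 * W) * ((\<Sum>b\<in>Basis. b \<bullet> L b) + (q - 1) / (norm g)\<^sup>2 * (g \<bullet> L g)) - \<eta>))) < 0"
      by (simp only: w_def m_def)
  qed
qed

end

section \<open>Perturbed odd moments for \<open>p = 1\<close>\<close>

lemma perp_add_scale:
  assumes "norm e = 1" shows "perp e (z + t *\<^sub>R e) = perp e z"
  using inner_self_1[OF assms] by (simp add: perp_def inner_add_left scaleR_left_distrib)

text \<open>Where \<open>G * \<bar>t\<bar> < \<bar>h\<bar>\<close> the two signs are opposite and
  the integrand is \<open>sgn h\<close>; where the inequality is reversed they cancel. Only the two
  points of equality are discarded.\<close>

lemma integral_sgn_symmetric_difference:
  fixes G h s :: real
  assumes G: "G > 0" and s: "s > 0"
  shows "(LINT t|lborel. indicator {-s<..<s} t * ((sgn (G * t + h) - sgn (G * t - h)) / 2)) = sgn h * 2 * min s (\<bar>h\<bar> / G)"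
proof -
  define m where "m = min s (\<bar>h\<bar> / G)"
  have m: "m \<ge> 0" using G s by (simp add: m_def)
  have "AE t in lborel. t \<notin> {\<bar>h\<bar> / G, - \<bar>h\<bar> / G}"
    by (intro AE_not_in finite_imp_null_set_lborel) simp
  then have "AE t in lborel. indicator {-s<..<s} t * ((sgn (G * t + h) - sgn (G * t - h)) / 2) = sgn h * indicator {-m<..<m} t"
  proof eventually_elim
    case (elim t)
    have *: "\<bar>t\<bar> < \<bar>h\<bar> / G \<longleftrightarrow> G * \<bar>t\<bar> < \<bar>h\<bar>" "\<bar>t\<bar> > \<bar>h\<bar> / G \<longleftrightarrow> G * \<bar>t\<bar> > \<bar>h\<bar>"
      using G by (simp_all add: field_simps)
    have ab: "G * \<bar>t\<bar> = \<bar>G * t\<bar>" using G by (simp add: abs_mult)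
    have "\<bar>t\<bar> \<noteq> \<bar>h\<bar> / G" using elim by (auto simp: abs_if split: if_splits)
    then consider "G * \<bar>t\<bar> < \<bar>h\<bar>" "\<bar>t\<bar> < \<bar>h\<bar> / G" | "G * \<bar>t\<bar> > \<bar>h\<bar>" "\<bar>t\<bar> > \<bar>h\<bar> / G" using * by linarith
    then show ?case
    proof cases
      case 1
      then have "(sgn (G * t + h) - sgn (G * t - h)) / 2 = sgn h"
        unfolding ab by (auto simp: sgn_if abs_if split: if_splits)
      moreover have "t \<in> {-s<..<s} \<longleftrightarrow> t \<in> {-m<..<m}" using 1 by (auto simp: m_def)
      ultimately show ?thesis by (simp add: indicator_def)
    next
      case 2
      then have "(sgn (G * t + h) - sgn (G * t - h)) / 2 = 0"
        unfolding ab by (auto simp: sgn_if abs_if split: if_splits)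
      moreover have "t \<notin> {-m<..<m}" using 2 by (auto simp: m_def)
      ultimately show ?thesis by (simp add: indicator_def)
    qed
  qed
  then have "(LINT t|lborel. indicator {-s<..<s} t * ((sgn (G * t + h) - sgn (G * t - h)) / 2))
    = (LINT t|lborel. sgn h * indicator {-m<..<m} t)"
    by (intro integral_cong_AE) auto
  also have "\<dots> = sgn h * 2 * m" using m by simp
  finally show ?thesis by (simp only: m_def)
qed

context
  fixes g :: "'a::euclidean_space"
  assumes g: "g \<noteq> 0"
begin

abbreviation "unit_g \<equiv> g /\<^sub>R norm g"

lemma norm_unit_g: "norm unit_g = 1" using g by simp

abbreviation "perp_g \<equiv> perp unit_g"

lemma inner_unit_g: "g \<bullet> z = norm g * (z \<bullet> unit_g)"
  using g by (simp add: inner_commute)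

text \<open>The unit slab over the disc of radius 1 orthogonal to \<open>g\<close>. Because the slab
  has width 1, integrating a function of \<open>perp_g z\<close> over it amounts to integrating over
  the disc, without a surface measure.\<close>

definition "cyl = {z. \<bar>z \<bullet> unit_g\<bar> < 1/2 \<and> norm (perp_g z) < 1}"

lemma borel_measurable_perp_g [measurable]: "perp_g \<in> borel_measurable borel"
  by (rule borel_measurable_perp[OF norm_unit_g])

lemma cyl_borel [measurable]: "cyl \<in> sets borel"
  unfolding cyl_def by measurable

lemma perp_g_inner_g [simp]: "g \<bullet> perp_g z = 0" "perp_g z \<bullet> g = 0"
  using perp_inner[OF norm_unit_g, of z] g by (simp_all add: inner_commute)

lemma cyl_subset: "cyl \<subseteq> ball 0 2"
proof
  fix z assume z: "z \<in> cyl"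
  have "norm z = norm (perp_g z + (z \<bullet> unit_g) *\<^sub>R unit_g)" by (simp add: perp_def)
  also have "\<dots> \<le> norm (perp_g z) + norm ((z \<bullet> unit_g) *\<^sub>R unit_g)" by (rule norm_triangle_ineq)
  also have "norm ((z \<bullet> unit_g) *\<^sub>R unit_g) = \<bar>z \<bullet> unit_g\<bar>" using norm_unit_g by (simp only: norm_scaleR real_norm_def mult_1_right)
  finally show "z \<in> ball 0 2" using z by (simp add: cyl_def)
qed

lemma integrable_cyl:
  fixes f :: "'a \<Rightarrow> real"
  assumes [measurable]: "f \<in> borel_measurable borel" and b: "\<And>y. y \<in> cyl \<Longrightarrow> \<bar>f y\<bar> \<le> C"
  shows "integrable lborel (\<lambda>y. indicator cyl y * f y)"
proof -
  have eq: "indicator cyl y * f y = indicator (ball 0 2) y * (indicator cyl y * f y)" for y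
    using cyl_subset by (auto simp: indicator_def)
  have bound: "\<bar>indicator cyl y * f y\<bar> \<le> \<bar>C\<bar>" for y
  proof (cases "y \<in> cyl")
    case True
    then show ?thesis using b[OF True] by simp
  qed simp
  have "integrable lborel (\<lambda>y. indicator (ball 0 2) y * (indicator cyl y * f y))"
    by (rule integrable_lborel_ball[OF _ bound]) measurable
  then show ?thesis by (simp only: eq[symmetric])
qed

lemma perp_g_reflect_g [simp]: "perp_g (reflect g y) = perp_g y"
proof -
  define t where "t = - (2 * (g \<bullet> y) / (g \<bullet> g)) * norm g"
  have "reflect g y = y + t *\<^sub>R unit_g"
    using g by (simp add: reflect_def t_def)
  then show ?thesis by (simp only: perp_add_scale[OF norm_unit_g])
qed

text \<open>A perturbation depending only on \<open>perp_g y\<close> is constant along lines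
  parallel to \<open>g\<close>, so slicing leaves explicit one-dimensional integrals. For fixed
  \<open>z\<close> the sign changes on an interval of length about
  \<open>2 * \<epsilon> * \<bar>v\<bar> / norm g\<close>, hence the limit.\<close>

lemma tendsto_ball_sgn:
  assumes [measurable]: "v \<in> borel_measurable borel" and v: "\<And>y. norm y < 1 \<Longrightarrow> \<bar>v y\<bar> \<le> C"
  shows "((\<lambda>\<epsilon>. (LINT y|lborel. indicator (ball 0 1) y * signed_powr 0 (g \<bullet> y + \<epsilon> * v (perp_g y))) / \<epsilon>)
    \<longlongrightarrow> (LINT z|lborel. indicator cyl z * (2 * v (perp_g z) / norm g))) (at_right 0)"
proof -
  define G where "G = norm g"
  have G: "G > 0" using g by (simp add: G_def)
  have C: "C \<ge> 0" using v[of 0] by simp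
  \<comment> \<open>Half the length of the chord of the unit ball through \<open>z\<close> parallel
    to \<open>g\<close>.\<close>
  define s where "s z = sqrt (1 - (norm (perp_g z))\<^sup>2)" for z
  have [measurable]: "s \<in> borel_measurable borel" unfolding s_def by measurable
  have s: "s z > 0" if "norm (perp_g z) < 1" for z
    using abs_square_less_1[of "norm (perp_g z)"] that by (simp add: s_def)
  have vb: "\<bar>v (perp_g y)\<bar> \<le> C" if "y \<in> ball 0 1" for y
    using v norm_perp_le[OF norm_unit_g, of y] that by simp
  have eq: "(LINT y|lborel. indicator (ball 0 1) y * signed_powr 0 (g \<bullet> y + \<epsilon> * v (perp_g y))) / \<epsilon>
    = (LINT z|lborel. indicator cyl z * (sgn (v (perp_g z)) * 2 * min (s z / \<epsilon>) (\<bar>v (perp_g z)\<bar> / G)))"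
    if \<epsilon>: "\<epsilon> > 0" for \<epsilon>
  proof -
    let ?f = "\<lambda>y. indicator (ball 0 1) y * ((signed_powr 0 (g \<bullet> y + \<epsilon> * v (perp_g y)) - signed_powr 0 (g \<bullet> y - \<epsilon> * v (perp_g y))) / 2 * 1)"
    have "(LINT y|lborel. indicator (ball 0 1) y * (signed_powr 0 (g \<bullet> y + \<epsilon> * v (perp_g y)) * 1)) = (LINT y|lborel. ?f y)"
    \<comment> \<open>Reflection in \<open>g\<close> fixes \<open>perp_g y\<close>, so it gives the
      required oddness without any evenness of \<open>v\<close>.\<close>
    proof (rule ball_signed_powr_symmetrize[OF g, where R="reflect g" and C="max C 1"])
      show "orthogonal_transformation (reflect g)" by (rule orthogonal_transformation_reflect)
      show "signed_powr 0 (g \<bullet> reflect g y + \<epsilon> * v (perp_g (reflect g y))) * 1 = - signed_powr 0 (g \<bullet> y - \<epsilon> * v (perp_g y)) * 1" for y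
        using signed_powr_minus[of 0 "g \<bullet> y - \<epsilon> * v (perp_g y)"] by (simp add: add.commute)
      show "\<bar>v (perp_g y)\<bar> \<le> max C 1" if "y \<in> ball 0 1" for y using vb[OF that] by simp
    qed auto
    also have "(LINT y|lborel. ?f y) = (LINT z|lborel. indicator {z. \<bar>z \<bullet> unit_g\<bar> < 1/2} z *
        (LINT t|lborel. ?f (perp_g z + t *\<^sub>R unit_g)))"
    proof (rule integral_slice[OF norm_unit_g], rule integrable_lborel_ball[where C=1])
      fix y
      show "\<bar>(signed_powr 0 (g \<bullet> y + \<epsilon> * v (perp_g y)) - signed_powr 0 (g \<bullet> y - \<epsilon> * v (perp_g y))) / 2 * 1\<bar> \<le> 1"
        by (simp add: signed_powr_exponent_zero sgn_if)
    qed measurable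
    also have "\<dots> = (LINT z|lborel. indicator cyl z * (sgn (v (perp_g z)) * 2 * min (s z) (\<epsilon> * \<bar>v (perp_g z)\<bar> / G)))"
    proof (intro Bochner_Integration.integral_cong refl)
      fix z
      have inner: "?f (perp_g z + t *\<^sub>R unit_g) = indicator {t. (norm (perp_g z))\<^sup>2 + t\<^sup>2 < 1} t *
        ((sgn (G * t + \<epsilon> * v (perp_g z)) - sgn (G * t - \<epsilon> * v (perp_g z))) / 2)" for t
      proof -
        have "g \<bullet> (perp_g z + t *\<^sub>R unit_g) = G * t"
          using g by (simp add: inner_add_right G_def power2_norm_eq_inner[symmetric] power2_eq_square)
        moreover have "perp_g (perp_g z + t *\<^sub>R unit_g) = perp_g z" by (rule perp_idem[OF norm_unit_g])
        moreover have "perp_g z + t *\<^sub>R unit_g \<in> ball 0 1 \<longleftrightarrow> (norm (perp_g z))\<^sup>2 + t\<^sup>2 < 1"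
          unfolding norm_perp_add[OF norm_unit_g, symmetric] by (simp add: abs_square_less_1)
        ultimately show ?thesis by (simp only: signed_powr_exponent_zero indicator_def mult_1_right mem_Collect_eq)
      qed
      show "indicator {z. \<bar>z \<bullet> unit_g\<bar> < 1/2} z * (LINT t|lborel. ?f (perp_g z + t *\<^sub>R unit_g))
        = indicator cyl z * (sgn (v (perp_g z)) * 2 * min (s z) (\<epsilon> * \<bar>v (perp_g z)\<bar> / G))"
      proof (cases "norm (perp_g z) < 1")
        case True
        have "{t. (norm (perp_g z))\<^sup>2 + t\<^sup>2 < 1} = {- s z<..<s z}"
        proof (intro set_eqI)
          fix t
          have "(norm (perp_g z))\<^sup>2 + t\<^sup>2 < 1 \<longleftrightarrow> sqrt (t\<^sup>2) < s z"
            unfolding s_def real_sqrt_less_iff by linarith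
          then show "t \<in> {t. (norm (perp_g z))\<^sup>2 + t\<^sup>2 < 1} \<longleftrightarrow> t \<in> {- s z<..<s z}"
            by (auto simp: abs_less_iff)
        qed
        then have "(LINT t|lborel. ?f (perp_g z + t *\<^sub>R unit_g)) = sgn (\<epsilon> * v (perp_g z)) * 2 * min (s z) (\<bar>\<epsilon> * v (perp_g z)\<bar> / G)"
          unfolding inner using integral_sgn_symmetric_difference[OF G s[OF True], of "\<epsilon> * v (perp_g z)"] by (simp only:)
        also have "\<dots> = sgn (v (perp_g z)) * 2 * min (s z) (\<epsilon> * \<bar>v (perp_g z)\<bar> / G)"
          using \<epsilon> by (simp add: sgn_mult abs_mult)
        finally show ?thesis using True by (simp add: cyl_def indicator_def)
      next
        case False
        have "1 \<le> (norm (perp_g z))\<^sup>2" using False by (intro one_le_power) simp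
        then have "\<not> (norm (perp_g z))\<^sup>2 + t\<^sup>2 < 1" for t
          using zero_le_power2[of t] by linarith
        then have "{t. (norm (perp_g z))\<^sup>2 + t\<^sup>2 < 1} = {}" by blast
        then have "(LINT t|lborel. ?f (perp_g z + t *\<^sub>R unit_g)) = 0" unfolding inner by simp
        then show ?thesis using False by (simp add: cyl_def)
      qed
    qed
    finally have "(LINT y|lborel. indicator (ball 0 1) y * signed_powr 0 (g \<bullet> y + \<epsilon> * v (perp_g y))) / \<epsilon> =
       (LINT z|lborel. indicator cyl z * (sgn (v (perp_g z)) * 2 * min (s z) (\<epsilon> * \<bar>v (perp_g z)\<bar> / G))) / \<epsilon>"
      by (simp only: mult_1_right)
    also have "\<dots> = (LINT z|lborel. indicator cyl z * (sgn (v (perp_g z)) * 2 * min (s z) (\<epsilon> * \<bar>v (perp_g z)\<bar> / G)) / \<epsilon>)"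
      by (rule integral_divide_zero[symmetric])
    also have "\<dots> = (LINT z|lborel. indicator cyl z * (sgn (v (perp_g z)) * 2 * min (s z / \<epsilon>) (\<bar>v (perp_g z)\<bar> / G)))"
    proof (intro Bochner_Integration.integral_cong refl)
      fix z
      have "min (s z / \<epsilon>) (\<bar>v (perp_g z)\<bar> / G) = min (s z) (\<epsilon> * \<bar>v (perp_g z)\<bar> / G) / \<epsilon>"
        using \<epsilon> by (simp add: min_divide_distrib_right)
      then show "indicator cyl z * (sgn (v (perp_g z)) * 2 * min (s z) (\<epsilon> * \<bar>v (perp_g z)\<bar> / G)) / \<epsilon> =
        indicator cyl z * (sgn (v (perp_g z)) * 2 * min (s z / \<epsilon>) (\<bar>v (perp_g z)\<bar> / G))" by simp
    qed
    finally show ?thesis .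
  qed
  have "((\<lambda>\<epsilon>. LINT z|lborel. indicator cyl z * (sgn (v (perp_g z)) * 2 * min (s z / \<epsilon>) (\<bar>v (perp_g z)\<bar> / G)))
    \<longlongrightarrow> (LINT z|lborel. indicator cyl z * (2 * v (perp_g z) / norm g))) (at_right 0)"
  proof (rule integral_dominated_convergence_at_right[where w="\<lambda>z. indicator cyl z * (2 * C / G)"])
    show "integrable lborel (\<lambda>z. indicator cyl z * (2 * C / G))"
      by (rule integrable_cyl[where C="\<bar>2 * C / G\<bar>"]) auto
    show "AE z in lborel. ((\<lambda>\<epsilon>. indicator cyl z * (sgn (v (perp_g z)) * 2 * min (s z / \<epsilon>) (\<bar>v (perp_g z)\<bar> / G)))
      \<longlongrightarrow> indicator cyl z * (2 * v (perp_g z) / norm g)) (at_right 0)"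
    proof (rule AE_I2)
      fix z
      show "((\<lambda>\<epsilon>. indicator cyl z * (sgn (v (perp_g z)) * 2 * min (s z / \<epsilon>) (\<bar>v (perp_g z)\<bar> / G)))
        \<longlongrightarrow> indicator cyl z * (2 * v (perp_g z) / norm g)) (at_right 0)"
      proof (cases "z \<in> cyl")
        case True
        \<comment> \<open>The chord has positive length, so after division by
          \<open>\<epsilon>\<close> it eventually exceeds the interval where the sign changes, and
          the minimum is attained by the latter.\<close>
        then have "s z > 0" using s by (simp add: cyl_def)
        then have "filterlim (\<lambda>\<epsilon>. s z / \<epsilon>) at_top (at_right 0)"
          using filterlim_tendsto_pos_mult_at_top[OF tendsto_const[of "s z"] _ filterlim_inverse_at_top_right]
          by (simp add: divide_inverse)
        then have "\<forall>\<^sub>F \<epsilon> in at_right 0. \<bar>v (perp_g z)\<bar> / G \<le> s z / \<epsilon>"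
          by (auto simp: filterlim_at_top)
        then have "\<forall>\<^sub>F \<epsilon> in at_right 0. indicator cyl z * (2 * v (perp_g z) / norm g) =
            indicator cyl z * (sgn (v (perp_g z)) * 2 * min (s z / \<epsilon>) (\<bar>v (perp_g z)\<bar> / G))"
        proof eventually_elim
          case (elim \<epsilon>)
          then have "min (s z / \<epsilon>) (\<bar>v (perp_g z)\<bar> / G) = \<bar>v (perp_g z)\<bar> / G" by simp
          then show ?case by (simp add: G_def sgn_if)
        qed
        then show ?thesis by (rule Lim_transform_eventually[OF tendsto_const])
      qed simp
    qed
    have "\<forall>\<^sub>F \<epsilon> in at_right 0. (0::real) < \<epsilon>" by (rule eventually_at_right_less)
    then show "\<forall>\<^sub>F \<epsilon> in at_right 0. AE z in lborel.
      norm (indicator cyl z * (sgn (v (perp_g z)) * 2 * min (s z / \<epsilon>) (\<bar>v (perp_g z)\<bar> / G))) \<le> indicator cyl z * (2 * C / G)"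
    proof eventually_elim
      case (elim \<epsilon>)
      show ?case
      proof (rule AE_I2)
        fix z
        show "norm (indicator cyl z * (sgn (v (perp_g z)) * 2 * min (s z / \<epsilon>) (\<bar>v (perp_g z)\<bar> / G))) \<le> indicator cyl z * (2 * C / G)"
        proof (cases "z \<in> cyl")
          case True
          then have z: "norm (perp_g z) < 1" by (simp add: cyl_def)
          have "0 \<le> min (s z / \<epsilon>) (\<bar>v (perp_g z)\<bar> / G)" using s[OF z] elim G by simp
          moreover have "\<bar>v (perp_g z)\<bar> / G \<le> C / G" using v[OF z] G by (simp add: divide_right_mono)
          moreover have "\<bar>sgn (v (perp_g z))\<bar> \<le> 1" by (simp add: sgn_if)
          ultimately have "\<bar>sgn (v (perp_g z))\<bar> * (2 * min (s z / \<epsilon>) (\<bar>v (perp_g z)\<bar> / G)) \<le> 1 * (2 * (C / G))"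
            by (intro mult_mono) auto
          moreover have "\<bar>min (s z / \<epsilon>) (\<bar>v (perp_g z)\<bar> / G)\<bar> = min (s z / \<epsilon>) (\<bar>v (perp_g z)\<bar> / G)"
            using \<open>0 \<le> min (s z / \<epsilon>) (\<bar>v (perp_g z)\<bar> / G)\<close> by (rule abs_of_nonneg)
          ultimately show ?thesis using True by (simp add: abs_mult)
        qed simp
      qed
    qed
  qed measurable
  then show ?thesis
    by (rule Lim_transform_eventually)
      (use eventually_at_right_less[of "0::real"] in \<open>eventually_elim, simp add: eq\<close>)
qed

section \<open>Second moments of the disc orthogonal to the gradient\<close>

definition "cyl_moment a = (LINT z|lborel. indicator cyl z * (a \<bullet> perp_g z)\<^sup>2)"

lemma inner_perp_g_cyl: "z \<in> cyl \<Longrightarrow> \<bar>a \<bullet> perp_g z\<bar> \<le> norm a"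
proof -
  assume z: "z \<in> cyl"
  have "\<bar>a \<bullet> perp_g z\<bar> \<le> norm a * norm (perp_g z)" by (rule Cauchy_Schwarz_ineq2)
  also have "\<dots> \<le> norm a * 1" using z by (intro mult_left_mono) (auto simp: cyl_def)
  finally show ?thesis by simp
qed

lemma integrable_cyl_inner: "integrable lborel (\<lambda>z. indicator cyl z * ((a \<bullet> perp_g z) * (b \<bullet> perp_g z)))"
proof (rule integrable_cyl)
  show "\<bar>(a \<bullet> perp_g z) * (b \<bullet> perp_g z)\<bar> \<le> norm a * norm b" if "z \<in> cyl" for z
    unfolding abs_mult by (intro mult_mono inner_perp_g_cyl that) auto
qed measurable

lemma perp_g_symmetric: "a \<bullet> perp_g z = perp_g a \<bullet> z"
  by (simp add: perp_def inner_diff_left inner_diff_right inner_commute)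

lemma cyl_moment_scale: "cyl_moment (c *\<^sub>R a) = c\<^sup>2 * cyl_moment a"
proof -
  have "cyl_moment (c *\<^sub>R a) = (LINT y|lborel. c\<^sup>2 * (indicator cyl y * (a \<bullet> perp_g y)\<^sup>2))"
    unfolding cyl_moment_def
    by (intro Bochner_Integration.integral_cong) (auto simp: power_mult_distrib mult_ac)
  then show ?thesis by (simp add: cyl_moment_def)
qed

lemma cyl_moment_perp_g: "cyl_moment (perp_g a) = cyl_moment a"
  unfolding cyl_moment_def perp_g_symmetric perp_idem(2)[OF norm_unit_g] by simp

text \<open>Reflection in \<open>f - f'\<close> exchanges the two vectors since their norms agree,
  and fixes \<open>g\<close>, hence preserves the cylinder.\<close>

lemma cyl_moment_orthogonal:
  assumes f: "f \<bullet> g = 0" "f' \<bullet> g = 0" and norm: "norm f = norm f'"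
  shows "cyl_moment f = cyl_moment f'"
proof (cases "f = f'")
  case False
  define v where "v = f - f'"
  define R where "R = reflect v"
  have vg: "v \<bullet> g = 0" using f by (simp add: v_def inner_diff_left)
  then have gv: "g \<bullet> v = 0" by (simp only: inner_commute)
  have Rg: "R z \<bullet> unit_g = z \<bullet> unit_g" for z
    using inner_reflect_orthogonal[OF gv, of z] by (simp add: R_def inner_commute)
  have pf: "perp_g f = f" "perp_g f' = f'" using f by (simp_all add: perp_def)
  have "norm (perp_g (R z)) = norm (perp_g z)" for z
  proof (rule power2_eq_imp_eq)
    have "norm (R z) = norm z" by (simp add: R_def)
    then show "(norm (perp_g (R z)))\<^sup>2 = (norm (perp_g z))\<^sup>2"
      using norm_perp_decomp[OF norm_unit_g, of "R z"] norm_perp_decomp[OF norm_unit_g, of z] unfolding Rg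
      by (metis add_right_cancel)
  qed auto
  then have cylR: "R z \<in> cyl \<longleftrightarrow> z \<in> cyl" for z by (simp only: cyl_def Rg mem_Collect_eq)
  have "v \<bullet> v \<noteq> 0" using False by (simp add: v_def)
  moreover have "2 * (f \<bullet> v) = v \<bullet> v"
    using norm by (simp add: v_def inner_diff_left inner_diff_right norm_eq inner_commute)
  ultimately have fR: "f \<bullet> R z = f' \<bullet> z" for z
  proof -
    have "f \<bullet> R z = f \<bullet> z - (v \<bullet> z) * (2 * (f \<bullet> v) / (v \<bullet> v))"
      by (simp add: R_def inner_reflect)
    also have "\<dots> = f' \<bullet> z"
      using \<open>v \<bullet> v \<noteq> 0\<close> \<open>2 * (f \<bullet> v) = v \<bullet> v\<close> by (simp only: divide_self mult_1_right) (simp add: v_def inner_diff_left)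
    finally show ?thesis .
  qed
  have "cyl_moment f = (LINT z|lborel. indicator cyl (R z) * (f \<bullet> R z)\<^sup>2)"
    unfolding cyl_moment_def perp_g_symmetric pf R_def
    by (rule integral_lborel_reflect[symmetric]) measurable
  also have "\<dots> = cyl_moment f'"
    unfolding cyl_moment_def perp_g_symmetric pf fR by (simp add: indicator_def cylR)
  finally show ?thesis .
qed simp

lemma cyl_emeasure_pos: "B \<in> sets borel \<Longrightarrow> ball 0 (1/2) \<subseteq> B \<Longrightarrow> B \<notin> null_sets lborel" for B :: "'a set"
proof
  assume B: "B \<in> sets borel" "ball 0 (1/2) \<subseteq> B" "B \<in> null_sets lborel"
  have "emeasure lborel (ball (0::'a) (1/2)) \<le> emeasure lborel B"
    using B by (intro emeasure_mono) auto
  then have "measure lborel (ball (0::'a) (1/2)) = 0" using B(3) by (simp add: measure_def null_sets_def)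
  then show False using content_ball_pos[of "1/2" "0::'a"] by simp
qed

lemma ball_subset_cyl: "ball 0 (1/2) \<subseteq> cyl"
proof
  fix z :: 'a assume z: "z \<in> ball 0 (1/2)"
  have "\<bar>z \<bullet> unit_g\<bar> \<le> norm z * norm unit_g" by (rule Cauchy_Schwarz_ineq2)
  then have "\<bar>z \<bullet> unit_g\<bar> < 1/2" using z norm_unit_g by simp
  moreover have "norm (perp_g z) \<le> norm z" by (rule norm_perp_le[OF norm_unit_g])
  ultimately show "z \<in> cyl" using z unfolding cyl_def by simp
qed

lemma cyl_moment_pos:
  assumes f: "f \<bullet> g = 0" "f \<noteq> 0" shows "cyl_moment f > 0"
proof -
  let ?h = "\<lambda>z. indicator cyl z * (f \<bullet> perp_g z)\<^sup>2"
  have pf: "perp_g f = f" using f by (simp add: perp_def)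
  have int: "integrable lborel ?h"
    using integrable_cyl_inner[of f f] by (simp add: power2_eq_square)
  have "cyl_moment f \<noteq> 0"
  proof
    assume "cyl_moment f = 0"
    then have "AE y in lborel. ?h y = 0"
      using int by (simp add: cyl_moment_def integral_nonneg_eq_0_iff_AE)
    then have "AE y in lborel. y \<notin> cyl"
      using AE_lborel_inner_nonzero[OF f(2)] unfolding perp_g_symmetric pf
      by eventually_elim (auto simp: indicator_def)
    then have "cyl \<in> null_sets lborel" by (subst AE_iff_null_sets) auto
    then show False using cyl_emeasure_pos[OF cyl_borel ball_subset_cyl] by blast
  qed
  moreover have "cyl_moment f \<ge> 0" unfolding cyl_moment_def by (intro integral_nonneg_AE AE_I2) auto
  ultimately show ?thesis by simp
qed

text \<open>All directions orthogonal to \<open>g\<close> are equivalent and the direction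
  \<open>g\<close> contributes nothing, so the moment is a multiple of
  \<open>(norm (perp_g a))\<^sup>2\<close>. This is the \<open>q = 0\<close> form of the formula for
  weighted second moments.\<close>

lemma cyl_moment_eq: "\<exists>K>0. \<forall>a. cyl_moment a = K * (a \<bullet> a + (- 1 / (norm g)\<^sup>2) * (a \<bullet> g)\<^sup>2)"
proof -
  have prg2: "(norm (perp_g a))\<^sup>2 = a \<bullet> a + (- 1 / (norm g)\<^sup>2) * (a \<bullet> g)\<^sup>2" for a
    using norm_perp_decomp[OF norm_unit_g, of a]
    by (simp add: power2_norm_eq_inner[of a] power_mult_distrib power_inverse divide_inverse)
  show ?thesis
  proof (cases "\<exists>f0. f0 \<noteq> 0 \<and> f0 \<bullet> g = 0")
    case True
    then obtain f0 where f0: "f0 \<noteq> 0" "f0 \<bullet> g = 0" by blast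
    define K where "K = cyl_moment f0 / (norm f0)\<^sup>2"
    have "cyl_moment a = K * (norm (perp_g a))\<^sup>2" for a
    proof -
      have "cyl_moment a = cyl_moment (perp_g a)" by (rule cyl_moment_perp_g[symmetric])
      also have "\<dots> = cyl_moment ((norm (perp_g a) / norm f0) *\<^sub>R f0)"
        using f0 by (intro cyl_moment_orthogonal) auto
      also have "\<dots> = K * (norm (perp_g a))\<^sup>2"
        unfolding cyl_moment_scale by (simp add: K_def power_divide)
      finally show ?thesis .
    qed
    moreover have "K > 0" using cyl_moment_pos f0 by (simp add: K_def)
    ultimately show ?thesis unfolding prg2 by blast
  next
    case False
    \<comment> \<open>In dimension one no nonzero vector is orthogonal to \<open>g\<close>; both
      sides vanish and any positive factor serves.\<close>
    have "perp_g a = 0" for a using False perp_g_inner_g(2)[of a] by blast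
    then have "cyl_moment a = 1 * (norm (perp_g a))\<^sup>2" for a
      by (simp add: cyl_moment_def)
    then show ?thesis unfolding prg2 using zero_less_one by blast
  qed
qed

text \<open>On the slab where \<open>g \<bullet> y + \<epsilon> * O(1)\<close> can change sign, \<open>y\<close> is close to \<open>perp_g y\<close>.\<close>

lemma eventually_sgn_le_sgn_perp_g:
  assumes L: "linear L" and \<eta>: "\<eta> > 0"
  shows "\<forall>\<^sub>F \<epsilon> in at_right 0. \<forall>y\<in>ball 0 1. signed_powr 0 (g \<bullet> y + \<epsilon> * ((y \<bullet> L y) / 2 - m - \<eta>))
     \<le> signed_powr 0 (g \<bullet> y + \<epsilon> * ((perp_g y \<bullet> L (perp_g y)) / 2 - m - \<eta> / 2))"
proof -
  obtain C where C: "C > 0" "\<And>y. norm (L y) \<le> C * norm y"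
    using linear_bounded_pos[OF L] by blast
  have in1: "\<bar>x \<bullet> L y\<bar> \<le> C" if "norm x \<le> 1" "norm y \<le> 1" for x y
  proof -
    have "\<bar>x \<bullet> L y\<bar> \<le> norm x * norm (L y)" by (rule Cauchy_Schwarz_ineq2)
    also have "\<dots> \<le> 1 * (C * 1)" using that C
      by (intro mult_mono order_trans[OF C(2)] mult_left_mono) auto
    finally show ?thesis by simp
  qed
  \<comment> \<open>\<open>M\<close> bounds both perturbations on the unit ball.
    \<open>\<delta>\<close> is chosen so that \<open>\<epsilon> * M\<close> stays below
    \<open>\<bar>g \<bullet> y\<bar>\<close> once the component of \<open>y\<close> along
    \<open>g\<close> exceeds \<open>\<eta> / (3 * C)\<close>; the \<open>3\<close> counts the terms
    by which the two quadratic values differ.\<close>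
  define M where "M = C + \<bar>m\<bar> + \<eta>"
  have M: "M > 0" using C \<eta> by (simp add: M_def)
  define \<delta> where "\<delta> = norm g * (\<eta> / (3 * C)) / M"
  have \<delta>: "\<delta> > 0" using g \<eta> C M by (simp add: \<delta>_def)
  have "\<forall>\<^sub>F \<epsilon> in at_right 0. 0 < \<epsilon> \<and> \<epsilon> < \<delta>"
    using \<delta> by (auto simp: eventually_at_right_field)
  then show ?thesis
  proof eventually_elim
    case (elim \<epsilon>)
    show ?case
    proof
      fix y :: 'a assume y: "y \<in> ball 0 1"
      define t where "t = y \<bullet> unit_g"
      have p1: "norm (perp_g y) \<le> 1" using norm_perp_le[OF norm_unit_g, of y] y by simp
      have "\<bar>t\<bar> \<le> norm y * norm unit_g" unfolding t_def by (rule Cauchy_Schwarz_ineq2)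
      then have t1: "\<bar>t\<bar> \<le> 1" using y norm_unit_g by simp
      have dec: "y = perp_g y + t *\<^sub>R unit_g" by (simp add: perp_def t_def)
      let ?a = "y \<bullet> L y" and ?b = "perp_g y \<bullet> L (perp_g y)"
      have "?a = (perp_g y + t *\<^sub>R unit_g) \<bullet> L (perp_g y + t *\<^sub>R unit_g)" using dec by simp
      also have "\<dots> = ?b + t * (perp_g y \<bullet> L unit_g + unit_g \<bullet> L (perp_g y) + t * (unit_g \<bullet> L unit_g))"
        unfolding linear_add[OF L] linear_scale[OF L, of t unit_g]
        by (simp only: inner_add_left inner_add_right inner_scaleR_left inner_scaleR_right) (simp only: algebra_simps)
      finally have "?a - ?b = t * (perp_g y \<bullet> L unit_g + unit_g \<bullet> L (perp_g y) + t * (unit_g \<bullet> L unit_g))" by simp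
      also have "\<bar>\<dots>\<bar> \<le> \<bar>t\<bar> * (3 * C)"
        unfolding abs_mult
      proof (rule mult_left_mono)
        have "\<bar>t * (unit_g \<bullet> L unit_g)\<bar> \<le> 1 * C" unfolding abs_mult
          by (intro mult_mono t1 in1) (use norm_unit_g in \<open>simp_all only: order_refl abs_ge_zero zero_le_one\<close>)
        moreover have "\<bar>perp_g y \<bullet> L unit_g\<bar> \<le> C" "\<bar>unit_g \<bullet> L (perp_g y)\<bar> \<le> C"
          by (rule in1; use p1 norm_unit_g in \<open>simp only: order_refl\<close>)+
        ultimately show "\<bar>perp_g y \<bullet> L unit_g + unit_g \<bullet> L (perp_g y) + t * (unit_g \<bullet> L unit_g)\<bar> \<le> 3 * C"
          by linarith
      qed simp
      finally have diff: "\<bar>?a - ?b\<bar> \<le> \<bar>t\<bar> * (3 * C)" .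
      show "signed_powr 0 (g \<bullet> y + \<epsilon> * (?a / 2 - m - \<eta>)) \<le> signed_powr 0 (g \<bullet> y + \<epsilon> * (?b / 2 - m - \<eta> / 2))"
      \<comment> \<open>If the quadratic values differ by at most \<open>\<eta>\<close>, half of
        \<open>\<eta>\<close> pays for it and monotonicity applies. Otherwise \<open>y\<close> is
        far from the hyperplane and both sides equal \<open>sgn (g \<bullet> y)\<close>.\<close>
      proof (cases "?a - ?b \<le> \<eta>")
        case True
        then have "?a / 2 - m - \<eta> \<le> ?b / 2 - m - \<eta> / 2" by simp
        then show ?thesis using elim by (intro signed_powr_mono add_left_mono mult_left_mono) auto
      next
        case False
        then have "\<eta> < \<bar>t\<bar> * (3 * C)" using diff by linarith
        then have "\<eta> / (3 * C) < \<bar>t\<bar>" using C by (simp add: field_simps)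
        then have "norm g * (\<eta> / (3 * C)) < \<bar>g \<bullet> y\<bar>"
          unfolding inner_unit_g t_def[symmetric] abs_mult abs_norm_cancel
          by (rule mult_strict_left_mono) (use g in simp)
        moreover have "\<epsilon> * M < norm g * (\<eta> / (3 * C))"
          using elim M unfolding \<delta>_def by (simp only: pos_less_divide_eq)
        ultimately have big: "\<epsilon> * M < \<bar>g \<bullet> y\<bar>" by linarith
        have sg: "signed_powr 0 (g \<bullet> y + \<epsilon> * w) = sgn (g \<bullet> y)" if "\<bar>w\<bar> \<le> M" for w
        proof -
          have "\<bar>\<epsilon> * w\<bar> \<le> \<epsilon> * M" unfolding abs_mult using elim that by simp
          then show ?thesis using big unfolding signed_powr_exponent_zero by (auto simp: sgn_if abs_if split: if_splits)
        qed
        have "\<bar>?a\<bar> \<le> C" "\<bar>?b\<bar> \<le> C" using in1 p1 y by auto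
        then have "\<bar>?a / 2 - m - \<eta>\<bar> \<le> M" "\<bar>?b / 2 - m - \<eta> / 2\<bar> \<le> M"
          unfolding M_def using C \<eta> by linarith+
        then show ?thesis by (simp only: sg)
      qed
    qed
  qed
qed

text \<open>Once projecting the perturbation has cost \<open>\<eta> / 2\<close>, the disc takes over
  the role of the weighted ball: \<open>K / (2 * W)\<close> again centres the quadratic term, now
  with \<open>W\<close> the measure of the cylinder. The coefficient \<open>-1\<close> is
  \<open>q - 1\<close> at \<open>q = 0\<close>.\<close>

lemma eventually_ball_sgn_neg:
  "\<exists>c>0. \<forall>L \<eta>. linear L \<and> \<eta> > 0 \<longrightarrow> (\<forall>\<^sub>F \<epsilon> in at_right 0. (LINT y|lborel. indicator (ball 0 1) y *
    signed_powr 0 (g \<bullet> y + \<epsilon> * ((y \<bullet> L y) / 2 - c * ((\<Sum>b\<in>Basis. b \<bullet> L b) + (- 1 / (norm g)\<^sup>2) * (g \<bullet> L g)) - \<eta>))) < 0)"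
proof -
  obtain K where K: "K > 0" "\<And>a. cyl_moment a = K * (a \<bullet> a + (- 1 / (norm g)\<^sup>2) * (a \<bullet> g)\<^sup>2)"
    using cyl_moment_eq by blast
  define W where "W = (LINT z|lborel. indicator cyl z :: real)"
  have int1: "integrable lborel (\<lambda>z. indicator cyl z * (1::real))" by (rule integrable_cyl[where C=1]) auto
  have W: "W > 0"
  proof -
    have "W \<noteq> 0"
    proof
      assume "W = 0"
      then have "AE z in lborel. indicator cyl z = (0::real)"
        using int1 unfolding W_def by (subst (asm) integral_nonneg_eq_0_iff_AE) auto
      then have "AE y in lborel. y \<notin> cyl" by eventually_elim (auto simp: indicator_def)
      then have "cyl \<in> null_sets lborel" by (subst AE_iff_null_sets) auto
      then show False using cyl_emeasure_pos[OF cyl_borel ball_subset_cyl] by blast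
    qed
    moreover have "W \<ge> 0" unfolding W_def by (intro integral_nonneg_AE AE_I2) auto
    ultimately show ?thesis by simp
  qed
  show ?thesis
  proof (intro exI[of _ "K / (2 * W)"] conjI allI impI)
    show "0 < K / (2 * W)" using W K by simp
    fix L :: "'a \<Rightarrow> 'a" and \<eta> :: real
    assume L\<eta>: "linear L \<and> \<eta> > 0"
    then have lin: "linear L" and \<eta>: "\<eta> > 0" by auto
    define T where "T = (\<Sum>b\<in>Basis. b \<bullet> L b) + (- 1 / (norm g)\<^sup>2) * (g \<bullet> L g)"
    define m where "m = K / (2 * W) * T"
    define v where "v y = (y \<bullet> L y) / 2 - m - \<eta> / 2" for y
    obtain C where C: "C \<ge> 0" "\<And>y. y \<in> ball 0 1 \<Longrightarrow> \<bar>y \<bullet> L y\<bar> \<le> C" using quadratic_bounded_ball[OF g lin] by blast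
    have Lm [measurable]: "L \<in> borel_measurable borel"
      using lin by (intro borel_measurable_continuous_onI linear_continuous_on linear_conv_bounded_linear[THEN iffD1])
    have vm [measurable]: "v \<in> borel_measurable borel" unfolding v_def by measurable
    have vb: "\<bar>v y\<bar> \<le> C + \<bar>m\<bar> + \<bar>\<eta>\<bar>" if "norm y < 1" for y
    proof -
      have "\<bar>y \<bullet> L y\<bar> \<le> C" using that by (intro C(2)) simp
      then show ?thesis using C(1) unfolding v_def by linarith
    qed
    note Q = integral_quadratic_form[OF integrable_cyl_inner K(2)[unfolded cyl_moment_def] lin]
    have "(LINT z|lborel. indicator cyl z * (2 * v (perp_g z) / norm g)) =
      (LINT z|lborel. (1 / norm g) * (indicator cyl z * (perp_g z \<bullet> L (perp_g z))) - (2 * (m + \<eta> / 2) / norm g) * (indicator cyl z * 1))"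
    proof (intro Bochner_Integration.integral_cong refl)
      have "i * (2 * (b / 2 - m - \<eta> / 2) / n) = (1 / n) * (i * b) - (2 * (m + \<eta> / 2) / n) * (i * 1)" for i b n :: real
        by (simp add: algebra_simps diff_divide_distrib add_divide_distrib)
      then show "indicator cyl z * (2 * v (perp_g z) / norm g) =
        (1 / norm g) * (indicator cyl z * (perp_g z \<bullet> L (perp_g z))) - (2 * (m + \<eta> / 2) / norm g) * (indicator cyl z * 1)" for z
        by (simp only: v_def)
    qed
    also have "\<dots> = (1 / norm g) * (K * T) - (2 * (m + \<eta> / 2) / norm g) * W"
      unfolding Bochner_Integration.integral_diff[OF integrable_mult_right[OF Q(1)] integrable_mult_right[OF int1]]
        integral_mult_right_zero Q(2) by (simp only: W_def T_def mult_1_right)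
    also have "\<dots> = - (\<eta> * W / norm g)" using W g by (simp add: m_def field_simps)
    finally have lim: "((\<lambda>\<epsilon>. (LINT y|lborel. indicator (ball 0 1) y * signed_powr 0 (g \<bullet> y + \<epsilon> * v (perp_g y))) / \<epsilon>)
      \<longlongrightarrow> - (\<eta> * W / norm g)) (at_right 0)"
      using tendsto_ball_sgn[OF vm vb] by simp
    have "- (\<eta> * W / norm g) < 0" using g W \<eta> by simp
    from order_tendstoD(2)[OF lim this] eventually_at_right_less[of 0] eventually_sgn_le_sgn_perp_g[OF lin \<eta>, of m]
    have "\<forall>\<^sub>F \<epsilon> in at_right 0. (LINT y|lborel. indicator (ball 0 1) y *
      signed_powr 0 (g \<bullet> y + \<epsilon> * ((y \<bullet> L y) / 2 - m - \<eta>))) < 0"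
    proof eventually_elim
      case (elim \<epsilon>)
      have "(LINT y|lborel. indicator (ball 0 1) y * signed_powr 0 (g \<bullet> y + \<epsilon> * ((y \<bullet> L y) / 2 - m - \<eta>)))
        \<le> (LINT y|lborel. indicator (ball 0 1) y * signed_powr 0 (g \<bullet> y + \<epsilon> * v (perp_g y)))"
      proof (rule integral_mono)
        have b: "\<bar>signed_powr 0 x\<bar> \<le> 1" for x by (simp add: signed_powr_exponent_zero sgn_if)
        show "integrable lborel (\<lambda>y. indicator (ball 0 1) y * signed_powr 0 (g \<bullet> y + \<epsilon> * ((y \<bullet> L y) / 2 - m - \<eta>)))"
          "integrable lborel (\<lambda>y. indicator (ball 0 1) y * signed_powr 0 (g \<bullet> y + \<epsilon> * v (perp_g y)))"
          by (rule integrable_lborel_ball[where C=1]; (rule b)?; measurable)+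
        show "indicator (ball 0 1) y * signed_powr 0 (g \<bullet> y + \<epsilon> * ((y \<bullet> L y) / 2 - m - \<eta>))
          \<le> indicator (ball 0 1) y * signed_powr 0 (g \<bullet> y + \<epsilon> * v (perp_g y))" for y
          using elim(3) by (cases "y \<in> ball 0 1") (auto simp: v_def)
      qed
      also have "\<dots> < 0" using elim(1,2) by (simp add: divide_less_0_iff)
      finally show ?case .
    qed
    then show "\<forall>\<^sub>F \<epsilon> in at_right 0. (LINT y|lborel. indicator (ball 0 1) y * signed_powr 0 (g \<bullet> y + \<epsilon> * ((y \<bullet> L y) / 2 -
        K / (2 * W) * ((\<Sum>b\<in>Basis. b \<bullet> L b) + (- 1 / (norm g)\<^sup>2) * (g \<bullet> L g)) - \<eta>))) < 0"
      by (simp only: m_def T_def)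
  qed
qed

end

section \<open>The asymptotic expansion of the \<open>p\<close>-mean\<close>

text \<open>Replacing \<open>y\<close> by \<open>- y\<close> and \<open>L\<close> by
  \<open>- L\<close> negates the integral, so the positive half follows from the negative one. The
  same \<open>c\<close> serves both because it is chosen before \<open>L\<close>.\<close>

lemma eventually_ball_signed_powr_sign:
  fixes g :: "'a::euclidean_space"
  assumes g: "g \<noteq> 0" and q: "q \<ge> 0"
  shows "\<exists>c>0. \<forall>L \<eta>. linear L \<and> \<eta> > 0 \<longrightarrow>
    (\<forall>\<^sub>F \<epsilon> in at_right 0. (LINT y|lborel. indicator (ball 0 1) y * signed_powr q (g \<bullet> y + \<epsilon> * ((y \<bullet> L y) / 2 -
       (c * ((\<Sum>b\<in>Basis. b \<bullet> L b) + (q - 1) / (norm g)\<^sup>2 * (g \<bullet> L g)) + \<eta>)))) < 0) \<and>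
    (\<forall>\<^sub>F \<epsilon> in at_right 0. (LINT y|lborel. indicator (ball 0 1) y * signed_powr q (g \<bullet> y + \<epsilon> * ((y \<bullet> L y) / 2 -
       (c * ((\<Sum>b\<in>Basis. b \<bullet> L b) + (q - 1) / (norm g)\<^sup>2 * (g \<bullet> L g)) - \<eta>)))) > 0)"
proof -
  define T where "T L = (\<Sum>b\<in>Basis. b \<bullet> L b) + (q - 1) / (norm g)\<^sup>2 * (g \<bullet> L g)" for L :: "'a \<Rightarrow> 'a"
  define N where "N \<epsilon> L k = (LINT y|lborel. indicator (ball 0 1) y * signed_powr q (g \<bullet> y + \<epsilon> * ((y \<bullet> L y) / 2 - k)))"
    for \<epsilon> k and L :: "'a \<Rightarrow> 'a"
  obtain c where c: "c > 0" and neg: "\<And>L \<eta>. linear L \<Longrightarrow> \<eta> > 0 \<Longrightarrow> (\<forall>\<^sub>F \<epsilon> in at_right 0. N \<epsilon> L (c * T L + \<eta>) < 0)"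
  proof -
    have "\<exists>c>0. \<forall>L \<eta>. linear L \<and> \<eta> > 0 \<longrightarrow> (\<forall>\<^sub>F \<epsilon> in at_right 0. N \<epsilon> L (c * T L + \<eta>) < 0)"
    proof (cases "q = 0")
      case True
      show ?thesis
        using eventually_ball_sgn_neg[OF g] unfolding N_def T_def True diff_0 diff_diff_eq .
    next
      case False
      then have "q > 0" using q by simp
      show ?thesis
        using eventually_ball_signed_powr_neg[OF g \<open>q > 0\<close>] unfolding N_def T_def diff_diff_eq .
    qed
    then show ?thesis using that by blast
  qed
  have pos: "\<forall>\<^sub>F \<epsilon> in at_right 0. N \<epsilon> L (c * T L - \<eta>) > 0" if L: "linear L" and \<eta>: "\<eta> > 0" for L \<eta>
  proof -
    have "linear (\<lambda>y. - L y)" using L by (rule linear_compose_neg)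
    from neg[OF this \<eta>] show ?thesis
    proof eventually_elim
      case (elim \<epsilon>)
      have [measurable]: "L \<in> borel_measurable borel"
        using L by (intro borel_measurable_continuous_onI linear_continuous_on linear_conv_bounded_linear[THEN iffD1])
      have Tneg: "T (\<lambda>y. - L y) = - T L" by (simp only: T_def inner_minus_right sum_negf mult_minus_right minus_add_distrib)
      have "N \<epsilon> L (c * T L - \<eta>) = (LINT y|lborel. indicator (ball 0 1) (- y) *
          signed_powr q (g \<bullet> (- y) + \<epsilon> * (((- y) \<bullet> L (- y)) / 2 - (c * T L - \<eta>))))"
        unfolding N_def by (rule integral_lborel_uminus[symmetric]) measurable
      also have "\<dots> = (LINT y|lborel. - (indicator (ball 0 1) y *
          signed_powr q (g \<bullet> y + \<epsilon> * ((y \<bullet> - L y) / 2 - (c * T (\<lambda>y. - L y) + \<eta>)))))"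
      proof (intro Bochner_Integration.integral_cong refl)
        fix y
        have "g \<bullet> (- y) + \<epsilon> * (((- y) \<bullet> L (- y)) / 2 - (c * T L - \<eta>)) =
          - (g \<bullet> y + \<epsilon> * ((y \<bullet> - L y) / 2 - (c * T (\<lambda>y. - L y) + \<eta>)))"
          using L unfolding Tneg by (simp add: linear_neg algebra_simps)
        then show "indicator (ball 0 1) (- y) * signed_powr q (g \<bullet> (- y) + \<epsilon> * (((- y) \<bullet> L (- y)) / 2 - (c * T L - \<eta>))) =
          - (indicator (ball 0 1) y * signed_powr q (g \<bullet> y + \<epsilon> * ((y \<bullet> - L y) / 2 - (c * T (\<lambda>y. - L y) + \<eta>))))"
          by (simp only: signed_powr_minus) (simp add: indicator_def)
      qed
      also have "\<dots> = - N \<epsilon> (\<lambda>y. - L y) (c * T (\<lambda>y. - L y) + \<eta>)"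
        unfolding N_def by (rule Bochner_Integration.integral_minus)
      finally show ?case using elim by simp
    qed
  qed
  show ?thesis using c neg pos unfolding N_def T_def by blast
qed

section \<open>Rescaling to the unit ball and Taylor expansion of test functions\<close>

lemma integral_lebesgue_on_ball:
  fixes f :: "'a::euclidean_space \<Rightarrow> real"
  assumes r: "r > 0" and [measurable]: "f \<in> borel_measurable borel"
  shows "(LINT z|lebesgue_on (ball x r). f z) = r ^ DIM('a) * (LINT y|lborel. indicator (ball 0 1) y * f (x + r *\<^sub>R y))"
proof -
  have "(LINT z|lebesgue_on (ball x r). f z) = (LINT z|lebesgue. indicator (ball x r) z * f z)"
    by (subst integral_restrict_space) auto
  also have "\<dots> = (LINT z|lborel. indicator (ball x r) z * f z)"
    by (rule integral_completion) measurable
  also have "\<dots> = r ^ DIM('a) * (LINT y|lborel. indicator (ball x r) (x + r *\<^sub>R y) * f (x + r *\<^sub>R y))"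
    by (rule integral_lborel_scale_translate[OF r]) measurable
  also have "(\<lambda>y. indicator (ball x r) (x + r *\<^sub>R y) * f (x + r *\<^sub>R y)) = (\<lambda>y. indicator (ball 0 1) y * f (x + r *\<^sub>R y))"
    using r by (auto simp: fun_eq_iff indicator_def dist_norm)
  finally show ?thesis .
qed

text \<open>One factor \<open>\<epsilon>\<close> splits off from the argument and homogeneity takes
  it outside. Both prefactors are positive, so the sign is decided on the unit ball.\<close>

lemma integral_ball_signed_powr_quadratic:
  fixes g :: "'a::euclidean_space"
  assumes \<epsilon>: "\<epsilon> > 0" and L: "linear L"
  shows "(LINT z|lebesgue_on (ball x \<epsilon>). signed_powr q (g \<bullet> (z - x) + ((z - x) \<bullet> L (z - x)) / 2 - k * \<epsilon>\<^sup>2)) =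
    \<epsilon> ^ DIM('a) * \<epsilon> powr q * (LINT y|lborel. indicator (ball 0 1) y * signed_powr q (g \<bullet> y + \<epsilon> * ((y \<bullet> L y) / 2 - k)))"
proof -
  have [measurable]: "L \<in> borel_measurable borel"
    using L by (intro borel_measurable_continuous_onI linear_continuous_on linear_conv_bounded_linear[THEN iffD1])
  let ?f = "\<lambda>z. signed_powr q (g \<bullet> (z - x) + ((z - x) \<bullet> L (z - x)) / 2 - k * \<epsilon>\<^sup>2)"
  have f: "?f (x + \<epsilon> *\<^sub>R y) = \<epsilon> powr q * signed_powr q (g \<bullet> y + \<epsilon> * ((y \<bullet> L y) / 2 - k))" for y
  proof -
    have "g \<bullet> (\<epsilon> *\<^sub>R y) + ((\<epsilon> *\<^sub>R y) \<bullet> L (\<epsilon> *\<^sub>R y)) / 2 - k * \<epsilon>\<^sup>2 = \<epsilon> * (g \<bullet> y + \<epsilon> * ((y \<bullet> L y) / 2 - k))"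
      by (simp add: linear_scale[OF L] power2_eq_square algebra_simps)
    then show ?thesis by (simp only: add_diff_cancel_left' signed_powr_scale[OF \<epsilon>])
  qed
  have "(LINT z|lebesgue_on (ball x \<epsilon>). ?f z) = \<epsilon> ^ DIM('a) * (LINT y|lborel. indicator (ball 0 1) y * ?f (x + \<epsilon> *\<^sub>R y))"
    by (rule integral_lebesgue_on_ball[OF \<epsilon>]) measurable
  also have "(\<lambda>y. indicator (ball 0 1) y * ?f (x + \<epsilon> *\<^sub>R y)) =
    (\<lambda>y. \<epsilon> powr q * (indicator (ball 0 1) y * signed_powr q (g \<bullet> y + \<epsilon> * ((y \<bullet> L y) / 2 - k))))"
    unfolding f by (simp add: mult_ac)
  also have "\<epsilon> ^ DIM('a) * (LINT y|lborel. \<epsilon> powr q * (indicator (ball 0 1) y * signed_powr q (g \<bullet> y + \<epsilon> * ((y \<bullet> L y) / 2 - k))))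
    = \<epsilon> ^ DIM('a) * \<epsilon> powr q * (LINT y|lborel. indicator (ball 0 1) y * signed_powr q (g \<bullet> y + \<epsilon> * ((y \<bullet> L y) / 2 - k)))"
    by (simp only: integral_mult_right_zero mult.assoc)
  finally show ?thesis .
qed

lemma continuous_on_cball_bounded:
  fixes f :: "'a::euclidean_space \<Rightarrow> real"
  assumes "continuous_on (cball x R) f"
  shows "\<exists>K. \<forall>y\<in>cball x R. \<bar>f y\<bar> \<le> K"
proof -
  have "bounded (f ` cball x R)" using assms by (intro compact_imp_bounded compact_continuous_image) auto
  then show ?thesis unfolding bounded_real by blast
qed

lemma C2_near_continuous:
  assumes "C2_near \<phi> x"
  obtains R where "R > 0" "continuous_on (cball x R) \<phi>"
proof -
  obtain U where U: "open U" "x \<in> U" "\<phi> differentiable_on U"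
    using assms unfolding C2_near_def by blast
  obtain R where "R > 0" "cball x R \<subseteq> U" using U(1,2) open_contains_cball by blast
  moreover have "continuous_on U \<phi>" using U(3) by (rule differentiable_imp_continuous_on)
  ultimately show thesis using that continuous_on_subset by blast
qed

text \<open>The mean value theorem is applied along the segment to \<open>\<phi>\<close> minus its
  linear and quadratic terms. The derivative at \<open>t\<close> is the inner product of
  \<open>z\<close> with the remainder in the first-order expansion of the gradient at
  \<open>x\<close>, which is at most \<open>\<delta> * norm z\<close>.\<close>

lemma C2_near_Taylor:
  fixes \<phi> :: "real^'n \<Rightarrow> real"
  assumes C2: "C2_near \<phi> x" and \<delta>: "\<delta> > 0"
  shows "\<exists>r>0. \<forall>z. norm z < r \<longrightarrow>
    \<bar>\<phi> (x + z) - \<phi> x - gradient \<phi> x \<bullet> z - (z \<bullet> (hessian \<phi> x *v z)) / 2\<bar> \<le> \<delta> * (norm z)\<^sup>2"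
proof -
  define H where "H = hessian \<phi> x"
  define g where "g = gradient \<phi> x"
  obtain U where U: "open U" "x \<in> U" "\<phi> differentiable_on U" "gradient \<phi> differentiable_on U"
    using C2 unfolding C2_near_def by blast
  have d\<phi>: "(\<phi> has_derivative (\<lambda>h. h \<bullet> gradient \<phi> y)) (at y)" if "y \<in> U" for y
  proof -
    have "\<phi> differentiable (at y)" using U that by (metis at_within_open differentiable_on_def)
    from GDERIV_gradient[OF this] show ?thesis by (simp add: gderiv_def)
  qed
  have "gradient \<phi> differentiable (at x)" using U by (metis at_within_open differentiable_on_def)
  then have "(gradient \<phi> has_derivative (\<lambda>h. H *v h)) (at x)"
    unfolding H_def hessian_def using jacobian_works by blast
  then obtain d where d: "d > 0"
    and dG: "\<And>y. norm (y - x) < d \<Longrightarrow> norm (gradient \<phi> y - g - H *v (y - x)) \<le> \<delta> * norm (y - x)"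
    unfolding has_derivative_at_alt g_def using \<delta> by blast
  obtain r where r: "r > 0" "ball x r \<subseteq> U" using U(1,2) open_contains_ball by blast
  have "\<bar>\<phi> (x + z) - \<phi> x - g \<bullet> z - (z \<bullet> (H *v z)) / 2\<bar> \<le> \<delta> * (norm z)\<^sup>2" if z: "norm z < min d r" for z
  proof -
    define h where "h t = \<phi> (x + t *\<^sub>R z) - t * (g \<bullet> z) - t\<^sup>2 / 2 * (z \<bullet> (H *v z))" for t
    define h' where "h' t s = s * (z \<bullet> gradient \<phi> (x + t *\<^sub>R z)) - s * (g \<bullet> z) - s * t * (z \<bullet> (H *v z))" for t s
    have small: "norm (t *\<^sub>R z) \<le> norm z" if "0 \<le> t" "t \<le> 1" for t
      using that by (simp add: mult_left_le_one_le)
    have "\<exists>t\<in>{0<..<1}. h 1 - h 0 = h' t (1 - 0)"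
    proof (rule mvt_simple)
      fix t :: real assume t: "0 \<le> t" "t \<le> 1"
      have "x + t *\<^sub>R z \<in> ball x r" using small[OF t] z by (simp add: dist_norm)
      then have U': "x + t *\<^sub>R z \<in> U" using r by blast
      have "((\<lambda>t. x + t *\<^sub>R z) has_derivative (\<lambda>s. s *\<^sub>R z)) (at t)"
        by (auto intro!: derivative_eq_intros)
      from has_derivative_compose[OF this d\<phi>[OF U']]
      have 1: "((\<lambda>t. \<phi> (x + t *\<^sub>R z)) has_derivative (\<lambda>s. s *\<^sub>R z \<bullet> gradient \<phi> (x + t *\<^sub>R z))) (at t)" .
      have "(h has_derivative h' t) (at t)"
        unfolding h_def h'_def
        by (rule has_derivative_eq_rhs, (rule derivative_intros 1)+) (auto simp: fun_eq_iff power2_eq_square algebra_simps)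
      then show "(h has_derivative h' t) (at t within {0..1})" by (rule has_derivative_at_withinI)
    qed simp
    then obtain t where t: "0 < t" "t < 1" "h 1 - h 0 = h' t 1" by auto
    have "\<phi> (x + z) - \<phi> x - g \<bullet> z - (z \<bullet> (H *v z)) / 2 = z \<bullet> (gradient \<phi> (x + t *\<^sub>R z) - g - H *v (t *\<^sub>R z))"
      using t(3) by (simp add: h_def h'_def inner_diff_right inner_commute matrix_vector_mult_scaleR)
    also have "\<bar>\<dots>\<bar> \<le> norm z * norm (gradient \<phi> (x + t *\<^sub>R z) - g - H *v (t *\<^sub>R z))"
      by (rule Cauchy_Schwarz_ineq2)
    also have "\<dots> \<le> norm z * (\<delta> * norm z)"
    proof (rule mult_left_mono)
      have "norm (gradient \<phi> (x + t *\<^sub>R z) - g - H *v (t *\<^sub>R z)) \<le> \<delta> * norm (t *\<^sub>R z)"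
        using dG[of "x + t *\<^sub>R z"] small[of t] t z by simp
      also have "\<dots> \<le> \<delta> * norm z" using small[of t] t \<delta> by (intro mult_left_mono) auto
      finally show "norm (gradient \<phi> (x + t *\<^sub>R z) - g - H *v (t *\<^sub>R z)) \<le> \<delta> * norm z" .
    qed simp
    finally show ?thesis by (simp add: power2_eq_square mult_ac)
  qed
  then show ?thesis using d r unfolding g_def H_def by (intro exI[of _ "min d r"]) auto
qed

lemma trace_eq_sum_Basis: "trace (A :: real^'n^'n) = (\<Sum>b\<in>Basis. b \<bullet> (A *v b))"
proof -
  have inj: "inj (\<lambda>i::'n. axis i (1::real))" by (auto simp: inj_on_def axis_eq_axis)
  have "(Basis :: (real^'n) set) = range (\<lambda>i. axis i 1)" by (auto simp: Basis_vec_def)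
  then have "(\<Sum>b\<in>Basis. b \<bullet> (A *v b)) = (\<Sum>i\<in>UNIV. axis i 1 \<bullet> (A *v axis i 1))"
    using sum.reindex[OF inj] by (simp add: o_def)
  also have "\<dots> = trace A"
    by (simp add: trace_def matrix_vector_mult_basis column_def inner_axis')
  finally show ?thesis by simp
qed

text \<open>On the ball \<open>\<phi>\<close> differs from its quadratic model by at most
  \<open>\<eta> / 2 * \<epsilon>\<^sup>2\<close>, a shift of the level \<open>k\<close> by
  \<open>\<eta> / 2\<close>. By monotonicity of the signed power, the sign results at
  \<open>\<eta> / 2\<close> bracket the mean within
  \<open>\<eta> * \<epsilon>\<^sup>2\<close>.\<close>

lemma p_mean_expansion_finite:
  fixes \<phi> :: "real^'n \<Rightarrow> real" and p :: real
  assumes C2: "C2_near \<phi> x" and g: "gradient \<phi> x \<noteq> 0" and p: "p \<ge> 1"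
  shows "\<exists>c>0. \<forall>\<eta>>0. \<forall>\<^sub>F \<epsilon> in at_right 0.
    \<bar>p_mean (ereal p) \<epsilon> \<phi> x - \<phi> x - c * normalized_p_laplacian (ereal p) \<phi> x * \<epsilon>\<^sup>2\<bar> \<le> \<eta> * \<epsilon>\<^sup>2"
proof -
  define G where "G = gradient \<phi> x"
  define L where "L z = hessian \<phi> x *v z" for z
  define \<Delta> where "\<Delta> = normalized_p_laplacian (ereal p) \<phi> x"
  have L: "linear L" unfolding L_def[abs_def] by (rule matrix_vector_mul_linear)
  have \<Delta>: "\<Delta> = (\<Sum>b\<in>Basis. b \<bullet> L b) + (p - 1 - 1) / (norm G)\<^sup>2 * (G \<bullet> L G)"
    unfolding \<Delta>_def using normalized_p_laplacian_finite[OF C2 g, of "ereal p"]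
    by (simp add: trace_eq_sum_Basis L_def G_def inner_commute)
  obtain c where c: "c > 0" and sgn: "\<And>\<eta>. \<eta> > 0 \<Longrightarrow>
    (\<forall>\<^sub>F \<epsilon> in at_right 0. (LINT y|lborel. indicator (ball 0 1) y * signed_powr (p - 1) (G \<bullet> y + \<epsilon> * ((y \<bullet> L y) / 2 - (c * \<Delta> + \<eta>)))) < 0) \<and>
    (\<forall>\<^sub>F \<epsilon> in at_right 0. (LINT y|lborel. indicator (ball 0 1) y * signed_powr (p - 1) (G \<bullet> y + \<epsilon> * ((y \<bullet> L y) / 2 - (c * \<Delta> - \<eta>)))) > 0)"
    using eventually_ball_signed_powr_sign[of G "p - 1"] g p L unfolding \<Delta> G_def[symmetric] by auto
  obtain R where R: "R > 0" and cont: "continuous_on (cball x R) \<phi>"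
    using C2_near_continuous[OF C2] .
  obtain K where K: "\<And>y. y \<in> cball x R \<Longrightarrow> \<bar>\<phi> y\<bar> \<le> K"
    using continuous_on_cball_bounded[OF cont] by blast
  show ?thesis
  proof (intro exI[of _ c] conjI allI impI)
    fix \<eta> :: real assume \<eta>: "\<eta> > 0"
    then have \<eta>2: "\<eta> / 2 > 0" by simp
    obtain r where r: "r > 0" and Taylor: "\<And>z. norm z < r \<Longrightarrow>
        \<bar>\<phi> (x + z) - \<phi> x - G \<bullet> z - (z \<bullet> L z) / 2\<bar> \<le> \<eta> / 2 * (norm z)\<^sup>2"
      using C2_near_Taylor[OF C2 \<eta>2] unfolding G_def L_def by blast
    have "\<forall>\<^sub>F \<epsilon> in at_right 0. 0 < \<epsilon> \<and> \<epsilon> < min r R"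
      using r R by (auto simp: eventually_at_right_field intro!: exI[of _ "min r R"])
    then show "\<forall>\<^sub>F \<epsilon> in at_right 0.
      \<bar>p_mean (ereal p) \<epsilon> \<phi> x - \<phi> x - c * normalized_p_laplacian (ereal p) \<phi> x * \<epsilon>\<^sup>2\<bar> \<le> \<eta> * \<epsilon>\<^sup>2"
      using conjunct1[OF sgn[OF \<eta>2]] conjunct2[OF sgn[OF \<eta>2]]
    proof eventually_elim
      case (elim \<epsilon>)
      then have \<epsilon>: "0 < \<epsilon>" "\<epsilon> < r" "\<epsilon> < R" by auto
      have cont': "continuous_on (ball x \<epsilon>) \<phi>" using cont \<epsilon> by (auto intro: continuous_on_subset)
      have K': "\<bar>\<phi> y\<bar> \<le> K" if "y \<in> ball x \<epsilon>" for y using that \<epsilon> by (intro K) auto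
      have T: "\<bar>\<phi> y - \<phi> x - G \<bullet> (y - x) - ((y - x) \<bullet> L (y - x)) / 2\<bar> \<le> \<eta> / 2 * \<epsilon>\<^sup>2" if "y \<in> ball x \<epsilon>" for y
      proof -
        have n: "norm (y - x) < \<epsilon>" using that by (simp add: dist_norm norm_minus_commute)
        have "\<bar>\<phi> (x + (y - x)) - \<phi> x - G \<bullet> (y - x) - ((y - x) \<bullet> L (y - x)) / 2\<bar> \<le> \<eta> / 2 * (norm (y - x))\<^sup>2"
          by (rule Taylor) (use n \<epsilon> in simp)
        also have "\<dots> \<le> \<eta> / 2 * \<epsilon>\<^sup>2"
          using n \<eta> by (intro mult_left_mono power_mono) auto
        finally show ?thesis by simp
      qed
      let ?P = "\<lambda>k z. signed_powr (p - 1) (G \<bullet> (z - x) + ((z - x) \<bullet> L (z - x)) / 2 - k * \<epsilon>\<^sup>2)"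
      have [measurable]: "L \<in> borel_measurable borel"
        using L by (intro borel_measurable_continuous_onI linear_continuous_on linear_conv_bounded_linear[THEN iffD1])
      have intP: "integrable (lebesgue_on (ball x \<epsilon>)) (?P k)" for k
      proof -
        have "continuous_on UNIV L" using L by (intro linear_continuous_on linear_conv_bounded_linear[THEN iffD1])
        then have "continuous_on (cball x \<epsilon>) (\<lambda>z. L (z - x))"
          by (rule continuous_on_compose2) (auto intro: continuous_on_diff continuous_on_id continuous_on_const)
        then have "continuous_on (cball x \<epsilon>) (\<lambda>z. G \<bullet> (z - x) + ((z - x) \<bullet> L (z - x)) / 2 - k * \<epsilon>\<^sup>2)"
          by (intro continuous_on_diff continuous_on_add continuous_on_inner continuous_on_divide
              continuous_on_id continuous_on_const) auto
        from continuous_on_cball_bounded[OF this]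
        obtain M where M: "\<forall>z\<in>cball x \<epsilon>. \<bar>G \<bullet> (z - x) + ((z - x) \<bullet> L (z - x)) / 2 - k * \<epsilon>\<^sup>2\<bar> \<le> M" ..
        show ?thesis
        proof (rule integrable_lebesgue_on_ball)
          have "?P k \<in> borel_measurable borel" by measurable
          then show "?P k \<in> borel_measurable (lebesgue_on (ball x \<epsilon>))"
            by (intro measurable_restrict_space1 measurable_completion) simp
          show "\<bar>?P k y\<bar> \<le> M powr (p - 1)" if "y \<in> ball x \<epsilon>" for y
            unfolding abs_signed_powr using bspec[OF M, of y] that p by (intro powr_mono2) auto
        qed
      qed
      have int\<phi>: "integrable (lebesgue_on (ball x \<epsilon>)) (\<lambda>y. signed_powr (p - 1) (\<phi> y - k))" for k
        by (rule integrable_signed_powr[OF cont' K' \<epsilon>(1) p])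
      have scale: "0 < \<epsilon> ^ DIM(real^'n) * \<epsilon> powr (p - 1)" using \<epsilon> by simp
      have upper: "p_mean (ereal p) \<epsilon> \<phi> x \<le> \<phi> x + (c * \<Delta> + \<eta>) * \<epsilon>\<^sup>2"
      proof (rule p_mean_le_if_integral_neg[OF cont' K' \<epsilon>(1) p])
        have "(LINT y|lebesgue_on (ball x \<epsilon>). signed_powr (p - 1) (\<phi> y - (\<phi> x + (c * \<Delta> + \<eta>) * \<epsilon>\<^sup>2)))
          \<le> (LINT y|lebesgue_on (ball x \<epsilon>). ?P (c * \<Delta> + \<eta> / 2) y)"
        proof (rule integral_mono_AE[OF int\<phi> intP], rule AE_I2)
          fix y assume "y \<in> space (lebesgue_on (ball x \<epsilon>))"
          then have y: "y \<in> ball x \<epsilon>" by simp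
          have "(c * \<Delta> + \<eta> / 2) * \<epsilon>\<^sup>2 = (c * \<Delta> + \<eta>) * \<epsilon>\<^sup>2 - \<eta> / 2 * \<epsilon>\<^sup>2" by (simp add: algebra_simps)
          then show "signed_powr (p - 1) (\<phi> y - (\<phi> x + (c * \<Delta> + \<eta>) * \<epsilon>\<^sup>2)) \<le> ?P (c * \<Delta> + \<eta> / 2) y"
            using p T[OF y] by (intro signed_powr_mono) linarith+
        qed
        also have "\<dots> < 0"
          unfolding integral_ball_signed_powr_quadratic[OF \<epsilon>(1) L] by (rule mult_pos_neg[OF scale elim(2)])
        finally show "(LINT y|lebesgue_on (ball x \<epsilon>). signed_powr (p - 1) (\<phi> y - (\<phi> x + (c * \<Delta> + \<eta>) * \<epsilon>\<^sup>2))) < 0" .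
      qed
      have lower: "\<phi> x + (c * \<Delta> - \<eta>) * \<epsilon>\<^sup>2 \<le> p_mean (ereal p) \<epsilon> \<phi> x"
      proof (rule p_mean_ge_if_integral_pos[OF cont' K' \<epsilon>(1) p])
        have "0 < (LINT y|lebesgue_on (ball x \<epsilon>). ?P (c * \<Delta> - \<eta> / 2) y)"
          unfolding integral_ball_signed_powr_quadratic[OF \<epsilon>(1) L] by (rule mult_pos_pos[OF scale elim(3)])
        also have "\<dots> \<le> (LINT y|lebesgue_on (ball x \<epsilon>). signed_powr (p - 1) (\<phi> y - (\<phi> x + (c * \<Delta> - \<eta>) * \<epsilon>\<^sup>2)))"
        proof (rule integral_mono_AE[OF intP int\<phi>], rule AE_I2)
          fix y assume "y \<in> space (lebesgue_on (ball x \<epsilon>))"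
          then have y: "y \<in> ball x \<epsilon>" by simp
          have "(c * \<Delta> - \<eta> / 2) * \<epsilon>\<^sup>2 = (c * \<Delta> - \<eta>) * \<epsilon>\<^sup>2 + \<eta> / 2 * \<epsilon>\<^sup>2" by (simp add: algebra_simps)
          then show "?P (c * \<Delta> - \<eta> / 2) y \<le> signed_powr (p - 1) (\<phi> y - (\<phi> x + (c * \<Delta> - \<eta>) * \<epsilon>\<^sup>2))"
            using p T[OF y] by (intro signed_powr_mono) linarith+
        qed
        finally show "0 < (LINT y|lebesgue_on (ball x \<epsilon>). signed_powr (p - 1) (\<phi> y - (\<phi> x + (c * \<Delta> - \<eta>) * \<epsilon>\<^sup>2)))" .
      qed
      show ?case using upper lower unfolding \<Delta>_def[symmetric] by (simp add: abs_le_iff algebra_simps)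
    qed
  qed (rule c)
qed

text \<open>The maximum of \<open>f\<close> over the ball is attained near \<open>x + \<epsilon> *\<^sub>R (g /\<^sub>R norm g)\<close>: moving a distance \<open>\<epsilon> * d\<close> away
  on the sphere costs \<open>\<epsilon> * norm g * d\<^sup>2 / 2\<close> in the linear term and gains at most \<open>O(\<epsilon>\<^sup>2 * d)\<close> in the quadratic one.\<close>

lemma eventually_SUP_ball_expansion:
  fixes f :: "'a::euclidean_space \<Rightarrow> real"
  assumes g: "g \<noteq> 0" and L: "linear L" and \<eta>: "\<eta> > 0"
    and Taylor: "\<And>\<delta>. \<delta> > 0 \<Longrightarrow> \<exists>r>0. \<forall>z. norm z < r \<longrightarrow> \<bar>f (x + z) - a - g \<bullet> z - (z \<bullet> L z) / 2\<bar> \<le> \<delta> * (norm z)\<^sup>2"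
  shows "\<forall>\<^sub>F \<epsilon> in at_right 0. \<bar>(SUP y\<in>ball x \<epsilon>. f y) - a - \<epsilon> * norm g - (g \<bullet> L g) / (2 * (norm g)\<^sup>2) * \<epsilon>\<^sup>2\<bar> \<le> \<eta> * \<epsilon>\<^sup>2"
proof -
  define G where "G = norm g"
  have G: "G > 0" using g by (simp add: G_def)
  define e where "e = g /\<^sub>R G"
  have e: "norm e = 1" and ge: "g = G *\<^sub>R e" using g by (simp_all add: e_def G_def)
  define \<kappa> where "\<kappa> = (e \<bullet> L e) / 2"
  have \<kappa>: "(g \<bullet> L g) / (2 * (norm g)\<^sup>2) = \<kappa>"
    using G unfolding ge linear_scale[OF L] by (simp add: \<kappa>_def e power2_eq_square)
  obtain C where C: "C > 0" "\<And>y. norm (L y) \<le> C * norm y"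
    using linear_bounded_pos[OF L] by blast
  have quad: "g \<bullet> y + \<epsilon> * ((y \<bullet> L y) / 2) \<le> G + \<epsilon> * \<kappa> + C\<^sup>2 * \<epsilon>\<^sup>2 / (2 * G)" if y: "norm y \<le> 1" and \<epsilon>: "\<epsilon> > 0" for y \<epsilon>
  proof -
    define d where "d = norm (y - e)"
    have "d\<^sup>2 = (norm y)\<^sup>2 + 1 - 2 * (y \<bullet> e)"
      unfolding d_def power2_norm_eq_inner using e by (simp add: inner_diff_left inner_diff_right inner_commute norm_eq_1)
    also have "\<dots> \<le> 1 + 1 - 2 * (y \<bullet> e)" using power_le_one[OF norm_ge_zero y, of 2] by simp
    finally have "y \<bullet> e \<le> 1 - d\<^sup>2 / 2" by simp
    then have "G * (y \<bullet> e) \<le> G * (1 - d\<^sup>2 / 2)" using G by (intro mult_left_mono) auto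
    then have lin: "g \<bullet> y \<le> G - G * d\<^sup>2 / 2" unfolding ge by (simp add: inner_commute algebra_simps)
    have "y \<bullet> L y - e \<bullet> L e = (y - e) \<bullet> L y + e \<bullet> L (y - e)"
      by (simp add: linear_diff[OF L] inner_diff_left inner_diff_right)
    also have "\<dots> \<le> d * (C * 1) + 1 * (C * d)"
    proof (rule add_mono)
      have "(y - e) \<bullet> L y \<le> norm (y - e) * norm (L y)" by (rule norm_cauchy_schwarz)
      also have "\<dots> \<le> d * (C * 1)" unfolding d_def
        using y C by (intro mult_left_mono order_trans[OF C(2)]) auto
      finally show "(y - e) \<bullet> L y \<le> d * (C * 1)" .
      have "e \<bullet> L (y - e) \<le> norm e * norm (L (y - e))" by (rule norm_cauchy_schwarz)
      also have "\<dots> \<le> 1 * (C * d)" unfolding d_def e using C(2) by (intro mult_left_mono) auto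
      finally show "e \<bullet> L (y - e) \<le> 1 * (C * d)" .
    qed
    finally have "(y \<bullet> L y) / 2 \<le> \<kappa> + C * d" by (simp add: \<kappa>_def)
    then have "\<epsilon> * ((y \<bullet> L y) / 2) \<le> \<epsilon> * (\<kappa> + C * d)" using \<epsilon> by (intro mult_left_mono) auto
    \<comment> \<open>Completing the square: the quadratic cost of leaving \<open>e\<close> absorbs
      the gain \<open>\<epsilon> * (C * d)\<close> up to a term of order
      \<open>\<epsilon>\<^sup>2\<close>, which becomes order \<open>\<epsilon>\<^sup>3\<close> after
      scaling back.\<close>
    moreover have "\<epsilon> * (C * d) \<le> G * d\<^sup>2 / 2 + C\<^sup>2 * \<epsilon>\<^sup>2 / (2 * G)"
    proof -
      have "0 \<le> (G * d - C * \<epsilon>)\<^sup>2 / (2 * G)" using G by simp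
      also have "\<dots> = G * d\<^sup>2 / 2 + C\<^sup>2 * \<epsilon>\<^sup>2 / (2 * G) - \<epsilon> * (C * d)"
        using G by (simp add: power2_eq_square field_simps)
      finally show ?thesis by simp
    qed
    ultimately show ?thesis using lin by (simp add: algebra_simps)
  qed
  have \<eta>2: "\<eta> / 2 > 0" using \<eta> by simp
  obtain r where r: "r > 0" and T: "\<And>z. norm z < r \<Longrightarrow> \<bar>f (x + z) - a - g \<bullet> z - (z \<bullet> L z) / 2\<bar> \<le> \<eta> / 2 * (norm z)\<^sup>2"
    using Taylor[OF \<eta>2] by blast
  \<comment> \<open>The second bound makes the cubic error
    \<open>C\<^sup>2 * \<epsilon> ^ 3 / (2 * G)\<close> at most
    \<open>\<eta> / 2 * \<epsilon>\<^sup>2\<close>; the other half of \<open>\<eta>\<close> pays for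
    the Taylor remainder.\<close>
  define \<rho> where "\<rho> = min r (\<eta> * G / C\<^sup>2)"
  have "\<rho> > 0" using r \<eta> G C by (simp add: \<rho>_def)
  then have "\<forall>\<^sub>F \<epsilon> in at_right 0. 0 < \<epsilon> \<and> \<epsilon> < \<rho>"
    by (auto simp: eventually_at_right_field)
  then show ?thesis
  proof eventually_elim
    case (elim \<epsilon>)
    then have \<epsilon>: "0 < \<epsilon>" "\<epsilon> < r" "\<epsilon> < \<eta> * G / C\<^sup>2" by (auto simp: \<rho>_def)
    have Cs: "C\<^sup>2 * \<epsilon> / (2 * G) \<le> \<eta> / 2" using \<epsilon>(3) G C by (simp add: field_simps)
    have upper: "f y \<le> a + \<epsilon> * G + (\<kappa> + \<eta>) * \<epsilon>\<^sup>2" if y: "y \<in> ball x \<epsilon>" for y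
    proof -
      define z where "z = (y - x) /\<^sub>R \<epsilon>"
      have yz: "y = x + \<epsilon> *\<^sub>R z" using \<epsilon>(1) by (simp add: z_def)
      have "norm z = norm (y - x) / \<epsilon>" using \<epsilon>(1) by (simp add: z_def divide_inverse mult.commute)
      then have z: "norm z \<le> 1" using y \<epsilon>(1) by (simp add: dist_norm norm_minus_commute)
      have nz: "norm (\<epsilon> *\<^sub>R z) \<le> \<epsilon>" using z \<epsilon>(1) by (simp add: mult_left_le)
      have "f y \<le> a + g \<bullet> (\<epsilon> *\<^sub>R z) + ((\<epsilon> *\<^sub>R z) \<bullet> L (\<epsilon> *\<^sub>R z)) / 2 + \<eta> / 2 * (norm (\<epsilon> *\<^sub>R z))\<^sup>2"
        using T[of "\<epsilon> *\<^sub>R z"] nz \<epsilon> unfolding yz by linarith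
      also have "\<dots> \<le> a + \<epsilon> * (g \<bullet> z + \<epsilon> * ((z \<bullet> L z) / 2)) + \<eta> / 2 * \<epsilon>\<^sup>2"
      proof -
        have "\<eta> / 2 * (norm (\<epsilon> *\<^sub>R z))\<^sup>2 \<le> \<eta> / 2 * \<epsilon>\<^sup>2"
          using nz \<eta> by (intro mult_left_mono power_mono) auto
        then show ?thesis by (simp add: linear_scale[OF L] algebra_simps)
      qed
      also have "\<dots> \<le> a + \<epsilon> * (G + \<epsilon> * \<kappa> + C\<^sup>2 * \<epsilon>\<^sup>2 / (2 * G)) + \<eta> / 2 * \<epsilon>\<^sup>2"
        using mult_left_mono[OF quad[OF z \<epsilon>(1)], of \<epsilon>] \<epsilon>(1) by simp
      also have "\<dots> = a + \<epsilon> * G + \<kappa> * \<epsilon>\<^sup>2 + (C\<^sup>2 * \<epsilon> / (2 * G)) * \<epsilon>\<^sup>2 + \<eta> / 2 * \<epsilon>\<^sup>2"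
        by (simp add: power2_eq_square algebra_simps)
      also have "\<dots> \<le> a + \<epsilon> * G + \<kappa> * \<epsilon>\<^sup>2 + (\<eta> / 2) * \<epsilon>\<^sup>2 + \<eta> / 2 * \<epsilon>\<^sup>2"
        using Cs by (intro add_mono mult_right_mono order_refl) auto
      also have "\<dots> = a + \<epsilon> * G + (\<kappa> + \<eta>) * \<epsilon>\<^sup>2" by (simp add: algebra_simps)
      finally show ?thesis .
    qed
    then have bdd: "bdd_above (f ` ball x \<epsilon>)" by (intro bdd_aboveI2)
    have ne: "ball x \<epsilon> \<noteq> {}" using \<epsilon>(1) by simp
    have le: "(SUP y\<in>ball x \<epsilon>. f y) \<le> a + \<epsilon> * G + (\<kappa> + \<eta>) * \<epsilon>\<^sup>2"
      using upper ne by (intro cSUP_least)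
    \<comment> \<open>The ball is open, so the boundary point
      \<open>x + \<epsilon> *\<^sub>R e\<close> is approached through \<open>s < 1\<close>, and
      \<open>s\<close> then tends to 1.\<close>
    have low: "a + s * \<epsilon> * G + s\<^sup>2 * \<epsilon>\<^sup>2 * \<kappa> - \<eta> * \<epsilon>\<^sup>2 \<le> (SUP y\<in>ball x \<epsilon>. f y)" if s: "0 < s" "s < 1" for s
    proof -
      define z where "z = (s * \<epsilon>) *\<^sub>R e"
      have nz: "norm z = s * \<epsilon>" using e s \<epsilon> by (simp add: z_def)
      have "s * \<epsilon> < \<epsilon>" using s \<epsilon> by simp
      have gz: "g \<bullet> z = s * \<epsilon> * G" using e by (simp add: ge z_def norm_eq_1)
      have zz: "(z \<bullet> L z) / 2 = s\<^sup>2 * \<epsilon>\<^sup>2 * \<kappa>" by (simp add: z_def linear_scale[OF L] \<kappa>_def power2_eq_square)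
      have "a + s * \<epsilon> * G + s\<^sup>2 * \<epsilon>\<^sup>2 * \<kappa> - \<eta> / 2 * (norm z)\<^sup>2 \<le> f (x + z)"
        using T[of z] \<open>s * \<epsilon> < \<epsilon>\<close> \<epsilon> unfolding nz gz zz by linarith
      moreover have "\<eta> / 2 * (norm z)\<^sup>2 \<le> \<eta> * \<epsilon>\<^sup>2"
        unfolding nz using \<open>s * \<epsilon> < \<epsilon>\<close> \<eta> s \<epsilon> by (intro mult_mono power_mono) auto
      moreover have "f (x + z) \<le> (SUP y\<in>ball x \<epsilon>. f y)"
        using nz \<open>s * \<epsilon> < \<epsilon>\<close> by (intro cSUP_upper bdd) (simp add: dist_norm)
      ultimately show ?thesis by linarith
    qed
    have "((\<lambda>s. a + s * \<epsilon> * G + s\<^sup>2 * \<epsilon>\<^sup>2 * \<kappa> - \<eta> * \<epsilon>\<^sup>2) \<longlongrightarrow> a + 1 * \<epsilon> * G + 1\<^sup>2 * \<epsilon>\<^sup>2 * \<kappa> - \<eta> * \<epsilon>\<^sup>2) (at_left 1)"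
      by (intro tendsto_intros)
    moreover have "\<forall>\<^sub>F s in at_left 1. a + s * \<epsilon> * G + s\<^sup>2 * \<epsilon>\<^sup>2 * \<kappa> - \<eta> * \<epsilon>\<^sup>2 \<le> (SUP y\<in>ball x \<epsilon>. f y)"
      unfolding eventually_at_left_field using low by (intro exI[of _ 0]) auto
    ultimately have "a + 1 * \<epsilon> * G + 1\<^sup>2 * \<epsilon>\<^sup>2 * \<kappa> - \<eta> * \<epsilon>\<^sup>2 \<le> (SUP y\<in>ball x \<epsilon>. f y)"
      by (rule tendsto_upperbound) simp
    then show ?case unfolding \<kappa> unfolding G_def[symmetric] using le by (simp add: abs_le_iff algebra_simps)
  qed
qed

text \<open>The infimum is minus the supremum of \<open>- \<phi>\<close>. In the midpoint the terms
  \<open>\<epsilon> * norm G\<close> cancel while the second-order terms agree, which gives the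
  constant \<open>1 / 2\<close>.\<close>

lemma p_mean_expansion_infinity:
  fixes \<phi> :: "real^'n \<Rightarrow> real"
  assumes C2: "C2_near \<phi> x" and g: "gradient \<phi> x \<noteq> 0" and \<eta>: "\<eta> > 0"
  shows "\<forall>\<^sub>F \<epsilon> in at_right 0. \<bar>p_mean \<infinity> \<epsilon> \<phi> x - \<phi> x - 1 / 2 * normalized_p_laplacian \<infinity> \<phi> x * \<epsilon>\<^sup>2\<bar> \<le> \<eta> * \<epsilon>\<^sup>2"
proof -
  define G where "G = gradient \<phi> x"
  define L where "L z = hessian \<phi> x *v z" for z
  have L: "linear L" unfolding L_def[abs_def] by (rule matrix_vector_mul_linear)
  have L': "linear (\<lambda>z. - L z)" using L by (rule linear_compose_neg)
  define \<kappa> where "\<kappa> = (G \<bullet> L G) / (2 * (norm G)\<^sup>2)"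
  have \<Delta>: "1 / 2 * normalized_p_laplacian \<infinity> \<phi> x = \<kappa>"
    by (simp add: normalized_p_laplacian_def \<kappa>_def L_def G_def inner_commute)
  have Taylor: "\<exists>r>0. \<forall>z. norm z < r \<longrightarrow> \<bar>\<phi> (x + z) - \<phi> x - G \<bullet> z - (z \<bullet> L z) / 2\<bar> \<le> \<delta> * (norm z)\<^sup>2" if "\<delta> > 0" for \<delta>
    using C2_near_Taylor[OF C2 that] unfolding G_def L_def .
  have Taylor': "\<exists>r>0. \<forall>z. norm z < r \<longrightarrow> \<bar>- \<phi> (x + z) - - \<phi> x - (- G) \<bullet> z - (z \<bullet> - L z) / 2\<bar> \<le> \<delta> * (norm z)\<^sup>2" if "\<delta> > 0" for \<delta>
  proof -
    have "\<bar>- \<phi> (x + z) - - \<phi> x - (- G) \<bullet> z - (z \<bullet> - L z) / 2\<bar> = \<bar>\<phi> (x + z) - \<phi> x - G \<bullet> z - (z \<bullet> L z) / 2\<bar>" for z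
      by (simp add: abs_if)
    then show ?thesis using Taylor[OF that] by (simp only:)
  qed
  have g0: "G \<noteq> 0" "- G \<noteq> 0" using g by (simp_all add: G_def)
  obtain R where R: "R > 0" and cont: "continuous_on (cball x R) \<phi>"
    using C2_near_continuous[OF C2] .
  obtain K where K: "\<And>y. y \<in> cball x R \<Longrightarrow> \<bar>\<phi> y\<bar> \<le> K"
    using continuous_on_cball_bounded[OF cont] by blast
  have sup: "\<forall>\<^sub>F \<epsilon> in at_right 0. \<bar>(SUP y\<in>ball x \<epsilon>. \<phi> y) - \<phi> x - \<epsilon> * norm G - (G \<bullet> L G) / (2 * (norm G)\<^sup>2) * \<epsilon>\<^sup>2\<bar> \<le> \<eta> * \<epsilon>\<^sup>2"
    by (rule eventually_SUP_ball_expansion[OF g0(1) L \<eta> Taylor])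
  have sup': "\<forall>\<^sub>F \<epsilon> in at_right 0. \<bar>(SUP y\<in>ball x \<epsilon>. - \<phi> y) - - \<phi> x - \<epsilon> * norm (- G)
      - ((- G) \<bullet> - L (- G)) / (2 * (norm (- G))\<^sup>2) * \<epsilon>\<^sup>2\<bar> \<le> \<eta> * \<epsilon>\<^sup>2"
    by (rule eventually_SUP_ball_expansion[OF g0(2) L' \<eta> Taylor'])
  have "\<forall>\<^sub>F \<epsilon> in at_right 0. 0 < \<epsilon> \<and> \<epsilon> < R" using R by (auto simp: eventually_at_right_field)
  then show ?thesis
    using sup sup'
  proof eventually_elim
    case (elim \<epsilon>)
    have cont': "continuous_on (ball x \<epsilon>) \<phi>" using cont elim by (auto intro: continuous_on_subset)
    have K': "\<bar>\<phi> y\<bar> \<le> K" if "y \<in> ball x \<epsilon>" for y using that elim by (intro K) auto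
    have pm: "p_mean \<infinity> \<epsilon> \<phi> x = ((SUP y\<in>ball x \<epsilon>. \<phi> y) + (INF y\<in>ball x \<epsilon>. \<phi> y)) / 2"
      \<comment> \<open>\<open>order_refl\<close> instantiates the real exponent of the context with
        1.\<close>
      by (rule p_mean_infinity[OF cont' K' _ order_refl]) (use elim in auto)
    have inf: "(INF y\<in>ball x \<epsilon>. \<phi> y) = - (SUP y\<in>ball x \<epsilon>. - \<phi> y)"
      by (simp add: Inf_real_def image_image)
    have \<kappa>': "((- G) \<bullet> - L (- G)) / (2 * (norm (- G))\<^sup>2) = - \<kappa>"
      by (simp add: \<kappa>_def linear_neg[OF L])
    have "\<bar>(SUP y\<in>ball x \<epsilon>. \<phi> y) - \<phi> x - \<epsilon> * norm G - \<kappa> * \<epsilon>\<^sup>2\<bar> \<le> \<eta> * \<epsilon>\<^sup>2"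
      using elim(2) by (simp only: \<kappa>_def)
    moreover have "\<bar>(SUP y\<in>ball x \<epsilon>. - \<phi> y) + \<phi> x - \<epsilon> * norm G + \<kappa> * \<epsilon>\<^sup>2\<bar> \<le> \<eta> * \<epsilon>\<^sup>2"
      using elim(3) unfolding \<kappa>' by simp
    ultimately show ?case unfolding \<Delta> pm inf by (auto simp: abs_le_iff field_simps)
  qed
qed

section \<open>From the expansion to the sign of the normalized Laplacian\<close>

lemma p_mean_expansion:
  fixes \<phi> :: "real^'n \<Rightarrow> real" and p :: ereal
  assumes C2: "C2_near \<phi> x" and g: "gradient \<phi> x \<noteq> 0" and p: "1 \<le> p"
  shows "\<exists>c>0. (\<lambda>\<epsilon>. p_mean p \<epsilon> \<phi> x - \<phi> x - c * normalized_p_laplacian p \<phi> x * \<epsilon>\<^sup>2) \<in> o[at_right 0](\<lambda>\<epsilon>. \<epsilon>\<^sup>2)"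
proof -
  have "\<exists>c>0. \<forall>\<eta>>0. \<forall>\<^sub>F \<epsilon> in at_right 0.
    \<bar>p_mean p \<epsilon> \<phi> x - \<phi> x - c * normalized_p_laplacian p \<phi> x * \<epsilon>\<^sup>2\<bar> \<le> \<eta> * \<epsilon>\<^sup>2"
  proof (cases p)
    case (real r)
    then show ?thesis using p_mean_expansion_finite[OF C2 g, of r] p by simp
  next
    case PInf
    then show ?thesis using p_mean_expansion_infinity[OF C2 g] by (intro exI[of _ "1/2"]) simp
  qed (use p in simp)
  then show ?thesis by (auto intro!: landau_o.smallI)
qed

text \<open>Since \<open>c > 0\<close>, the term \<open>c * \<Delta> * \<epsilon>\<^sup>2\<close>
  dominates every error of smaller order unless \<open>\<Delta> = 0\<close>. Conversely, the negated
  remainder \<open>- \<rho>\<close> of the expansion is the required error in both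
  comparisons.\<close>

lemma p_mean_comparison_iff_laplacian_sign:
  fixes \<phi> :: "real^'n \<Rightarrow> real" and p :: ereal
  assumes C2: "C2_near \<phi> x" and g: "gradient \<phi> x \<noteq> 0" and p: "1 \<le> p"
  shows "(\<exists>r\<in>o[at_right 0](\<lambda>\<epsilon>. \<epsilon>\<^sup>2). \<forall>\<^sub>F \<epsilon> in at_right 0. \<phi> x \<ge> p_mean p \<epsilon> \<phi> x + r \<epsilon>)
      \<longleftrightarrow> normalized_p_laplacian p \<phi> x \<le> 0"
    and "(\<exists>r\<in>o[at_right 0](\<lambda>\<epsilon>. \<epsilon>\<^sup>2). \<forall>\<^sub>F \<epsilon> in at_right 0. \<phi> x \<le> p_mean p \<epsilon> \<phi> x + r \<epsilon>)
      \<longleftrightarrow> normalized_p_laplacian p \<phi> x \<ge> 0"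
proof -
  define \<Delta> where "\<Delta> = normalized_p_laplacian p \<phi> x"
  obtain c where c: "c > 0" and o: "(\<lambda>\<epsilon>. p_mean p \<epsilon> \<phi> x - \<phi> x - c * \<Delta> * \<epsilon>\<^sup>2) \<in> o[at_right 0](\<lambda>\<epsilon>. \<epsilon>\<^sup>2)"
    using p_mean_expansion[OF assms] unfolding \<Delta>_def by blast
  define \<rho> where "\<rho> \<epsilon> = p_mean p \<epsilon> \<phi> x - \<phi> x - c * \<Delta> * \<epsilon>\<^sup>2" for \<epsilon>
  have \<rho>: "\<rho> \<in> o[at_right 0](\<lambda>\<epsilon>. \<epsilon>\<^sup>2)" using o by (simp add: \<rho>_def[abs_def])
  have sq: "\<forall>\<^sub>F \<epsilon> in at_right 0. (0::real) < \<epsilon>" by (rule eventually_at_right_less)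
  \<comment> \<open>A positive \<open>k\<close> would contradict the small-o bound with constant
    \<open>k / 2\<close> at small positive radii.\<close>
  have nonpos: "k \<le> 0" if s: "s \<in> o[at_right 0](\<lambda>\<epsilon>. \<epsilon>\<^sup>2)" and "\<forall>\<^sub>F \<epsilon> in at_right 0. k * \<epsilon>\<^sup>2 \<le> s \<epsilon>" for k and s :: "real \<Rightarrow> real"
  proof (rule ccontr)
    assume "\<not> k \<le> 0"
    then have "k / 2 > 0" by simp
    from landau_o.smallD[OF s this] sq that(2)
    have "\<forall>\<^sub>F \<epsilon> in at_right (0::real). False"
    proof eventually_elim
      case (elim \<epsilon>)
      have "0 < k * \<epsilon>\<^sup>2" using elim(2) \<open>\<not> k \<le> 0\<close> by simp
      then show False using elim(1,3) by simp
    qed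
    then show False by simp
  qed
  have m: "(\<lambda>\<epsilon>. - \<rho> \<epsilon>) \<in> o[at_right 0](\<lambda>\<epsilon>. \<epsilon>\<^sup>2)" using \<rho> by simp
  show "(\<exists>r\<in>o[at_right 0](\<lambda>\<epsilon>. \<epsilon>\<^sup>2). \<forall>\<^sub>F \<epsilon> in at_right 0. \<phi> x \<ge> p_mean p \<epsilon> \<phi> x + r \<epsilon>)
      \<longleftrightarrow> normalized_p_laplacian p \<phi> x \<le> 0"
    unfolding \<Delta>_def[symmetric]
  proof
    assume "\<exists>r\<in>o[at_right 0](\<lambda>\<epsilon>. \<epsilon>\<^sup>2). \<forall>\<^sub>F \<epsilon> in at_right 0. \<phi> x \<ge> p_mean p \<epsilon> \<phi> x + r \<epsilon>"
    then obtain r where r: "r \<in> o[at_right 0](\<lambda>\<epsilon>. \<epsilon>\<^sup>2)" "\<forall>\<^sub>F \<epsilon> in at_right 0. \<phi> x \<ge> p_mean p \<epsilon> \<phi> x + r \<epsilon>" by blast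
    have "c * \<Delta> \<le> 0"
    proof (rule nonpos)
      show "(\<lambda>\<epsilon>. - \<rho> \<epsilon> - r \<epsilon>) \<in> o[at_right 0](\<lambda>\<epsilon>. \<epsilon>\<^sup>2)" using m r(1) by (rule sum_in_smallo)
      show "\<forall>\<^sub>F \<epsilon> in at_right 0. c * \<Delta> * \<epsilon>\<^sup>2 \<le> - \<rho> \<epsilon> - r \<epsilon>"
        using r(2) by eventually_elim (simp add: \<rho>_def)
    qed
    then show "\<Delta> \<le> 0" using c by (simp add: mult_le_0_iff)
  next
    assume "\<Delta> \<le> 0"
    then have "c * \<Delta> * \<epsilon>\<^sup>2 \<le> 0" for \<epsilon> using c by (simp add: mult_nonneg_nonpos mult_nonpos_nonneg)
    then have "\<forall>\<^sub>F \<epsilon> in at_right 0. \<phi> x \<ge> p_mean p \<epsilon> \<phi> x + - \<rho> \<epsilon>" by (simp add: \<rho>_def)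
    with m show "\<exists>r\<in>o[at_right 0](\<lambda>\<epsilon>. \<epsilon>\<^sup>2). \<forall>\<^sub>F \<epsilon> in at_right 0. \<phi> x \<ge> p_mean p \<epsilon> \<phi> x + r \<epsilon>"
      by (intro bexI[of _ "\<lambda>\<epsilon>. - \<rho> \<epsilon>"])
  qed
  show "(\<exists>r\<in>o[at_right 0](\<lambda>\<epsilon>. \<epsilon>\<^sup>2). \<forall>\<^sub>F \<epsilon> in at_right 0. \<phi> x \<le> p_mean p \<epsilon> \<phi> x + r \<epsilon>)
      \<longleftrightarrow> normalized_p_laplacian p \<phi> x \<ge> 0"
    unfolding \<Delta>_def[symmetric]
  proof
    assume "\<exists>r\<in>o[at_right 0](\<lambda>\<epsilon>. \<epsilon>\<^sup>2). \<forall>\<^sub>F \<epsilon> in at_right 0. \<phi> x \<le> p_mean p \<epsilon> \<phi> x + r \<epsilon>"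
    then obtain r where r: "r \<in> o[at_right 0](\<lambda>\<epsilon>. \<epsilon>\<^sup>2)" "\<forall>\<^sub>F \<epsilon> in at_right 0. \<phi> x \<le> p_mean p \<epsilon> \<phi> x + r \<epsilon>" by blast
    have "- (c * \<Delta>) \<le> 0"
    proof (rule nonpos)
      show "(\<lambda>\<epsilon>. \<rho> \<epsilon> + r \<epsilon>) \<in> o[at_right 0](\<lambda>\<epsilon>. \<epsilon>\<^sup>2)" using \<rho> r(1) by (rule sum_in_smallo)
      show "\<forall>\<^sub>F \<epsilon> in at_right 0. - (c * \<Delta>) * \<epsilon>\<^sup>2 \<le> \<rho> \<epsilon> + r \<epsilon>"
        using r(2) by eventually_elim (simp add: \<rho>_def)
    qed
    then show "\<Delta> \<ge> 0" using c by (simp add: zero_le_mult_iff)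
  next
    assume "\<Delta> \<ge> 0"
    then have "0 \<le> c * \<Delta> * \<epsilon>\<^sup>2" for \<epsilon> using c by simp
    then have "\<forall>\<^sub>F \<epsilon> in at_right 0. \<phi> x \<le> p_mean p \<epsilon> \<phi> x + - \<rho> \<epsilon>" by (simp add: \<rho>_def)
    with m show "\<exists>r\<in>o[at_right 0](\<lambda>\<epsilon>. \<epsilon>\<^sup>2). \<forall>\<^sub>F \<epsilon> in at_right 0. \<phi> x \<le> p_mean p \<epsilon> \<phi> x + r \<epsilon>"
      by (intro bexI[of _ "\<lambda>\<epsilon>. - \<rho> \<epsilon>"])
  qed
qed

theorem theorem1p1:
  fixes p :: ereal and \<Omega> :: "(real^'n) set" and u :: "real^'n \<Rightarrow> real"
  assumes "1 \<le> p" and "open \<Omega>" and "continuous_on \<Omega> u"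
  shows "viscosity_solution p \<Omega> u \<longleftrightarrow> (\<forall>x\<in>\<Omega>. viscosity_mean_value p u x)"
proof -
  \<comment> \<open>The equivalence already holds for each test function at each point, under the
    same admissibility condition on both sides.\<close>
  have "(C2_near \<phi> x \<and> strict_local_min (\<lambda>y. u y - \<phi> y) x \<and> u x = \<phi> x \<and> gradient \<phi> x \<noteq> 0
        \<longrightarrow> normalized_p_laplacian p \<phi> x \<le> 0) \<longleftrightarrow>
      (C2_near \<phi> x \<and> strict_local_min (\<lambda>y. u y - \<phi> y) x \<and> u x = \<phi> x \<and> gradient \<phi> x \<noteq> 0
        \<longrightarrow> (\<exists>r\<in>o[at_right 0](\<lambda>\<epsilon>. \<epsilon>\<^sup>2). \<forall>\<^sub>F \<epsilon> in at_right 0. \<phi> x \<ge> p_mean p \<epsilon> \<phi> x + r \<epsilon>))"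
    and "(C2_near \<phi> x \<and> strict_local_max (\<lambda>y. u y - \<phi> y) x \<and> u x = \<phi> x \<and> gradient \<phi> x \<noteq> 0
        \<longrightarrow> normalized_p_laplacian p \<phi> x \<ge> 0) \<longleftrightarrow>
      (C2_near \<phi> x \<and> strict_local_max (\<lambda>y. u y - \<phi> y) x \<and> u x = \<phi> x \<and> gradient \<phi> x \<noteq> 0
        \<longrightarrow> (\<exists>r\<in>o[at_right 0](\<lambda>\<epsilon>. \<epsilon>\<^sup>2). \<forall>\<^sub>F \<epsilon> in at_right 0. \<phi> x \<le> p_mean p \<epsilon> \<phi> x + r \<epsilon>))" for \<phi> x
    using p_mean_comparison_iff_laplacian_sign[of \<phi> x p] assms(1) by blast+
  then show ?thesis
    unfolding viscosity_solution_def viscosity_mean_value_def by presburger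
qed

end
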